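(* Assume $\gamma\in(1,2)$ and $\alpha>1-\gamma^{-1}$. Then $h_c(\beta)>0$ for all $\beta\in(0,1)$. Furthermore $$\lim_{\beta\to0+}\frac{\log h_c(\beta)}{\log\beta}=\begin{cases}\dfrac{\alpha\gamma}{(\alpha-1)\gamma+1}&\text{if }\alpha\in(1-\gamma^{-1},1),\\[2mm] \gamma&\text{if }\alpha\ge1.\end{cases}$$
   Context: Renewal: $\tau=(\tau_n)_{n\ge0}$ is a renewal process under $\mathbf P$ (expectation $\mathbf E$), $\tau_0=0$, with i.i.d. positive integer increments of law $K(n):=\mathbf P[\tau_1=n]$, $\sum_{n\ge1}K(n)=1$ (recurrent), and $K(n)\sim C_K n^{-(1+\alpha)}$ as $n\to\infty$ for some constant $C_K>0$ and $\alpha\in(0,\infty)$. $\tau$ is also viewed as a random subset of the nonnegative integers. Environment: $(\omega_n)_{n\ge0}$ are i.i.d. real random variables under $\mathbb P$ (expectation $\mathbb E$) with $\mathbb P[\omega_1\ge-1]=1$, $\mathbb E[\omega_1]=0$ and $\mathbb P[\omega_1\ge x]\sim C_{\mathbb P}x^{-\gamma}$ as $x\to\infty$, for some constant $C_{\mathbb P}>0$ and $\gamma\in(1,2)$. Pinning model: for $\beta\in[0,1)$, $h\in\mathbb R$, $N\in\mathbb N$, $$Z^{\beta,\omega}_{N,h}:=\mathbf E\Big[\Big(\prod_{n\in\tau\cap[1,N]}e^h(\beta\omega_n+1)\Big)\mathbf 1_{\{N\in\tau\}}\Big].$$ Free energy: $\mathrm F(\beta,h):=\lim_{N\to\infty}\frac1N\log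 Z^{\beta,\omega}_{N,h}$ ($\mathbb P$-a.s. limit, which is known to exist, to be finite, nonnegative, non-random, and equal to $\lim_N\frac1N\mathbb E[\log Z^{\beta,\omega}_{N,h}]$); it is non-decreasing and convex in $h$. Critical point: $h_c(\beta):=\inf\{h\in\mathbb R:\mathrm F(\beta,h)>0\}$. *)

theory Defs
  imports "HOL-Probability.Probability" "HOL-Library.Landau_Symbols"
begin

(* K 0 is left unconstrained: the increments are almost surely positive.  The differences are
   truncated natural-number subtraction, which is harmless because of increments_pos. *)
locale renewal_process = prob_space P for P :: "'b measure" +
  fixes \<tau> :: "nat \<Rightarrow> 'b \<Rightarrow> nat" and K :: "nat \<Rightarrow> real"
  assumes renewal_measurable: "\<And>n. \<tau> n \<in> measurable P (count_space UNIV)"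
    and renewal_0: "AE t in P. \<tau> 0 t = 0"
    and increments_pos: "\<And>n. AE t in P. \<tau> n t < \<tau> (Suc n) t"
    and increments_indep: "indep_vars (\<lambda>_. count_space UNIV) (\<lambda>n t. \<tau> (Suc n) t - \<tau> n t) UNIV"
    and increments_law: "\<And>n k. k \<ge> 1 \<Longrightarrow> prob {t \<in> space P. \<tau> (Suc n) t - \<tau> n t = k} = K k"
    and recurrent: "(\<lambda>k. K (Suc k)) sums 1"

locale iid_environment = prob_space M for M :: "'a measure" +
  fixes \<omega> :: "nat \<Rightarrow> 'a \<Rightarrow> real"
  assumes environment_indep: "indep_vars (\<lambda>_. borel) \<omega> UNIV"
    and environment_identical: "\<And>n. distr M borel (\<omega> n) = distr M borel (\<omega> 1)"

definition renewal_set :: "(nat \<Rightarrow> 'b \<Rightarrow> nat) \<Rightarrow> 'b \<Rightarrow> nat set" where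
  "renewal_set \<tau> t = range (\<lambda>k. \<tau> k t)"

(* Quenched: w is one fixed realisation of the environment, only the renewal is averaged. *)
definition partition_function ::
    "'b measure \<Rightarrow> (nat \<Rightarrow> 'b \<Rightarrow> nat) \<Rightarrow> (nat \<Rightarrow> real) \<Rightarrow> real \<Rightarrow> real \<Rightarrow> nat \<Rightarrow> real" where
  "partition_function P \<tau> w \<beta> h N =
     (LINT t|P. (\<Prod>n\<in>renewal_set \<tau> t \<inter> {1..N}. exp h * (\<beta> * w n + 1))
                * indicator {s. N \<in> renewal_set \<tau> s} t)"

(* The (non-random) almost sure limit.  Finitely many N may have partition function 0
   (N not reachable by the renewal); there ln 0 = 0, without effect on the limit. *)
definition free_energy ::
    "'a measure \<Rightarrow> (nat \<Rightarrow> 'a \<Rightarrow> real) \<Rightarrow> 'b measure \<Rightarrow> (nat \<Rightarrow> 'b \<Rightarrow> nat) \<Rightarrow> real \<Rightarrow> real \<Rightarrow> real" where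
  "free_energy M \<omega> P \<tau> \<beta> h =
     (THE f. AE x in M.
        (\<lambda>N. 1 / real N * ln (partition_function P \<tau> (\<lambda>n. \<omega> n x) \<beta> h N)) \<longlonglongrightarrow> f)"

definition critical_point ::
    "'a measure \<Rightarrow> (nat \<Rightarrow> 'a \<Rightarrow> real) \<Rightarrow> 'b measure \<Rightarrow> (nat \<Rightarrow> 'b \<Rightarrow> nat) \<Rightarrow> real \<Rightarrow> real" where
  "critical_point M \<omega> P \<tau> \<beta> = Inf {h. free_energy M \<omega> P \<tau> \<beta> h > 0}"

end

theory Submission
  imports Defs "HOL-Computational_Algebra.Formal_Power_Series" "HOL-Real_Asymp.Real_Asymp"
begin

text \<open>
  Write \<open>a = min \<alpha> 1\<close>. A block of length \<open>l\<close> contains about \<open>l\<^sup>a\<close> contacts, and the disorder becomes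
  relevant on it once \<open>\<beta> l\<^sup>a\<^sup>-\<^sup>1\<^sup>+\<^sup>1\<^sup>/\<^sup>\<gamma>\<close> is of order one, since the fluctuations of the partition
  function over the block are of order \<open>\<beta> (\<Sum>n\<le>l. P(n \<in> \<tau>)\<^sup>\<gamma>)\<^sup>1\<^sup>/\<^sup>\<gamma>\<close>. The critical point should then be
  \<open>l\<^sup>-\<^sup>a\<close> up to a factor \<open>l\<^sup>o\<^sup>(\<^sup>1\<^sup>)\<close>, which gives the claimed exponent.

  Lower bound: damping the environment at the sites with \<open>\<omega>\<^sub>n \<ge> l\<^sup>1\<^sup>/\<^sup>\<gamma>\<close> costs only a constant in Young's
  inequality for \<open>E[Z\<^sup>\<theta>]\<close>, but multiplies the weight of each contact by \<open>1 - c \<beta> l\<^sup>-\<^sup>1\<^sup>+\<^sup>1\<^sup>/\<^sup>\<gamma>\<close>, so that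
  only the trajectories with few contacts survive. As \<open>\<theta>\<close> can be taken close to 1, the resulting
  polynomial gain closes a recursion for the fractional moments, and bounded fractional moments force
  the free energy to vanish.

  Upper bound: a martingale estimate in \<open>L\<^sup>p\<close>, \<open>p < \<gamma>\<close>, shows that the free partition function at
  \<open>h = 0\<close> is close to 1 up to the scale \<open>l\<close>. Almost all its mass is carried by trajectories with at least
  \<open>l\<^sup>a\<^sup>-\<^sup>o\<^sup>(\<^sup>1\<^sup>)\<close> contacts, on which a slightly larger \<open>h\<close> beats the polynomial cost of pinning the
  endpoint.

  Where the free energy is positive, the limit defining it exists by superadditivity of the mean and an
  Efron--Stein bound for the variance of \<open>ln Z\<close>.
\<close>

subsection \<open>Contact kernels\<close>

text \<open>Only a ratio of logarithms is claimed, so every estimate may lose a small power of the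
  scale. Moments of order p < \<gamma> can therefore stand in for the infinite \<gamma>-th moment,
  and few contacts are separated from many at a power slightly below \<open>a\<close>. With \<kappa>
  = a - 1 + 1 / \<gamma> the critical scale solves \<beta> l^\<kappa> = 1, whence l^(-a) =
  \<beta>^(a / \<kappa>); the hypothesis on \<alpha> says exactly that \<kappa> > 0.

  The local renewal bounds rest on the exchangeability of the increments. Together with n K(n) <= C
  P(\<tau>_1 > n) it bounds n P(\<tau>_k = n) by k times a difference that telescopes in k, which
  controls both P(n in \<tau>) and its restriction to few contacts.

  \<open>free_energy\<close> is a definite description and \<open>critical_point\<close> an infimum
  over all real h, so neither has a meaningful value by default. The lower bound is therefore proved
  for every h below a threshold, negative ones included, which also bounds the set from below; the
  upper bound exhibits one h with a positive almost sure limit.\<close>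

locale renewal_kernel =
  fixes K :: "nat \<Rightarrow> real"
  assumes K_0: "K 0 = 0" and K_nonneg: "0 \<le> K n" and K_sums: "K sums 1"
begin

text \<open>
  \<open>W \<xi> k n\<close> is the weight of the trajectories whose \<open>k\<close>-th contact is at \<open>n\<close>, where a contact at \<open>i\<close>
  has weight \<open>\<xi> i\<close>, and \<open>Z\<close> is the pinned partition function. For \<open>\<xi> = 1\<close> they are the renewal
  probabilities \<open>P(\<tau>\<^sub>k = n)\<close> and \<open>P(n \<in> \<tau>)\<close>, and \<open>T n\<close> is \<open>P(\<tau>\<^sub>1 > n)\<close>.
\<close>

fun W :: "(nat \<Rightarrow> real) \<Rightarrow> nat \<Rightarrow> nat \<Rightarrow> real" where
  "W \<xi> 0 n = (if n = 0 then 1 else 0)"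
| "W \<xi> (Suc k) n = \<xi> n * (\<Sum>i\<le>n. W \<xi> k i * K (n - i))"

definition Z :: "(nat \<Rightarrow> real) \<Rightarrow> nat \<Rightarrow> real" where
  "Z \<xi> n = (\<Sum>k\<le>n. W \<xi> k n)"

abbreviation kap :: "nat \<Rightarrow> nat \<Rightarrow> real" where "kap \<equiv> W (\<lambda>_. 1)"
abbreviation u :: "nat \<Rightarrow> real" where "u \<equiv> Z (\<lambda>_. 1)"

definition T :: "nat \<Rightarrow> real" where "T n = 1 - (\<Sum>k\<le>n. K k)"

lemma W_eq_0: "n < k \<Longrightarrow> W \<xi> k n = 0"
proof (induction k arbitrary: n)
  case (Suc k)
  have "W \<xi> k i * K (n - i) = 0" if "i \<le> n" for i
    using that Suc by (cases "i = n") (auto simp: K_0)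
  then have "(\<Sum>i\<le>n. W \<xi> k i * K (n - i)) = 0" by (intro sum.neutral) auto
  then show ?case by simp
qed simp

text \<open>Site 0 carries no weight: \<open>W \<xi> (Suc k) 0\<close> vanishes because
  \<open>K 0 = 0\<close>. Hence only the weights at 1, ..., n matter, here and in the congruence
  rule.\<close>

lemma W_nonneg: "(\<And>i. 1 \<le> i \<Longrightarrow> i \<le> n \<Longrightarrow> 0 \<le> \<xi> i) \<Longrightarrow> 0 \<le> W \<xi> k n"
proof (induction k arbitrary: n)
  case (Suc k)
  show ?case
  proof (cases "n = 0")
    case True
    then show ?thesis by (simp add: K_0)
  next
    case False
    then show ?thesis
      using Suc by (auto intro!: mult_nonneg_nonneg sum_nonneg K_nonneg)
  qed
qed simp

lemma W_cong: "(\<And>i. 1 \<le> i \<Longrightarrow> i \<le> n \<Longrightarrow> \<xi> i = \<xi>' i) \<Longrightarrow> W \<xi> k n = W \<xi>' k n"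
proof (induction k arbitrary: n)
  case (Suc k)
  show ?case
  proof (cases "n = 0")
    case True
    then show ?thesis by (simp add: K_0)
  next
    case False
    then show ?thesis using Suc by (auto intro!: sum.cong)
  qed
qed simp

lemma W_scale: "W (\<lambda>i. c * \<xi> i) k n = c ^ k * W \<xi> k n"
  by (induction k arbitrary: n) (auto simp: sum_distrib_left algebra_simps)

lemma Z_0 [simp]: "Z \<xi> 0 = 1"
  by (simp add: Z_def)

lemma Z_eq_sum: "n \<le> m \<Longrightarrow> Z \<xi> n = (\<Sum>k\<le>m. W \<xi> k n)"
  unfolding Z_def by (rule sum.mono_neutral_left) (auto simp: W_eq_0)

lemma Z_rec:
  assumes "0 < n"
  shows "Z \<xi> n = \<xi> n * (\<Sum>m<n. Z \<xi> m * K (n - m))"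
proof -
  obtain l where l: "n = Suc l" using assms by (cases n) auto
  have "Z \<xi> n = (\<Sum>k\<le>l. W \<xi> (Suc k) n)"
    unfolding Z_def l by (subst sum.atMost_Suc_shift) simp
  also have "\<dots> = \<xi> n * (\<Sum>k\<le>l. \<Sum>i\<le>n. W \<xi> k i * K (n - i))"
    by (simp add: sum_distrib_left)
  also have "(\<Sum>k\<le>l. \<Sum>i\<le>n. W \<xi> k i * K (n - i)) = (\<Sum>i\<le>n. (\<Sum>k\<le>l. W \<xi> k i) * K (n - i))"
    by (subst sum.swap) (simp add: sum_distrib_right)
  also have "\<dots> = (\<Sum>i<n. (\<Sum>k\<le>l. W \<xi> k i) * K (n - i))"
    by (rule sum.mono_neutral_right) (auto simp: K_0)
  also have "\<dots> = (\<Sum>i<n. Z \<xi> i * K (n - i))"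
    by (intro sum.cong refl) (auto simp: Z_eq_sum[of _ l] l)
  finally show ?thesis .
qed

lemma Z_nonneg: "(\<And>i. 1 \<le> i \<Longrightarrow> i \<le> n \<Longrightarrow> 0 \<le> \<xi> i) \<Longrightarrow> 0 \<le> Z \<xi> n"
  unfolding Z_def by (intro sum_nonneg W_nonneg) auto

lemma Z_cong: "(\<And>i. 1 \<le> i \<Longrightarrow> i \<le> n \<Longrightarrow> \<xi> i = \<xi>' i) \<Longrightarrow> Z \<xi> n = Z \<xi>' n"
  unfolding Z_def by (intro sum.cong refl W_cong) auto

lemma Z_ge_single:
  assumes "0 < n" "\<And>i. 0 \<le> \<xi> i"
  shows "\<xi> n * K n \<le> Z \<xi> n"
proof -
  have "Z \<xi> 0 * K (n - 0) \<le> (\<Sum>m<n. Z \<xi> m * K (n - m))"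
    using assms by (intro member_le_sum) (auto intro!: mult_nonneg_nonneg Z_nonneg K_nonneg)
  then show ?thesis
    using assms by (simp add: Z_rec mult_left_mono)
qed

text \<open>Keeping only the trajectories through \<open>N\<close> loses mass: in the recursion at
  \<open>N + m\<close> the terms whose last gap starts before \<open>N\<close> are nonnegative and
  are dropped.\<close>

lemma Z_supermult:
  assumes "\<And>i. 0 \<le> \<xi> i"
  shows "Z \<xi> N * Z (\<lambda>i. \<xi> (N + i)) m \<le> Z \<xi> (N + m)"
proof (induction m rule: less_induct)
  case (less m)
  show ?case
  proof (cases "m = 0")
    case False
    have "Z \<xi> N * Z (\<lambda>i. \<xi> (N + i)) m
        = \<xi> (N + m) * (\<Sum>i<m. Z \<xi> N * Z (\<lambda>i. \<xi> (N + i)) i * K (m - i))"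
      using False by (simp add: Z_rec[of m] sum_distrib_left mult_ac)
    also have "\<dots> \<le> \<xi> (N + m) * (\<Sum>i<m. Z \<xi> (N + i) * K (m - i))"
      by (intro mult_left_mono sum_mono mult_right_mono less.IH assms K_nonneg) auto
    also have "(\<Sum>i<m. Z \<xi> (N + i) * K (m - i)) = (\<Sum>i\<in>{N..<N+m}. Z \<xi> i * K (N + m - i))"
      by (rule sum.reindex_bij_witness[of _ "\<lambda>i. i - N" "\<lambda>i. N + i"]) auto
    also have "\<xi> (N + m) * \<dots> \<le> \<xi> (N + m) * (\<Sum>i<N+m. Z \<xi> i * K (N + m - i))"
      by (intro mult_left_mono sum_mono2)
        (auto intro!: mult_nonneg_nonneg Z_nonneg K_nonneg assms)
    also have "\<dots> = Z \<xi> (N + m)" using False by (simp add: Z_rec[of "N + m"])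
    finally show ?thesis .
  qed simp
qed

text \<open>Decomposition at the last contact up to \<open>m\<close> and the first one after it.\<close>

lemma Z_split:
  assumes "m < N"
  shows "Z \<xi> N = (\<Sum>i\<le>m. \<Sum>b\<in>{m<..N}. Z \<xi> i * K (b - i) * (\<xi> b * Z (\<lambda>j. \<xi> (b + j)) (N - b)))"
  using assms
proof (induction N rule: less_induct)
  case (less N)
  let ?S = "\<lambda>b. \<Sum>i\<le>m. Z \<xi> i * K (b - i)"
  let ?R = "\<lambda>b c. Z (\<lambda>j. \<xi> (b + j)) (c - b)"
  have IH: "Z \<xi> c = (\<Sum>b\<in>{m<..c}. ?S b * (\<xi> b * ?R b c))" if "m < c" "c < N" for c
    by (rule trans[OF less.IH[OF that(2,1)]]) (unfold sum_distrib_right, rule sum.swap)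
  \<comment> \<open>The part after \<open>b\<close> obeys the same recursion at its endpoint
    \<open>N\<close>. Last gaps that start beyond \<open>m\<close> thus recombine into restarted
    partition functions, and those that start at or before \<open>m\<close> give the summand
    \<open>b = N\<close>.\<close>
  have R: "?R b N = \<xi> N * (\<Sum>c\<in>{b..<N}. ?R b c * K (N - c))" if "b < N" for b
  proof -
    have "(\<Sum>c<N - b. Z (\<lambda>j. \<xi> (b + j)) c * K (N - b - c)) = (\<Sum>c\<in>{b..<N}. ?R b c * K (N - c))"
      by (rule sum.reindex_bij_witness[of _ "\<lambda>i. i - b" "\<lambda>i. b + i"]) (use that in auto)
    then show ?thesis using that by (subst Z_rec) auto
  qed
  have N: "{..<N} = {..m} \<union> {m<..<N}" using less.prems by auto
  have "(\<Sum>c<N. Z \<xi> c * K (N - c)) = ?S N + (\<Sum>c\<in>{m<..<N}. Z \<xi> c * K (N - c))"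
    unfolding N by (rule sum.union_disjoint) auto
  also have "(\<Sum>c\<in>{m<..<N}. Z \<xi> c * K (N - c))
      = (\<Sum>c\<in>{m<..<N}. \<Sum>b\<in>{m<..c}. ?S b * (\<xi> b * ?R b c) * K (N - c))"
    by (intro sum.cong refl) (auto simp: IH sum_distrib_right)
  also have "\<dots> = (\<Sum>b\<in>{m<..<N}. \<Sum>c\<in>{b..<N}. ?S b * (\<xi> b * ?R b c) * K (N - c))"
    unfolding sum.Sigma[OF finite_greaterThanLessThan ballI[OF finite_greaterThanAtMost]]
      sum.Sigma[OF finite_greaterThanLessThan ballI[OF finite_atLeastLessThan]]
    by (rule sum.reindex_bij_witness[of _ "\<lambda>(b,c). (c,b)" "\<lambda>(b,c). (c,b)"]) auto
  also have "\<dots> = (\<Sum>b\<in>{m<..<N}. ?S b * (\<xi> b * (\<Sum>c\<in>{b..<N}. ?R b c * K (N - c))))"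
    by (simp add: sum_distrib_left mult_ac)
  finally have *: "Z \<xi> N = \<xi> N * ?S N
      + (\<Sum>b\<in>{m<..<N}. ?S b * (\<xi> b * (\<xi> N * (\<Sum>c\<in>{b..<N}. ?R b c * K (N - c)))))"
    using less.prems by (simp add: Z_rec[of N] distrib_left sum_distrib_left mult_ac)
  also have "(\<Sum>b\<in>{m<..<N}. ?S b * (\<xi> b * (\<xi> N * (\<Sum>c\<in>{b..<N}. ?R b c * K (N - c)))))
      = (\<Sum>b\<in>{m<..<N}. ?S b * (\<xi> b * ?R b N))"
    by (intro sum.cong refl) (simp add: R)
  also have "\<xi> N * ?S N + \<dots> = (\<Sum>b\<in>{m<..N}. ?S b * (\<xi> b * ?R b N))"
  proof -
    have "{m<..N} = insert N {m<..<N}" using less.prems by auto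
    then show ?thesis by simp
  qed
  finally show ?case
    unfolding sum_distrib_right by (rule trans[OF _ sum.swap])
qed

section \<open>Tails, last contacts and the exchange identity\<close>

lemma K_le_1: "(\<Sum>k\<le>n. K k) \<le> 1"
  using sum_le_suminf[of K "{..n}"] K_sums K_nonneg by (auto simp: sums_iff)

lemma T_nonneg: "0 \<le> T n"
  using K_le_1[of n] by (simp add: T_def)

lemma T_le_1: "T n \<le> 1"
  by (simp add: T_def sum_nonneg K_nonneg)

lemma T_0 [simp]: "T 0 = 1"
  by (simp add: T_def K_0)

lemma T_antimono: "m \<le> n \<Longrightarrow> T n \<le> T m"
  unfolding T_def by (auto intro!: sum_mono2 K_nonneg)

text \<open>The distribution function P(\<tau>_k <= n) of the k-th contact.\<close>

definition S :: "nat \<Rightarrow> nat \<Rightarrow> real" where "S k n = (\<Sum>m\<le>n. kap k m)"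

lemma S_0 [simp]: "S 0 n = 1"
  by (simp add: S_def if_distrib cong: if_cong)

lemma kap_nonneg: "0 \<le> kap k n"
  by (rule W_nonneg) auto

lemma u_nonneg: "0 \<le> u n"
  by (rule Z_nonneg) auto

lemma S_nonneg: "0 \<le> S k n"
  unfolding S_def by (intro sum_nonneg kap_nonneg)

lemma sum_convolution:
  fixes f g :: "nat \<Rightarrow> real"
  shows "(\<Sum>m\<le>n. \<Sum>i\<le>m. f i * g (m - i)) = (\<Sum>i\<le>n. f i * (\<Sum>j\<le>n - i. g j))"
proof -
  have "(\<Sum>m\<le>n. \<Sum>i\<le>m. f i * g (m - i)) = (\<Sum>i\<le>n. \<Sum>m\<in>{i..n}. f i * g (m - i))"
    unfolding sum.Sigma[OF finite_atMost ballI[OF finite_atMost]]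
      sum.Sigma[OF finite_atMost ballI[OF finite_atLeastAtMost]]
    by (rule sum.reindex_bij_witness[of _ "\<lambda>(b,c). (c,b)" "\<lambda>(b,c). (c,b)"]) auto
  also have "\<dots> = (\<Sum>i\<le>n. f i * (\<Sum>j\<le>n - i. g j))"
  proof (intro sum.cong refl)
    fix i assume "i \<in> {..n}"
    then have "(\<Sum>m\<in>{i..n}. f i * g (m - i)) = (\<Sum>j\<le>n - i. f i * g j)"
      by (intro sum.reindex_bij_witness[of _ "\<lambda>j. i + j" "\<lambda>m. m - i"]) auto
    then show "(\<Sum>m\<in>{i..n}. f i * g (m - i)) = f i * (\<Sum>j\<le>n - i. g j)"
      by (simp add: sum_distrib_left)
  qed
  finally show ?thesis .
qed

text \<open>Both sides are the probability that the k-th contact is the last one up to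
  \<open>n\<close>: it lies at some \<open>m\<close>, and the next gap exceeds
  \<open>n - m\<close>.\<close>

lemma kap_T: "(\<Sum>m\<le>n. kap k m * T (n - m)) = S k n - S (Suc k) n"
proof -
  have "S (Suc k) n = (\<Sum>i\<le>n. kap k i * (\<Sum>j\<le>n - i. K j))"
    by (simp add: S_def sum_convolution)
  then show ?thesis
    by (simp add: T_def S_def right_diff_distrib sum_subtractf)
qed

lemma kap_T_sum: "(\<Sum>k<L. \<Sum>m\<le>n. kap k m * T (n - m)) = 1 - S L n"
  using sum_lessThan_telescope'[of "\<lambda>k. S k n" L] by (simp add: kap_T)

text \<open>The last contact up to \<open>n\<close> is unique, so the probabilities of its positions
  add up to 1. The telescoping sum over k ends because \<open>n + 1\<close> contacts do not fit:
  \<open>S (Suc n) n = 0\<close>.\<close>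

lemma u_T: "(\<Sum>m\<le>n. u m * T (n - m)) = 1"
proof -
  have "S (Suc n) n = 0" by (auto simp: S_def W_eq_0 intro!: sum.neutral simp del: W.simps)
  then have "1 = (\<Sum>k<Suc n. \<Sum>m\<le>n. kap k m * T (n - m))"
    by (simp add: kap_T_sum del: W.simps)
  also have "\<dots> = (\<Sum>m\<le>n. (\<Sum>k\<le>n. kap k m) * T (n - m))"
    unfolding lessThan_Suc_atMost by (subst sum.swap) (simp add: sum_distrib_right)
  also have "\<dots> = (\<Sum>m\<le>n. u m * T (n - m))"
    by (intro sum.cong refl) (simp add: Z_eq_sum[of _ n])
  finally show ?thesis by simp
qed

lemma u_le_1: "u n \<le> 1"
proof -
  have "u n * T (n - n) \<le> (\<Sum>m\<le>n. u m * T (n - m))"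
    by (intro member_le_sum mult_nonneg_nonneg u_nonneg T_nonneg) auto
  then show ?thesis by (simp add: u_T)
qed

text \<open>By monotonicity each \<open>T (n - m)\<close> in \<open>u_T\<close> is at least
  \<open>T n\<close>. Lower bounds on the tail thus become upper bounds on the expected number of
  contacts.\<close>

lemma sum_u_le: "(\<Sum>m\<le>n. u m) * T n \<le> 1"
proof -
  have "(\<Sum>m\<le>n. u m) * T n \<le> (\<Sum>m\<le>n. u m * T (n - m))"
    unfolding sum_distrib_right
    by (intro sum_mono mult_left_mono T_antimono u_nonneg) auto
  then show ?thesis by (simp add: u_T)
qed

lemma kap_fps: "kap k n = fps_nth (Abs_fps K ^ k) n"
proof (induction k arbitrary: n)
  case (Suc k)
  have "kap (Suc k) n = fps_nth (Abs_fps K ^ k * Abs_fps K) n"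
    by (simp add: Suc fps_mult_nth atMost_atLeast0)
  then show ?case by (simp add: mult.commute del: W.simps)
qed simp

text \<open>By exchangeability of the increments, \<open>E[\<tau>\<^sub>k; \<tau>\<^sub>k = n]\<close> is \<open>k\<close> times the
  contribution of the last increment; analytically this is \<open>(F\<^sup>k)' = k F' F\<^sup>k\<^sup>-\<^sup>1\<close>.\<close>

lemma kap_exchange:
  "real n * kap (Suc k) n = real (Suc k) * (\<Sum>i\<le>n. kap k i * (real (n - i) * K (n - i)))"
proof (cases n)
  case 0
  then show ?thesis by (simp add: K_0)
next
  case (Suc l)
  let ?F = "Abs_fps K"
  have "real n * kap (Suc k) n = fps_nth (fps_deriv (?F ^ Suc k)) l"
    by (simp add: kap_fps Suc fps_deriv_nth del: W.simps power_Suc)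
  also have "\<dots> = real (Suc k) * fps_nth (?F ^ k * fps_deriv ?F) l"
  proof -
    have "fps_deriv (?F ^ Suc k) = fps_const (real (Suc k)) * (?F ^ k * fps_deriv ?F)"
      unfolding fps_deriv_power diff_Suc_1 mult.assoc by (simp only: mult.commute)
    then show ?thesis by (simp only: fps_mult_left_const_nth)
  qed
  also have "fps_nth (?F ^ k * fps_deriv ?F) l = (\<Sum>i\<le>l. kap k i * (real (n - i) * K (n - i)))"
    unfolding fps_mult_nth atMost_atLeast0
    by (intro sum.cong refl) (auto simp: kap_fps Suc Suc_diff_le)
  also have "\<dots> = (\<Sum>i\<le>n. kap k i * (real (n - i) * K (n - i)))"
    by (simp add: Suc)
  finally show ?thesis .
qed

end

section \<open>Elementary estimates for powers and power sums\<close>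

lemma powr_diff_MVT:
  fixes x p :: real
  assumes "0 < x"
  shows "\<exists>z. x < z \<and> z < x + 1 \<and> (x + 1) powr p - x powr p = p * z powr (p - 1)"
proof -
  have "\<exists>z. x < z \<and> z < x + 1 \<and> (x + 1) powr p - x powr p = (x + 1 - x) * (p * z powr (p - 1))"
    by (rule MVT2) (use assms in \<open>auto intro!: derivative_eq_intros simp: powr_diff field_simps\<close>)
  then show ?thesis by auto
qed

text \<open>Comparison with the integral, one step at a time: by the mean value theorem the
  increment of x^(1 - q) / (1 - q) from n to n + 1 dominates (n + 1)^(-q).\<close>

lemma sum_powr_le:
  fixes q :: real
  assumes "0 \<le> q" "q < 1"
  shows "(\<Sum>j=1..n. real j powr (- q)) \<le> real n powr (1 - q) / (1 - q)"
proof (induction n)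
  case (Suc n)
  have "real (Suc n) powr (- q) \<le> (real (Suc n) powr (1 - q) - real n powr (1 - q)) / (1 - q)"
  proof (cases "n = 0")
    case False
    then obtain z where z: "real n < z" "z < real n + 1"
      "(real n + 1) powr (1 - q) - real n powr (1 - q) = (1 - q) * z powr (1 - q - 1)"
      using powr_diff_MVT[of "real n" "1 - q"] by auto
    have "real (Suc n) powr (- q) \<le> z powr (- q)"
      by (rule powr_mono2') (use z False assms in auto)
    then show ?thesis using z(3) assms by (simp add: add.commute)
  qed (use assms in auto)
  then show ?case using Suc by (simp add: diff_divide_distrib)
qed simp

lemma sum_powr_tail_le:
  fixes q :: real
  assumes q: "1 < q" and x: "1 \<le> x"
  shows "(\<Sum>j=x..y. real j powr (- q)) \<le> q / (q - 1) * real x powr (1 - q)"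
proof -
  \<comment> \<open>The negative end term is kept so that the induction on the length telescopes; it
    is discarded only afterwards.\<close>
  have *: "(\<Sum>j=x..x+n. real j powr (- q))
      \<le> real x powr (- q) + (real x powr (1 - q) - real (x + n) powr (1 - q)) / (q - 1)" for n
  proof (induction n)
    case (Suc n)
    obtain z where z: "real (x + n) < z" "z < real (x + n) + 1"
      "(real (x + n) + 1) powr (1 - q) - real (x + n) powr (1 - q) = (1 - q) * z powr (1 - q - 1)"
      using powr_diff_MVT[of "real (x + n)" "1 - q"] x by auto
    have "real (x + Suc n) powr (- q) \<le> z powr (- q)"
      by (rule powr_mono2') (use z x assms in auto)
    also have "\<dots> = (real (x + n) powr (1 - q) - real (x + Suc n) powr (1 - q)) / (q - 1)"
      using z(3) q by (simp add: field_simps)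
    finally show ?case using Suc by (simp add: diff_divide_distrib)
  qed simp
  have 1: "real x powr (- q) \<le> real x powr (1 - q)"
    using x by (intro powr_mono) auto
  show ?thesis
  proof (cases "x \<le> y")
    case True
    then obtain n where n: "y = x + n" using le_Suc_ex by auto
    have "(\<Sum>j=x..y. real j powr (- q)) \<le> real x powr (- q) + real x powr (1 - q) / (q - 1)"
      unfolding n by (rule order_trans[OF *]) (use q in \<open>auto simp: divide_right_mono\<close>)
    also have "\<dots> \<le> real x powr (1 - q) + real x powr (1 - q) / (q - 1)" using 1 by simp
    also have "\<dots> = q / (q - 1) * real x powr (1 - q)" using q by (simp add: field_simps)
    finally show ?thesis .
  qed (use q in auto)
qed

text \<open>After division by \<open>x + y\<close> the two ratios lie in [0, 1] and add up to 1, and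
  on [0, 1] a power s <= 1 only increases a number.\<close>

lemma powr_add_le:
  fixes x y s :: real
  assumes "0 \<le> x" "0 \<le> y" "0 < s" "s \<le> 1"
  shows "(x + y) powr s \<le> x powr s + y powr s"
proof (cases "x + y = 0")
  case False
  then have p: "0 < x + y" using assms by linarith
  have *: "z / (x + y) \<le> (z / (x + y)) powr s" if "0 \<le> z" "z \<le> x + y" for z
  proof (cases "z = 0")
    case False
    then have "(z / (x + y)) powr 1 \<le> (z / (x + y)) powr s"
      using that p assms by (intro powr_mono') auto
    then show ?thesis using that p False by simp
  qed simp
  have "1 = x / (x + y) + y / (x + y)" using p by (simp add: add_divide_distrib[symmetric])
  also have "\<dots> \<le> (x / (x + y)) powr s + (y / (x + y)) powr s"
    using assms by (intro add_mono *) auto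
  also have "\<dots> = (x powr s + y powr s) / (x + y) powr s"
    using assms p by (simp add: powr_divide add_divide_distrib)
  finally show ?thesis using p by (simp add: field_simps)
qed (use assms in simp)

section \<open>Renewal estimates from the power tail of the gaps\<close>

locale pinning_kernel = renewal_kernel K for K :: "nat \<Rightarrow> real" +
  fixes \<alpha> C_K :: real
  assumes \<alpha>_pos: "0 < \<alpha>" and C_K_pos: "0 < C_K"
    and K_asymp: "K \<sim>[at_top] (\<lambda>n. C_K * real n powr (- (1 + \<alpha>)))"
begin

definition a :: real where "a = min \<alpha> 1"

lemma a_bounds: "0 < a" "a \<le> 1" "a \<le> \<alpha>"
  using \<alpha>_pos by (auto simp: a_def)

lemma K_ratio: "(\<lambda>n. K n / (C_K * real n powr (- (1 + \<alpha>)))) \<longlonglongrightarrow> 1"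
proof (rule asymp_equivD_strong[OF K_asymp])
  show "\<forall>\<^sub>F n in sequentially. K n \<noteq> 0 \<or> C_K * real n powr (- (1 + \<alpha>)) \<noteq> 0"
    using eventually_gt_at_top[of 0] by eventually_elim (use C_K_pos in simp)
qed

lemma K_upper: "\<exists>C>0. \<forall>n\<ge>1. K n \<le> C * real n powr (- (1 + \<alpha>))"
proof -
  obtain B where B: "0 < B" "\<And>n. norm (K n / (C_K * real n powr (- (1 + \<alpha>)))) \<le> B"
    using convergent_imp_Bseq[OF convergentI[OF K_ratio]] by (auto elim: BseqE)
  have "K n \<le> B * C_K * real n powr (- (1 + \<alpha>))" if "1 \<le> n" for n
    using B(2)[of n] that C_K_pos K_nonneg[of n]
    by (auto simp: field_simps)
  then show ?thesis using B(1) C_K_pos by (intro exI[of _ "B * C_K"]) auto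
qed

text \<open>Only from some \<open>n0\<close> on: the asymptotics allow finitely many
  \<open>K n\<close> to vanish. This threshold reappears wherever \<open>Z\<close> has to be
  positive.\<close>

lemma K_lower: "\<exists>c>0. \<exists>n0\<ge>1. \<forall>n\<ge>n0. c * real n powr (- (1 + \<alpha>)) \<le> K n"
proof -
  have "eventually (\<lambda>n. K n / (C_K * real n powr (- (1 + \<alpha>))) > 1 / 2) sequentially"
    by (rule order_tendstoD[OF K_ratio]) simp
  then obtain n0 where n0: "\<And>n. n \<ge> n0 \<Longrightarrow> K n / (C_K * real n powr (- (1 + \<alpha>))) > 1 / 2"
    by (auto simp: eventually_at_top_linorder)
  have "C_K / 2 * real n powr (- (1 + \<alpha>)) \<le> K n" if "n \<ge> max 1 n0" for n
    using n0[of n] that C_K_pos by (simp add: field_simps)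
  then show ?thesis using C_K_pos
    by (intro exI[of _ "C_K/2"] conjI exI[of _ "max 1 n0"]) (auto simp del: max.bounded_iff)
qed

text \<open>The gap lengths in (n, 2n] alone contribute n terms of order n^(-1-\<alpha>). For small
  n, monotonicity reduces the claim to the positive value \<open>T n0\<close>.\<close>

lemma T_lower: "\<exists>c>0. \<forall>n\<ge>1. c * real n powr (- \<alpha>) \<le> T n"
proof -
  obtain c n0 where c: "c > 0" "n0 \<ge> 1" "\<And>n. n \<ge> n0 \<Longrightarrow> c * real n powr (- (1 + \<alpha>)) \<le> K n"
    using K_lower by blast
  define c1 where "c1 = c * 2 powr (- (1 + \<alpha>))"
  have large: "c1 * real n powr (- \<alpha>) \<le> T n" if "n \<ge> n0" for n
  proof -
    have "c1 * real n powr (- \<alpha>) = real n * (c * real (2 * n) powr (- (1 + \<alpha>)))"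
      using that c(2) by (simp add: c1_def powr_mult powr_add powr_diff powr_minus field_simps)
    also have "\<dots> = (\<Sum>k\<in>{n<..2*n}. c * real (2 * n) powr (- (1 + \<alpha>)))"
      by (simp add: of_nat_diff)
    also have "\<dots> \<le> (\<Sum>k\<in>{n<..2*n}. K k)"
    proof (rule sum_mono)
      fix k assume k: "k \<in> {n<..2*n}"
      have "real (2 * n) powr (- (1 + \<alpha>)) \<le> real k powr (- (1 + \<alpha>))"
        using k \<alpha>_pos by (intro powr_mono2') auto
      then show "c * real (2 * n) powr (- (1 + \<alpha>)) \<le> K k"
        using c(1) c(3)[of k] k that by (smt (verit) greaterThanAtMost_iff mult_left_mono order.trans less_imp_le_nat)
    qed
    also have "\<dots> \<le> T n"
    proof -
      have N: "{..2*n} = {..n} \<union> {n<..2*n}" by auto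
      have "(\<Sum>k\<le>2*n. K k) = (\<Sum>k\<le>n. K k) + (\<Sum>k\<in>{n<..2*n}. K k)"
        unfolding N by (rule sum.union_disjoint) auto
      then show ?thesis using K_le_1[of "2*n"] by (simp add: T_def)
    qed
    finally show ?thesis .
  qed
  have "0 < c1 * real n0 powr (- \<alpha>)" using c by (simp add: c1_def)
  also have "\<dots> \<le> T n0" by (rule large) simp
  finally have T0: "0 < T n0" .
  have "min c1 (T n0) * real n powr (- \<alpha>) \<le> T n" if "n \<ge> 1" for n
  proof (cases "n \<ge> n0")
    case True
    have "min c1 (T n0) * real n powr (- \<alpha>) \<le> c1 * real n powr (- \<alpha>)"
      by (intro mult_right_mono) auto
    then show ?thesis using large[OF True] by simp
  next
    case False
    have "real n powr (- \<alpha>) \<le> 1"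
      using that \<alpha>_pos by (simp add: powr_minus field_simps ge_one_powr_ge_zero)
    then have "min c1 (T n0) * real n powr (- \<alpha>) \<le> T n0 * 1"
      using T0 by (intro mult_mono) auto
    also have "\<dots> \<le> T n" using False by (simp add: T_antimono)
    finally show ?thesis .
  qed
  moreover have "0 < min c1 (T n0)" using T0 c by (simp add: c1_def)
  ultimately show ?thesis by blast
qed

text \<open>This comparison turns the size-biased last increment of \<open>kap_exchange\<close> into
  a tail, and a tail convolved with \<open>kap k\<close> is the difference in
  \<open>kap_T\<close>.\<close>

lemma nK_le_T: "\<exists>C>0. \<forall>n. real n * K n \<le> C * T n"
proof -
  obtain C where C: "C > 0" "\<And>n. n \<ge> 1 \<Longrightarrow> K n \<le> C * real n powr (- (1 + \<alpha>))"
    using K_upper by blast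
  obtain c where c: "c > 0" "\<And>n. n \<ge> 1 \<Longrightarrow> c * real n powr (- \<alpha>) \<le> T n"
    using T_lower by blast
  have "real n * K n \<le> C / c * T n" for n
  proof (cases "n = 0")
    case False
    have "real n * K n \<le> real n * (C * real n powr (- (1 + \<alpha>)))"
      using C False by (intro mult_left_mono) auto
    also have "\<dots> = C / c * (c * real n powr (- \<alpha>))"
      using c(1) False by (simp add: powr_add powr_diff powr_minus field_simps)
    also have "\<dots> \<le> C / c * T n"
      using C(1) c False by (intro mult_left_mono) auto
    finally show ?thesis .
  qed (use C(1) c(1) in simp)
  then show ?thesis using C(1) c(1) by (intro exI[of _ "C / c"]) auto
qed

lemma kap_Suc_le:
  assumes "\<And>n. real n * K n \<le> C * T n"
  shows "real n * kap (Suc k) n \<le> C * (real (Suc k) * (S k n - S (Suc k) n))"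
proof -
  have "real n * kap (Suc k) n \<le> real (Suc k) * (\<Sum>i\<le>n. kap k i * (C * T (n - i)))"
    unfolding kap_exchange by (intro mult_left_mono sum_mono kap_nonneg assms) auto
  also have "(\<Sum>i\<le>n. kap k i * (C * T (n - i))) = C * (\<Sum>i\<le>n. kap k i * T (n - i))"
    by (simp add: sum_distrib_left mult_ac)
  also have "real (Suc k) * (C * (\<Sum>i\<le>n. kap k i * T (n - i)))
      = C * (real (Suc k) * (S k n - S (Suc k) n))"
    unfolding kap_T by (rule mult.left_commute)
  finally show ?thesis .
qed

lemma S_Suc_le: "S (Suc k) n \<le> S k n"
proof -
  have "0 \<le> (\<Sum>m\<le>n. kap k m * T (n - m))"
    by (intro sum_nonneg mult_nonneg_nonneg kap_nonneg T_nonneg)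
  then show ?thesis by (simp add: kap_T)
qed

text \<open>In \<open>kap_Suc_le\<close> the factor \<open>Suc k\<close> is at most L, and the
  remaining differences telescope to at most 1. The smallness for L well below n^a drives the
  delocalization proof.\<close>

lemma few_contacts: "\<exists>C>0. \<forall>L. \<forall>n\<ge>1. (\<Sum>k\<le>L. kap k n) \<le> C * real L / real n"
proof -
  obtain C where C: "C > 0" "\<And>n. real n * K n \<le> C * T n"
    using nK_le_T by blast
  have "(\<Sum>k\<le>L. kap k n) \<le> C * real L / real n" if n: "n \<ge> 1" for n L
  proof -
    have "(\<Sum>k\<le>L. kap k n) = (\<Sum>k<L. kap (Suc k) n)"
      unfolding lessThan_Suc_atMost[symmetric] using n by (subst sum.lessThan_Suc_shift) simp
    then have "real n * (\<Sum>k\<le>L. kap k n) = (\<Sum>k<L. real n * kap (Suc k) n)"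
      by (simp only: sum_distrib_left)
    also have "\<dots> \<le> (\<Sum>k<L. C * (real L * (S k n - S (Suc k) n)))"
      using C(1) S_Suc_le
      by (intro sum_mono order_trans[OF kap_Suc_le[OF C(2)]] mult_left_mono mult_right_mono) auto
    also have "\<dots> = C * (real L * (\<Sum>k<L. S k n - S (Suc k) n))"
      by (simp add: sum_distrib_left)
    also have "(\<Sum>k<L. S k n - S (Suc k) n) = 1 - S L n"
      using sum_lessThan_telescope'[of "\<lambda>k. S k n" L] by simp
    also have "C * (real L * (1 - S L n)) \<le> C * (real L * 1)"
      using C(1) S_nonneg[of L n] by (intro mult_left_mono) auto
    finally show ?thesis using n by (simp add: field_simps)
  qed
  then show ?thesis using C(1) by blast
qed

lemma sum_by_parts:
  fixes s :: "nat \<Rightarrow> real"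
  shows "(\<Sum>k<n. real (Suc k) * (s k - s (Suc k))) = (\<Sum>k<n. s k) - real n * s n"
  by (induction n) (auto simp: algebra_simps)

text \<open>Summation by parts over all k turns the differences of \<open>S\<close> into the sum of
  all \<open>S k n\<close>, the expected number of contacts up to \<open>n\<close>, which
  \<open>sum_u_le\<close> and the tail bound make O(n^\<alpha>). For \<alpha> >= 1 the trivial bound
  \<open>u n \<le> 1\<close> already has the required form.\<close>

lemma u_upper: "\<exists>C>0. \<forall>n\<ge>1. u n \<le> C * real n powr (a - 1)"
proof -
  obtain C where C: "C > 0" "\<And>n. real n * K n \<le> C * T n"
    using nK_le_T by blast
  obtain c where c: "c > 0" "\<And>n. n \<ge> 1 \<Longrightarrow> c * real n powr (- \<alpha>) \<le> T n"
    using T_lower by blast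
  have *: "u n \<le> C / c * real n powr (\<alpha> - 1)" if n: "n \<ge> 1" for n
  proof -
    have "u n = (\<Sum>k<n. kap (Suc k) n)"
      unfolding Z_def lessThan_Suc_atMost[symmetric] using n by (subst sum.lessThan_Suc_shift) simp
    then have "real n * u n = (\<Sum>k<n. real n * kap (Suc k) n)"
      by (simp only: sum_distrib_left)
    also have "\<dots> \<le> (\<Sum>k<n. C * (real (Suc k) * (S k n - S (Suc k) n)))"
      by (intro sum_mono kap_Suc_le C(2))
    also have "\<dots> = C * ((\<Sum>k<n. S k n) - real n * S n n)"
      using sum_by_parts[of "\<lambda>k. S k n" n] by (simp only: sum_distrib_left[symmetric])
    also have "\<dots> \<le> C * (\<Sum>k<n. S k n)"
      using C(1) S_nonneg[of n n] by (intro mult_left_mono) auto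
    also have "\<dots> \<le> C * (\<Sum>k\<le>n. S k n)"
      using C(1) by (intro mult_left_mono sum_mono2 S_nonneg) auto
    also have "(\<Sum>k\<le>n. S k n) = (\<Sum>m\<le>n. u m)"
      unfolding S_def by (subst sum.swap) (auto simp: Z_eq_sum[of _ n] intro!: sum.cong)
    also have "C * (\<Sum>m\<le>n. u m) \<le> C * (real n powr \<alpha> / c)"
    proof (intro mult_left_mono)
      have "(\<Sum>m\<le>n. u m) * (c * real n powr (- \<alpha>)) \<le> (\<Sum>m\<le>n. u m) * T n"
        using c(2)[OF n] by (intro mult_left_mono sum_nonneg u_nonneg) auto
      also have "\<dots> \<le> 1" by (rule sum_u_le)
      finally show "(\<Sum>m\<le>n. u m) \<le> real n powr \<alpha> / c"
        using c(1) n by (simp add: powr_minus field_simps)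
    qed (use C(1) in simp)
    finally have "real n * u n \<le> C * real n powr \<alpha> / c" by simp
    then have "u n \<le> C * real n powr \<alpha> / c / real n"
      using n by (subst pos_le_divide_eq) (simp, subst mult.commute)
    then show ?thesis using n by (simp add: powr_diff)
  qed
  have "u n \<le> max 1 (C / c) * real n powr (a - 1)" if n: "n \<ge> 1" for n
  proof (cases "\<alpha> < 1")
    case True
    have "C / c * real n powr (\<alpha> - 1) \<le> max 1 (C / c) * real n powr (\<alpha> - 1)"
      by (intro mult_right_mono) auto
    then show ?thesis using *[OF n] True by (simp add: a_def)
  next
    case False
    then show ?thesis using u_le_1[of n] n by (auto simp: a_def)
  qed
  then show ?thesis by (intro exI[of _ "max 1 (C / c)"]) auto
qed

section \<open>Number of contacts via moments of the gaps\<close>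

lemma kap_sums: "kap k sums 1"
proof (induction k)
  case 0
  show ?case using sums_If_finite_set[of "{0}" "\<lambda>_. 1::real"] by simp
next
  case (Suc k)
  have "(\<lambda>n. \<Sum>i\<le>n. kap k i * K (n - i)) sums ((\<Sum>n. kap k n) * (\<Sum>n. K n))"
    using Suc K_sums
    by (intro Cauchy_product_sums) (auto simp: K_nonneg kap_nonneg sums_iff)
  then show ?case using Suc K_sums by (simp add: sums_iff)
qed

lemma K_moment:
  assumes s: "0 < s" "s < \<alpha>"
  shows "summable (\<lambda>n. K n * real n powr s)"
proof -
  obtain C where C: "C > 0" "\<And>n. n \<ge> 1 \<Longrightarrow> K n \<le> C * real n powr (- (1 + \<alpha>))"
    using K_upper by blast
  have "summable (\<lambda>n. C * real n powr (s - \<alpha> - 1))"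
    using s by (intro summable_mult) (simp add: summable_real_powr_iff)
  then show ?thesis
  proof (rule summable_comparison_test'[where N = 1])
    fix n :: nat assume n: "1 \<le> n"
    have "K n * real n powr s \<le> C * real n powr (- (1 + \<alpha>)) * real n powr s"
      using C(2)[OF n] by (intro mult_right_mono) auto
    also have "\<dots> = C * real n powr (s - \<alpha> - 1)"
      by (simp add: powr_add[symmetric] algebra_simps)
    finally show "norm (K n * real n powr s) \<le> C * real n powr (s - \<alpha> - 1)"
      using K_nonneg[of n] by simp
  qed
qed

text \<open>For s <= 1 the map x -> x^s is subadditive, so the moment of a sum of k gaps is at most
  the sum of their moments; the two convolutions are Cauchy products.\<close>

lemma kap_moment:
  assumes s: "0 < s" "s < \<alpha>" "s \<le> 1"
  shows "summable (\<lambda>n. kap k n * real n powr s)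
    \<and> (\<Sum>n. kap k n * real n powr s) \<le> real k * (\<Sum>n. K n * real n powr s)"
proof (induction k)
  case 0
  have "(\<lambda>n. kap 0 n * real n powr s) = (\<lambda>_. 0)" by auto
  then show ?case by simp
next
  case (Suc k)
  let ?f = "\<lambda>n. kap k n * real n powr s" and ?g = "\<lambda>n. K n * real n powr s"
  have sm: "summable (kap k)" "suminf (kap k) = 1" "summable K" "suminf K = 1"
    using kap_sums[of k] K_sums by (auto simp: sums_iff)
  have nn: "norm (?f n) = ?f n" "norm (?g n) = ?g n" "norm (kap k n) = kap k n" "norm (K n) = K n" for n
    using kap_nonneg K_nonneg by auto
  have 1: "(\<lambda>n. \<Sum>i\<le>n. ?f i * K (n - i)) sums (suminf ?f * suminf K)"
    by (intro Cauchy_product_sums) (simp_all only: nn sm Suc.IH)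
  have 2: "(\<lambda>n. \<Sum>i\<le>n. kap k i * ?g (n - i)) sums (suminf (kap k) * suminf ?g)"
    by (intro Cauchy_product_sums) (simp_all only: nn sm K_moment[OF s(1,2)])
  have 3: "(\<lambda>n. (\<Sum>i\<le>n. ?f i * K (n - i)) + (\<Sum>i\<le>n. kap k i * ?g (n - i))) sums (suminf ?f + suminf ?g)"
    using sums_add[OF 1 2] by (simp add: sm)
  have le: "kap (Suc k) n * real n powr s
      \<le> (\<Sum>i\<le>n. ?f i * K (n - i)) + (\<Sum>i\<le>n. kap k i * ?g (n - i))" for n
  proof -
    have "kap (Suc k) n * real n powr s = (\<Sum>i\<le>n. kap k i * K (n - i) * real n powr s)"
      by (simp add: sum_distrib_right)
    also have "\<dots> \<le> (\<Sum>i\<le>n. kap k i * K (n - i) * (real i powr s + real (n - i) powr s))"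
    proof (intro sum_mono mult_left_mono mult_nonneg_nonneg kap_nonneg K_nonneg)
      fix i assume "i \<in> {..n}"
      then show "real n powr s \<le> real i powr s + real (n - i) powr s"
        using powr_add_le[of "real i" "real (n - i)" s] s by auto
    qed
    also have "\<dots> = (\<Sum>i\<le>n. ?f i * K (n - i)) + (\<Sum>i\<le>n. kap k i * ?g (n - i))"
      by (simp add: sum.distrib[symmetric] algebra_simps)
    finally show ?thesis .
  qed
  have sum: "summable (\<lambda>n. kap (Suc k) n * real n powr s)"
    using sums_summable[OF 3] le kap_nonneg[of "Suc k"]
    by (intro summable_comparison_test'[OF sums_summable[OF 3], where N = 0]) (simp del: W.simps)
  have "(\<Sum>n. kap (Suc k) n * real n powr s) \<le> suminf ?f + suminf ?g"
    using suminf_le[OF le sum sums_summable[OF 3]] sums_unique[OF 3] by simp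
  also have "\<dots> \<le> real (Suc k) * suminf ?g" using Suc.IH by (simp add: algebra_simps)
  finally show ?case using sum by blast
qed

text \<open>Markov's inequality for \<tau>_L^s. With L a small multiple of N^s it says that at least
  L contacts up to \<open>N\<close> occur with probability close to 1.\<close>

lemma S_lower:
  assumes s: "0 < s" "s < \<alpha>" "s \<le> 1"
  shows "\<exists>C>0. \<forall>L. \<forall>N\<ge>1. 1 - S L N \<le> C * real L * real N powr (- s)"
proof -
  define m where "m = (\<Sum>n. K n * real n powr s)"
  have m: "0 \<le> m" unfolding m_def
    by (intro suminf_nonneg K_moment s) (simp add: K_nonneg)
  have "1 - S L N \<le> (m + 1) * real L * real N powr (- s)" if N: "N \<ge> 1" for L N
  proof -
    note sm = kap_moment[OF s, of L]
    have 1: "(\<lambda>n. if n \<in> {..N} then kap L n else 0) sums S L N"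
      unfolding S_def by (rule sums_If_finite_set) simp
    have 2: "(\<lambda>n. real N powr (- s) * (kap L n * real n powr s)) sums
        (real N powr (- s) * (\<Sum>n. kap L n * real n powr s))"
      using sm by (intro sums_mult) (simp add: sums_iff)
    have "1 \<le> S L N + real N powr (- s) * (\<Sum>n. kap L n * real n powr s)"
    proof (rule sums_le[OF _ kap_sums sums_add[OF 1 2]])
      fix n
      show "kap L n \<le> (if n \<in> {..N} then kap L n else 0) + real N powr (- s) * (kap L n * real n powr s)"
      proof (cases "n \<le> N")
        case False
        have "1 \<le> (real n / real N) powr s"
          using False N s by (intro ge_one_powr_ge_zero) auto
        then have "1 \<le> real N powr (- s) * real n powr s"
          using N by (simp add: powr_divide powr_minus field_simps)
        then have "kap L n * 1 \<le> kap L n * (real N powr (- s) * real n powr s)"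
          by (intro mult_left_mono kap_nonneg)
        then show ?thesis using False by (simp add: mult_ac)
      qed (auto simp: kap_nonneg)
    qed
    then have "1 - S L N \<le> real N powr (- s) * (\<Sum>n. kap L n * real n powr s)" by simp
    also have "\<dots> \<le> real N powr (- s) * (real L * m)"
      using sm by (intro mult_left_mono) (auto simp: m_def)
    also have "\<dots> \<le> (m + 1) * real L * real N powr (- s)"
      by (simp add: algebra_simps)
    finally show ?thesis .
  qed
  then show ?thesis using m by (intro exI[of _ "m + 1"]) auto
qed

end

subsection \<open>The environment\<close>

context renewal_kernel
begin

lemma measurable_W [measurable (raw)]:
  "(\<And>i. f i \<in> borel_measurable N) \<Longrightarrow> (\<lambda>x. W (\<lambda>i. f i x) k n) \<in> borel_measurable N"
proof (induction k arbitrary: n)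
  case (Suc k)
  show ?case
    unfolding W.simps
    by (intro borel_measurable_times borel_measurable_sum borel_measurable_const Suc.IH[OF Suc.prems] Suc.prems)
qed simp

lemma measurable_Z [measurable (raw)]:
  "(\<And>i. f i \<in> borel_measurable N) \<Longrightarrow> (\<lambda>x. Z (\<lambda>i. f i x) n) \<in> borel_measurable N"
  unfolding Z_def by (rule borel_measurable_sum, rule measurable_W)

end

text \<open>A pointwise substitute for measurability with respect to the coordinates in
  \<open>A\<close>: independence proofs split into this combinatorial condition and plain
  measurability.\<close>

definition depends_on :: "'i set \<Rightarrow> (('i \<Rightarrow> 'v) \<Rightarrow> 'c) \<Rightarrow> bool" where
  "depends_on A F \<longleftrightarrow> (\<forall>y y'. (\<forall>i\<in>A. y i = y' i) \<longrightarrow> F y = F y')"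

lemma depends_onI: "(\<And>y y'. (\<And>i. i \<in> A \<Longrightarrow> y i = y' i) \<Longrightarrow> F y = F y') \<Longrightarrow> depends_on A F"
  unfolding depends_on_def by blast

lemma depends_onD: "depends_on A F \<Longrightarrow> (\<And>i. i \<in> A \<Longrightarrow> y i = y' i) \<Longrightarrow> F y = F y'"
  unfolding depends_on_def by blast

abbreviation seq_space :: "(nat \<Rightarrow> real) measure" where
  "seq_space \<equiv> \<Pi>\<^sub>M i\<in>UNIV. borel"

lemma measurable_coordinate: "(\<lambda>y. y i) \<in> borel_measurable seq_space"
  by (rule measurable_component_singleton[OF UNIV_I])

lemma (in prob_space) indep_var_nn_integral:
  fixes X Y :: "'a \<Rightarrow> ennreal"
  assumes "indep_var borel X borel Y"
  shows "(\<integral>\<^sup>+x. X x * Y x \<partial>M) = (\<integral>\<^sup>+x. X x \<partial>M) * (\<integral>\<^sup>+x. Y x \<partial>M)"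
proof -
  have eq: "case_bool borel borel = (\<lambda>_. borel :: ennreal measure)"
    by (rule ext) (simp split: bool.split)
  have "indep_vars (\<lambda>_. borel) (case_bool X Y) UNIV"
    using assms unfolding indep_var_def eq .
  then have "(\<integral>\<^sup>+x. (\<Prod>i\<in>UNIV. case_bool X Y i x) \<partial>M) = (\<Prod>i\<in>UNIV. \<integral>\<^sup>+x. case_bool X Y i x \<partial>M)"
    by (intro indep_vars_nn_integral) simp_all
  moreover have "(\<Prod>i\<in>UNIV. f i) = f True * f False" for f :: "bool \<Rightarrow> ennreal"
    unfolding UNIV_bool by (simp add: mult.commute)
  ultimately show ?thesis by simp
qed

text \<open>The lower bound is imposed at every point, which makes all weights nonnegative
  everywhere for 0 <= \<beta> <= 1. The given environment is brought into this form by truncating it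
  at -1, which changes it only on a null set.\<close>

locale environment = prob_space M for M :: "'a measure" +
  fixes \<omega> :: "nat \<Rightarrow> 'a \<Rightarrow> real"
  assumes indep: "indep_vars (\<lambda>_. borel) \<omega> UNIV"
    and identical: "\<And>n. distr M borel (\<omega> n) = distr M borel (\<omega> 1)"
    and lower: "\<And>n x. - 1 \<le> \<omega> n x"
    and integrable_1: "integrable M (\<omega> 1)" and mean_1: "expectation (\<omega> 1) = 0"
begin

lemma measurable_\<omega> [measurable]: "\<omega> n \<in> borel_measurable M"
  using indep by (auto simp: indep_vars_def)

definition env :: "'a \<Rightarrow> nat \<Rightarrow> real" where "env x = (\<lambda>i. \<omega> i x)"

lemma measurable_env [measurable]: "env \<in> measurable M seq_space"
  unfolding env_def by (rule measurable_abs_UNIV) simp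

text \<open>A functional that depends on \<open>A\<close> factors through the restriction to
  \<open>A\<close>, since extending a restricted family by 0 does not alter its value; independence
  of disjoint groups of coordinates then applies.\<close>

lemma indep_depends_on:
  assumes F: "F \<in> measurable seq_space N1" "depends_on A F"
    and G: "G \<in> measurable seq_space N2" "depends_on B G" and "A \<inter> B = {}"
  shows "indep_var N1 (\<lambda>x. F (env x)) N2 (\<lambda>x. G (env x))"
proof -
  define ext where "ext A z = (\<lambda>i. if i \<in> A then z i else 0 :: real)" for A :: "nat set" and z
  have m: "ext A \<in> measurable (PiM A (\<lambda>_. borel)) seq_space" for A
    unfolding ext_def
  proof (rule measurable_abs_UNIV)
    fix n show "(\<lambda>z. if n \<in> A then z n else 0) \<in> borel_measurable (PiM A (\<lambda>_. borel))"
      by (cases "n \<in> A") (auto intro: measurable_component_singleton)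
  qed
  have "indep_var N1 ((F \<circ> ext A) \<circ> (\<lambda>x. restrict (\<lambda>i. \<omega> i x) A))
                  N2 ((G \<circ> ext B) \<circ> (\<lambda>x. restrict (\<lambda>i. \<omega> i x) B))"
    by (intro indep_var_compose[OF indep_var_restrict[OF indep]] assms
        measurable_comp[OF m]) auto
  moreover have "(F \<circ> ext A) \<circ> (\<lambda>x. restrict (\<lambda>i. \<omega> i x) A) = (\<lambda>x. F (env x))"
    using depends_onD[OF F(2), of "\<lambda>i. if i \<in> A then \<omega> i _ else 0" "\<lambda>i. \<omega> i _"]
    by (simp add: fun_eq_iff ext_def env_def restrict_def cong: if_cong)
  moreover have "(G \<circ> ext B) \<circ> (\<lambda>x. restrict (\<lambda>i. \<omega> i x) B) = (\<lambda>x. G (env x))"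
    using depends_onD[OF G(2), of "\<lambda>i. if i \<in> B then \<omega> i _ else 0" "\<lambda>i. \<omega> i _"]
    by (simp add: fun_eq_iff ext_def env_def restrict_def cong: if_cong)
  ultimately show ?thesis by simp
qed

lemma nn_indep:
  fixes F G :: "(nat \<Rightarrow> real) \<Rightarrow> ennreal"
  assumes "F \<in> borel_measurable seq_space" "depends_on A F"
    and "G \<in> borel_measurable seq_space" "depends_on B G" and "A \<inter> B = {}"
  shows "(\<integral>\<^sup>+x. F (env x) * G (env x) \<partial>M) = (\<integral>\<^sup>+x. F (env x) \<partial>M) * (\<integral>\<^sup>+x. G (env x) \<partial>M)"
  by (rule indep_var_nn_integral[OF indep_depends_on[OF assms]])

definition D :: "real measure" where "D = distr M borel (\<omega> 1)"

lemma distr_\<omega>: "distr M borel (\<omega> n) = D"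
  unfolding D_def by (rule identical)

lemma space_D [simp]: "space D = UNIV" and sets_D [simp, measurable_cong]: "sets D = sets borel"
  by (auto simp: D_def)

lemma prob_space_D: "prob_space D"
  unfolding D_def by (rule prob_space_distr) simp

text \<open>The law is the same product measure for every \<open>m\<close>; comparing
  \<open>m\<close> with 0 gives stationarity for all functionals of the environment.\<close>

lemma distr_shift: "distr M seq_space (\<lambda>x i. \<omega> (m + i) x) = PiM UNIV (\<lambda>_. D)"
proof -
  \<comment> \<open>Reindexing by i -> m + i is expressed as grouping into the disjoint singletons
    {m + i}.\<close>
  have "indep_vars (\<lambda>_. borel) (\<lambda>i x. restrict (\<lambda>i. \<omega> i x) {m + i} (m + i)) UNIV"
    by (rule indep_vars_compose2[OF indep_vars_restrict[OF indep]])
      (auto simp: disjoint_family_on_def intro: measurable_component_singleton)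
  then have "indep_vars (\<lambda>_. borel) (\<lambda>i. \<omega> (m + i)) UNIV" by simp
  then have "distr M seq_space (\<lambda>x. \<lambda>i\<in>UNIV. \<omega> (m + i) x) = PiM UNIV (\<lambda>i. distr M borel (\<omega> (m + i)))"
    by (subst (asm) indep_vars_iff_distr_eq_PiM) auto
  then show ?thesis by (simp only: distr_\<omega> restrict_UNIV)
qed

lemma measurable_shifted [measurable]: "(\<lambda>x i. \<omega> (m + i) x) \<in> measurable M seq_space"
  by (rule measurable_abs_UNIV) simp

lemma nn_shift:
  assumes [measurable]: "F \<in> borel_measurable seq_space"
  shows "(\<integral>\<^sup>+x. F (\<lambda>i. env x (m + i)) \<partial>M) = (\<integral>\<^sup>+x. F (env x) \<partial>M)"
proof -
  have "(\<integral>\<^sup>+x. F (\<lambda>i. env x (m + i)) \<partial>M) = (\<integral>\<^sup>+y. F y \<partial>distr M seq_space (\<lambda>x i. \<omega> (m + i) x))" for m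
    unfolding env_def by (subst nn_integral_distr) auto
  from this[of m] this[of 0] show ?thesis unfolding distr_shift by simp
qed

lemma integral_shift:
  fixes F :: "(nat \<Rightarrow> real) \<Rightarrow> real"
  assumes [measurable]: "F \<in> borel_measurable seq_space"
  shows "(\<integral>x. F (\<lambda>i. env x (m + i)) \<partial>M) = (\<integral>x. F (env x) \<partial>M)"
    and "integrable M (\<lambda>x. F (\<lambda>i. env x (m + i))) \<longleftrightarrow> integrable M (\<lambda>x. F (env x))"
proof -
  have "(\<integral>x. F (\<lambda>i. env x (m + i)) \<partial>M) = (\<integral>y. F y \<partial>distr M seq_space (\<lambda>x i. \<omega> (m + i) x))" for m
    unfolding env_def by (subst integral_distr) auto
  from this[of m] this[of 0] show "(\<integral>x. F (\<lambda>i. env x (m + i)) \<partial>M) = (\<integral>x. F (env x) \<partial>M)"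
    unfolding distr_shift by simp
  have "integrable M (\<lambda>x. F (\<lambda>i. env x (m + i))) \<longleftrightarrow> integrable (distr M seq_space (\<lambda>x i. \<omega> (m + i) x)) F" for m
    unfolding env_def by (subst integrable_distr_eq) auto
  from this[of m] this[of 0] show "integrable M (\<lambda>x. F (\<lambda>i. env x (m + i))) \<longleftrightarrow> integrable M (\<lambda>x. F (env x))"
    unfolding distr_shift by simp
qed

lemma nn_identical:
  assumes [measurable]: "f \<in> borel_measurable borel"
  shows "(\<integral>\<^sup>+x. f (\<omega> n x) \<partial>M) = (\<integral>\<^sup>+y. f y \<partial>D)"
  unfolding distr_\<omega>[of n, symmetric] by (subst nn_integral_distr) auto

lemma integral_identical:
  fixes f :: "real \<Rightarrow> real"
  assumes [measurable]: "f \<in> borel_measurable borel"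
  shows "(\<integral>x. f (\<omega> n x) \<partial>M) = (\<integral>y. f y \<partial>D)"
    and "integrable M (\<lambda>x. f (\<omega> n x)) \<longleftrightarrow> integrable D f"
proof -
  have "(\<integral>y. f y \<partial>distr M borel (\<omega> n)) = (\<integral>x. f (\<omega> n x) \<partial>M)"
    by (rule integral_distr) auto
  then show "(\<integral>x. f (\<omega> n x) \<partial>M) = (\<integral>y. f y \<partial>D)" by (simp only: distr_\<omega>)
  have "integrable (distr M borel (\<omega> n)) f = integrable M (\<lambda>x. f (\<omega> n x))"
    by (rule integrable_distr_eq) auto
  then show "integrable M (\<lambda>x. f (\<omega> n x)) \<longleftrightarrow> integrable D f" by (simp only: distr_\<omega>)
qed

lemma integrable_\<omega>: "integrable M (\<omega> n)" and mean_\<omega>: "expectation (\<omega> n) = 0"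
  using integrable_1 mean_1 integral_identical[of "\<lambda>x. x" n] integral_identical[of "\<lambda>x. x" 1]
  by simp_all

definition wt :: "real \<Rightarrow> real \<Rightarrow> (nat \<Rightarrow> real) \<Rightarrow> nat \<Rightarrow> real" where
  "wt \<beta> h y i = exp h * (\<beta> * y i + 1)"

lemma wt_lower:
  assumes "0 \<le> \<beta>"
  shows "exp h * (1 - \<beta>) \<le> wt \<beta> h (env x) i"
  using mult_left_mono[OF lower[of i x] assms] by (auto simp: wt_def env_def intro!: mult_left_mono)

lemma wt_nonneg: "0 \<le> \<beta> \<Longrightarrow> \<beta> \<le> 1 \<Longrightarrow> 0 \<le> wt \<beta> h (env x) i"
  by (rule order_trans[OF _ wt_lower]) auto

lemma wt_pos: "0 \<le> \<beta> \<Longrightarrow> \<beta> < 1 \<Longrightarrow> 0 < wt \<beta> h (env x) i"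
  by (rule less_le_trans[OF _ wt_lower]) auto

lemma measurable_wt [measurable]: "(\<lambda>y. wt \<beta> h y i) \<in> borel_measurable seq_space"
  unfolding wt_def using measurable_coordinate by auto

lemma wt_shift: "wt \<beta> h y (m + i) = wt \<beta> h (\<lambda>j. y (m + j)) i"
  by (simp add: wt_def)

end

section \<open>Tail and moments of the disorder\<close>

locale heavy_environment = environment M \<omega> for M :: "'a measure" and \<omega> +
  fixes C_P \<gamma> :: real
  assumes C_P_pos: "0 < C_P" and \<gamma>_range: "1 < \<gamma>" "\<gamma> < 2"
    and tail: "(\<lambda>t. measure M {x \<in> space M. \<omega> 1 x \<ge> t}) \<sim>[at_top] (\<lambda>t. C_P * t powr (- \<gamma>))"
begin

definition tl :: "real \<Rightarrow> real" where "tl t = measure M {x \<in> space M. \<omega> 1 x \<ge> t}"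

lemma tl_ratio: "((\<lambda>t. tl t / (C_P * t powr (- \<gamma>))) \<longlongrightarrow> 1) at_top"
  unfolding tl_def
proof (rule asymp_equivD_strong[OF tail])
  show "\<forall>\<^sub>F t in at_top. measure M {x \<in> space M. \<omega> 1 x \<ge> t} \<noteq> 0 \<or> C_P * t powr (- \<gamma>) \<noteq> 0"
    using eventually_gt_at_top[of 0] by eventually_elim (use C_P_pos in simp)
qed

lemma tl_le_1: "tl t \<le> 1" unfolding tl_def by simp

lemma tl_bounds: "\<exists>c>0. \<exists>C>0. \<exists>t0\<ge>1. (\<forall>t\<ge>t0. c * t powr (- \<gamma>) \<le> tl t) \<and> (\<forall>t>0. tl t \<le> C * t powr (- \<gamma>))"
proof -
  have "eventually (\<lambda>t. 1/2 < tl t / (C_P * t powr (- \<gamma>)) \<and> tl t / (C_P * t powr (- \<gamma>)) < 2) at_top"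
    using order_tendstoD(1)[OF tl_ratio, of "1/2"] order_tendstoD(2)[OF tl_ratio, of 2]
    by (auto intro: eventually_conj)
  then obtain t1 where t1: "\<And>t. t \<ge> t1 \<Longrightarrow> 1/2 < tl t / (C_P * t powr (- \<gamma>))"
    "\<And>t. t \<ge> t1 \<Longrightarrow> tl t / (C_P * t powr (- \<gamma>)) < 2"
    by (auto simp: eventually_at_top_linorder)
  define t0 where "t0 = max 1 t1"
  have t0: "t0 \<ge> 1" "t0 \<ge> t1" by (auto simp: t0_def)
  have lo: "C_P / 2 * t powr (- \<gamma>) \<le> tl t" if "t \<ge> t0" for t
    using t1(1)[of t] that t0 C_P_pos by (simp add: field_simps)
  have hi: "tl t \<le> max (2 * C_P) (t0 powr \<gamma>) * t powr (- \<gamma>)" if "t > 0" for t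
  proof (cases "t \<ge> t0")
    case True
    then have "tl t \<le> 2 * C_P * t powr (- \<gamma>)"
      using t1(2)[of t] that t0 C_P_pos by (simp add: field_simps)
    also have "\<dots> \<le> max (2 * C_P) (t0 powr \<gamma>) * t powr (- \<gamma>)"
      by (intro mult_right_mono) auto
    finally show ?thesis .
  next
    case False
    have "tl t \<le> 1" by (rule tl_le_1)
    also have "1 = t powr \<gamma> * t powr (- \<gamma>)" using that by (simp add: powr_minus)
    also have "\<dots> \<le> t0 powr \<gamma> * t powr (- \<gamma>)"
      using False that \<gamma>_range by (intro mult_right_mono powr_mono2) auto
    also have "\<dots> \<le> max (2 * C_P) (t0 powr \<gamma>) * t powr (- \<gamma>)"
      by (intro mult_right_mono) auto
    finally show ?thesis .
  qed
  show ?thesis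
    by (intro exI[of _ "C_P/2"] exI[of _ "max (2 * C_P) (t0 powr \<gamma>)"] exI[of _ t0] conjI allI impI)
      (use C_P_pos t0 lo hi in auto)
qed

text \<open>Dyadic layers: for y in [2^j, 2^(j+1)] the power is at most 2^(p (j+1)), the mass above
  2^j is O(2^(-\<gamma> j)), and the resulting series is geometric with ratio 2^(p - \<gamma>) < 1.
  Values in [-1, 1] are covered by the constant 1.\<close>

lemma \<omega>_moment:
  assumes p: "1 \<le> p" "p < \<gamma>"
  shows "integrable D (\<lambda>y. \<bar>y\<bar> powr p)"
proof -
  obtain C where C: "C > 0" "\<And>t. t > 0 \<Longrightarrow> tl t \<le> C * t powr (- \<gamma>)"
    using tl_bounds by blast
  have D: "emeasure D {2 ^ j..} = ennreal (tl (2 ^ j))" for j :: nat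
    unfolding D_def tl_def
    by (subst emeasure_distr) (auto simp: emeasure_eq_measure vimage_def intro!: arg_cong[where f = "measure M"])
  have sum: "summable (\<lambda>j. (2 powr p * C) * (2 powr (p - \<gamma>)) ^ j)"
    using p by (intro summable_mult summable_geometric) (simp add: powr_less_one)
  have AE: "AE y in D. - 1 \<le> y"
    unfolding D_def by (subst AE_distr_iff) (auto simp: lower)
  have "(\<integral>\<^sup>+y. ennreal (\<bar>y\<bar> powr p) \<partial>D)
      \<le> (\<integral>\<^sup>+y. 1 + (\<Sum>j. ennreal (2 powr (p * (real j + 1))) * indicator {2 ^ j..} y) \<partial>D)"
  proof (rule nn_integral_mono_AE)
    show "AE y in D. ennreal (\<bar>y\<bar> powr p)
        \<le> 1 + (\<Sum>j. ennreal (2 powr (p * (real j + 1))) * indicator {2 ^ j..} y)"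
      using AE
    proof eventually_elim
      case (elim y)
      show ?case
      proof (cases "y \<le> 1")
        case True
        then have "\<bar>y\<bar> powr p \<le> 1 powr p" using elim p by (intro powr_mono2) auto
        then have "ennreal (\<bar>y\<bar> powr p) \<le> ennreal 1" by (intro ennreal_leI) simp
        then show ?thesis by (simp add: add_increasing2)
      next
        case False
        define j where "j = nat \<lfloor>log 2 y\<rfloor>"
        have l: "0 \<le> log 2 y" using False by simp
        have j: "real j \<le> log 2 y" "log 2 y \<le> real j + 1"
          using l by (auto simp: j_def)
        have "2 powr real j \<le> y" "y \<le> 2 powr (real j + 1)"
          using j False by (simp_all add: le_log_iff log_le_iff)
        then have y: "2 ^ j \<le> y" "y powr p \<le> 2 powr (p * (real j + 1))"
          using p False powr_mono2[of p y "2 powr (real j + 1)"]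
          by (auto simp: powr_realpow powr_powr mult.commute)
        have "ennreal (\<bar>y\<bar> powr p) \<le> ennreal (2 powr (p * (real j + 1))) * indicator {2 ^ j..} y"
          using y False by (auto intro!: ennreal_leI)
        also have "\<dots> = (\<Sum>i\<in>{j}. ennreal (2 powr (p * (real i + 1))) * indicator {2 ^ i..} y)"
          by (simp only: sum.insert finite.emptyI empty_iff not_False_eq_True sum.empty add_0_right)
        also have "\<dots> \<le> (\<Sum>j. ennreal (2 powr (p * (real j + 1))) * indicator {2 ^ j..} y)"
          by (rule sum_le_suminf) auto
        finally show ?thesis by (simp add: add_increasing)
      qed
    qed
  qed
  also have "\<dots> = 1 + (\<Sum>j. ennreal (2 powr (p * (real j + 1))) * ennreal (tl (2 ^ j)))"
  proof -
    have m: "(\<lambda>y. ennreal (2 powr (p * (real j + 1))) * indicator {2 ^ j..} y) \<in> borel_measurable D" for j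
      by (intro borel_measurable_times_ennreal borel_measurable_const borel_measurable_indicator) simp
    have m': "(\<lambda>y. \<Sum>j. ennreal (2 powr (p * (real j + 1))) * indicator {2 ^ j..} y) \<in> borel_measurable D"
      by (rule borel_measurable_suminf_order[OF m])
    have "(\<integral>\<^sup>+y. ennreal (2 powr (p * (real j + 1))) * indicator {2 ^ j..} y \<partial>D)
        = ennreal (2 powr (p * (real j + 1))) * ennreal (tl (2 ^ j))" for j
      unfolding D[symmetric] by (rule nn_integral_cmult_indicator) simp
    moreover have "(\<integral>\<^sup>+y. (\<Sum>j. ennreal (2 powr (p * (real j + 1))) * indicator {2 ^ j..} y) \<partial>D)
        = (\<Sum>j. \<integral>\<^sup>+y. ennreal (2 powr (p * (real j + 1))) * indicator {2 ^ j..} y \<partial>D)"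
      by (rule nn_integral_suminf[OF m])
    moreover have "(\<integral>\<^sup>+y. 1 \<partial>D) = 1"
      using prob_space.emeasure_space_1[OF prob_space_D] by simp
    ultimately show ?thesis by (subst nn_integral_add[OF borel_measurable_const m']) (simp only:)
  qed
  also have "\<dots> \<le> 1 + (\<Sum>j. ennreal ((2 powr p * C) * (2 powr (p - \<gamma>)) ^ j))"
  proof (intro add_left_mono suminf_le)
    fix j :: nat
    have "2 powr (p * (real j + 1)) * tl (2 ^ j) \<le> 2 powr (p * (real j + 1)) * (C * (2 ^ j) powr (- \<gamma>))"
      using C(2)[of "2 ^ j"] by (intro mult_left_mono) auto
    also have "((2::real) ^ j) powr (- \<gamma>) = 2 powr (- \<gamma> * real j)"
      by (subst powr_realpow[symmetric]) (simp_all add: powr_powr mult.commute)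
    also have "2 powr (p * (real j + 1)) * (C * 2 powr (- \<gamma> * real j))
        = (2 powr p * C) * (2 powr ((p - \<gamma>) * real j))"
    proof -
      have "2 powr (p * (real j + 1)) * 2 powr (- \<gamma> * real j) = 2 powr (p * (real j + 1) + - \<gamma> * real j)"
        by (rule powr_add[symmetric])
      also have "p * (real j + 1) + - \<gamma> * real j = p + (p - \<gamma>) * real j" by (simp add: algebra_simps)
      also have "2 powr \<dots> = 2 powr p * 2 powr ((p - \<gamma>) * real j)" by (rule powr_add)
      finally show ?thesis by (simp only: mult.left_commute mult.commute mult.assoc)
    qed
    also have "2 powr ((p - \<gamma>) * real j) = (2 powr (p - \<gamma>)) ^ j"
      by (subst powr_realpow[symmetric]) (simp_all add: powr_powr)
    finally show "ennreal (2 powr (p * (real j + 1))) * ennreal (tl (2 ^ j))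
        \<le> ennreal ((2 powr p * C) * (2 powr (p - \<gamma>)) ^ j)"
      by (simp add: ennreal_mult'[symmetric] ennreal_leI)
  qed auto
  also have "(\<Sum>j. ennreal ((2 powr p * C) * (2 powr (p - \<gamma>)) ^ j))
      = ennreal (\<Sum>j. (2 powr p * C) * (2 powr (p - \<gamma>)) ^ j)"
    using less_imp_le[OF C(1)]
    by (intro suminf_ennreal2[OF _ sum] mult_nonneg_nonneg zero_le_power powr_ge_zero)
  also have "1 + \<dots> < \<infinity>"
    by (simp only: ennreal_1[symmetric] ennreal_add_eq_top infinity_ennreal_def less_top[symmetric])
      (simp only: ennreal_neq_top, simp)
  finally have "(\<integral>\<^sup>+y. ennreal (norm (\<bar>y\<bar> powr p)) \<partial>D) < \<infinity>" by simp
  then show ?thesis by (intro integrableI_bounded) auto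
qed

end

subsection \<open>Delocalization by fractional moments\<close>

locale pinning = pinning_kernel K \<alpha> C_K + heavy_environment M \<omega> C_P \<gamma>
  for K :: "nat \<Rightarrow> real" and \<alpha> C_K and M :: "'a measure" and \<omega> and C_P \<gamma>
begin

lemma depends_W: "depends_on {1..n} (\<lambda>y. W (wt \<beta> h y) k n)"
  by (rule depends_onI, rule W_cong) (simp add: wt_def)

lemma depends_Z: "depends_on {1..n} (\<lambda>y. Z (wt \<beta> h y) n)"
  by (rule depends_onI, rule Z_cong) (simp add: wt_def)

lemma measurable_W_wt [measurable]: "(\<lambda>y. W (wt \<beta> h y) k n) \<in> borel_measurable seq_space"
  by (rule measurable_W[OF measurable_wt])

lemma measurable_Z_wt [measurable]: "(\<lambda>y. Z (wt \<beta> h y) n) \<in> borel_measurable seq_space"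
  by (rule measurable_Z[OF measurable_wt])

lemma W_wt_nonneg: "0 \<le> \<beta> \<Longrightarrow> \<beta> \<le> 1 \<Longrightarrow> 0 \<le> W (wt \<beta> h (env x)) k n"
  by (intro W_nonneg wt_nonneg)

lemma Z_wt_nonneg: "0 \<le> \<beta> \<Longrightarrow> \<beta> \<le> 1 \<Longrightarrow> 0 \<le> Z (wt \<beta> h (env x)) n"
  by (intro Z_nonneg wt_nonneg)

lemma measurable_prod_coordinates:
  fixes g :: "real \<Rightarrow> real"
  assumes [measurable]: "g \<in> borel_measurable borel"
  shows "(\<lambda>y. \<Prod>i\<in>I. g (y i)) \<in> borel_measurable seq_space"
  by (intro borel_measurable_prod measurable_compose[OF measurable_coordinate assms])

text \<open>Induction on the number of contacts: the damped weight of the last one depends on site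
  \<open>n\<close> alone and is independent of everything up to the previous contact, so each
  contact contributes a factor \<open>r\<close>. With \<open>g = 1\<close> and
  \<open>r = exp h\<close> this is the annealed bound.\<close>

lemma tilted_W_le:
  fixes g :: "real \<Rightarrow> real"
  assumes g [measurable]: "g \<in> borel_measurable borel" and g01: "\<And>y. 0 \<le> g y" "\<And>y. g y \<le> 1"
    and \<beta>: "0 \<le> \<beta>" "\<beta> \<le> 1" and r: "0 \<le> r"
    and int: "(\<integral>\<^sup>+y. ennreal (g y * (exp h * (\<beta> * y + 1))) \<partial>D) \<le> ennreal r"
  shows "(\<integral>\<^sup>+x. ennreal ((\<Prod>i=1..n. g (env x i)) * W (wt \<beta> h (env x)) k n) \<partial>M) \<le> ennreal (r ^ k * kap k n)"
proof (induction k arbitrary: n)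
  case 0
  have "(\<integral>\<^sup>+x. ennreal ((\<Prod>i=1..n. g (env x i)) * W (wt \<beta> h (env x)) 0 n) \<partial>M)
      \<le> (\<integral>\<^sup>+x. ennreal (kap 0 n) \<partial>M)"
    by (intro nn_integral_mono ennreal_leI) simp
  then show ?case by (simp add: emeasure_space_1)
next
  case (Suc k)
  let ?H = "\<lambda>n y. (\<Prod>i=1..n. g (y i)) * W (wt \<beta> h y) k n"
  let ?f = "\<lambda>y. g y * (exp h * (\<beta> * y + 1))"
  have m [measurable]: "(\<lambda>y. ?H i y) \<in> borel_measurable seq_space" for i
    by (intro borel_measurable_times measurable_prod_coordinates g measurable_W_wt)
  have mf: "(\<lambda>y. ?f (y n)) \<in> borel_measurable seq_space"
    by (rule measurable_compose[OF measurable_coordinate[of n]]) simp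
  have Hnn: "0 \<le> ?H i (env x)" for i x
    by (intro mult_nonneg_nonneg prod_nonneg W_wt_nonneg \<beta>) (simp add: g01)
  have fnn: "0 \<le> ?f (env x n)" for x
    using wt_nonneg[OF \<beta>, of h x n] by (simp add: wt_def g01)
  have rk: "0 \<le> r ^ k * kap k i" for i
    using r kap_nonneg by simp
  have le: "(\<Prod>i=1..n. g (env x i)) * W (wt \<beta> h (env x)) (Suc k) n
      \<le> (\<Sum>i<n. K (n - i) * (?f (env x n) * ?H i (env x)))" for x
  proof (cases "n = 0")
    case False
    then obtain l where l: "n = Suc l" by (cases n) auto
    have "(\<Prod>i=1..n. g (env x i)) * W (wt \<beta> h (env x)) (Suc k) n
        = (\<Sum>i\<le>n. (\<Prod>i=1..n. g (env x i)) * (wt \<beta> h (env x) n * (W (wt \<beta> h (env x)) k i * K (n - i))))"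
      by (simp add: sum_distrib_left)
    also have "\<dots> = (\<Sum>i<n. (\<Prod>i=1..n. g (env x i)) * (wt \<beta> h (env x) n * (W (wt \<beta> h (env x)) k i * K (n - i))))"
      by (rule sum.mono_neutral_right) (auto simp: K_0)
    also have "\<dots> \<le> (\<Sum>i<n. K (n - i) * (?f (env x n) * ?H i (env x)))"
    proof (rule sum_mono)
      fix i assume i: "i \<in> {..<n}"
      \<comment> \<open>Damping factors at the sites strictly between the last two contacts are at
        most 1 and are discarded; the one at \<open>n\<close> is paired with the weight
        there.\<close>
      have "{1..l} = {1..i} \<union> {i<..l}" using i l by auto
      then have "(\<Prod>i=1..l. g (env x i)) = (\<Prod>i=1..i. g (env x i)) * (\<Prod>i\<in>{i<..l}. g (env x i))"
        by (simp only:) (rule prod.union_disjoint, auto)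
      also have "\<dots> \<le> (\<Prod>i=1..i. g (env x i)) * 1"
        by (intro mult_left_mono prod_le_1 prod_nonneg) (auto simp: g01)
      finally have "(\<Prod>i=1..n. g (env x i)) \<le> (\<Prod>i=1..i. g (env x i)) * g (env x n)"
        unfolding l by (simp add: mult_right_mono g01)
      then have "(\<Prod>i=1..n. g (env x i)) * (wt \<beta> h (env x) n * (W (wt \<beta> h (env x)) k i * K (n - i)))
          \<le> ((\<Prod>i=1..i. g (env x i)) * g (env x n)) * (wt \<beta> h (env x) n * (W (wt \<beta> h (env x)) k i * K (n - i)))"
        by (intro mult_right_mono mult_nonneg_nonneg wt_nonneg W_wt_nonneg K_nonneg \<beta>)
      then show "(\<Prod>i=1..n. g (env x i)) * (wt \<beta> h (env x) n * (W (wt \<beta> h (env x)) k i * K (n - i)))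
          \<le> K (n - i) * (?f (env x n) * ?H i (env x))"
        by (simp only: wt_def mult_ac)
    qed
    finally show ?thesis .
  qed (simp add: K_0)
  have "(\<integral>\<^sup>+x. ennreal ((\<Prod>i=1..n. g (env x i)) * W (wt \<beta> h (env x)) (Suc k) n) \<partial>M)
      \<le> (\<integral>\<^sup>+x. (\<Sum>i<n. ennreal (K (n - i)) * (ennreal (?f (env x n)) * ennreal (?H i (env x)))) \<partial>M)"
  proof (rule nn_integral_mono)
    fix x
    have "ennreal ((\<Prod>i=1..n. g (env x i)) * W (wt \<beta> h (env x)) (Suc k) n)
        \<le> ennreal (\<Sum>i<n. K (n - i) * (?f (env x n) * ?H i (env x)))"
      by (rule ennreal_leI[OF le])
    also have "\<dots> = (\<Sum>i<n. ennreal (K (n - i) * (?f (env x n) * ?H i (env x))))"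
      by (rule sum_ennreal[symmetric]) (intro mult_nonneg_nonneg[OF K_nonneg mult_nonneg_nonneg[OF fnn Hnn]])
    also have "\<dots> = (\<Sum>i<n. ennreal (K (n - i)) * (ennreal (?f (env x n)) * ennreal (?H i (env x))))"
      by (simp only: ennreal_mult[OF K_nonneg mult_nonneg_nonneg[OF fnn Hnn]] ennreal_mult[OF fnn Hnn])
    finally show "ennreal ((\<Prod>i=1..n. g (env x i)) * W (wt \<beta> h (env x)) (Suc k) n)
        \<le> (\<Sum>i<n. ennreal (K (n - i)) * (ennreal (?f (env x n)) * ennreal (?H i (env x))))" .
  qed
  also have "\<dots> = (\<Sum>i<n. ennreal (K (n - i)) * (\<integral>\<^sup>+x. ennreal (?f (env x n)) * ennreal (?H i (env x)) \<partial>M))"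
    using mf by (subst nn_integral_sum) (auto intro!: sum.cong nn_integral_cmult)
  also have "\<dots> \<le> (\<Sum>i<n. ennreal (K (n - i)) * (ennreal r * ennreal (r ^ k * kap k i)))"
  proof (intro sum_mono mult_left_mono)
    fix i assume i: "i \<in> {..<n}"
    have "(\<integral>\<^sup>+x. ennreal (?f (env x n)) * ennreal (?H i (env x)) \<partial>M)
        = (\<integral>\<^sup>+x. ennreal (?f (env x n)) \<partial>M) * (\<integral>\<^sup>+x. ennreal (?H i (env x)) \<partial>M)"
    proof (rule nn_indep[where A = "{n}" and B = "{1..i}"])
      show "depends_on {1..i} (\<lambda>y. ennreal (?H i y))"
      proof (rule depends_onI)
        fix y y' :: "nat \<Rightarrow> real" assume *: "\<And>j. j \<in> {1..i} \<Longrightarrow> y j = y' j"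
        have "W (wt \<beta> h y) k i = W (wt \<beta> h y') k i" by (rule depends_onD[OF depends_W *])
        moreover have "(\<Prod>j=1..i. g (y j)) = (\<Prod>j=1..i. g (y' j))" by (intro prod.cong) (auto simp: *)
        ultimately show "ennreal (?H i y) = ennreal (?H i y')" by simp
      qed
    qed (use i mf in \<open>auto intro: depends_onI\<close>)
    also have "(\<integral>\<^sup>+x. ennreal (?f (env x n)) \<partial>M) = (\<integral>\<^sup>+y. ennreal (?f y) \<partial>D)"
      unfolding env_def by (rule nn_identical) simp
    also have "\<dots> * (\<integral>\<^sup>+x. ennreal (?H i (env x)) \<partial>M) \<le> ennreal r * ennreal (r ^ k * kap k i)"
      by (intro mult_mono int Suc.IH) auto
    finally show "(\<integral>\<^sup>+x. ennreal (?f (env x n)) * ennreal (?H i (env x)) \<partial>M) \<le> ennreal r * ennreal (r ^ k * kap k i)" .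
  qed simp
  also have "\<dots> = (\<Sum>i<n. ennreal (K (n - i) * (r * (r ^ k * kap k i))))"
    by (simp only: ennreal_mult[OF K_nonneg mult_nonneg_nonneg[OF r rk]] ennreal_mult[OF r rk])
  also have "\<dots> = ennreal (\<Sum>i<n. K (n - i) * (r * (r ^ k * kap k i)))"
    by (rule sum_ennreal) (intro mult_nonneg_nonneg K_nonneg r rk)
  also have "(\<Sum>i<n. K (n - i) * (r * (r ^ k * kap k i))) = r ^ Suc k * (\<Sum>i<n. kap k i * K (n - i))"
    by (simp add: sum_distrib_left mult_ac)
  also have "(\<Sum>i<n. kap k i * K (n - i)) = (\<Sum>i\<le>n. kap k i * K (n - i))"
    by (rule sum.mono_neutral_left) (auto simp: K_0)
  finally show ?case by simp
qed

lemma tilted_Z_le: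
  fixes g :: "real \<Rightarrow> real"
  assumes g [measurable]: "g \<in> borel_measurable borel" and g01: "\<And>y. 0 \<le> g y" "\<And>y. g y \<le> 1"
    and \<beta>: "0 \<le> \<beta>" "\<beta> \<le> 1" and r: "0 \<le> r"
    and int: "(\<integral>\<^sup>+y. ennreal (g y * (exp h * (\<beta> * y + 1))) \<partial>D) \<le> ennreal r"
  shows "(\<integral>\<^sup>+x. ennreal ((\<Prod>i=1..n. g (env x i)) * Z (wt \<beta> h (env x)) n) \<partial>M)
    \<le> ennreal (\<Sum>k\<le>n. r ^ k * kap k n)"
proof -
  let ?H = "\<lambda>k y. (\<Prod>i=1..n. g (y i)) * W (wt \<beta> h y) k n"
  have m [measurable]: "(\<lambda>y. ?H i y) \<in> borel_measurable seq_space" for i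
    by (intro borel_measurable_times measurable_prod_coordinates g measurable_W_wt)
  have Hnn: "0 \<le> ?H i (env x)" for i x
    by (intro mult_nonneg_nonneg prod_nonneg W_wt_nonneg \<beta>) (simp add: g01)
  have "(\<integral>\<^sup>+x. ennreal ((\<Prod>i=1..n. g (env x i)) * Z (wt \<beta> h (env x)) n) \<partial>M)
      = (\<integral>\<^sup>+x. (\<Sum>k\<le>n. ennreal (?H k (env x))) \<partial>M)"
    using Hnn by (intro nn_integral_cong) (simp add: Z_def sum_distrib_left sum_ennreal)
  also have "\<dots> = (\<Sum>k\<le>n. \<integral>\<^sup>+x. ennreal (?H k (env x)) \<partial>M)"
    by (rule nn_integral_sum) simp
  also have "\<dots> \<le> (\<Sum>k\<le>n. ennreal (r ^ k * kap k n))"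
    by (intro sum_mono tilted_W_le assms)
  also have "\<dots> = ennreal (\<Sum>k\<le>n. r ^ k * kap k n)"
    using r kap_nonneg by (intro sum_ennreal) simp
  finally show ?thesis .
qed

section \<open>Damping the large values of the disorder\<close>

definition damp :: "real \<Rightarrow> real \<Rightarrow> real" where "damp t y = (if t \<le> y then 1/2 else 1)"

lemma measurable_damp [measurable]: "damp t \<in> borel_measurable borel"
  unfolding damp_def[abs_def] by measurable

lemma measure_D_tail: "measure D {t..} = tl t"
  unfolding D_def tl_def
  by (subst measure_distr) (auto simp: vimage_def Int_def conj_commute intro!: arg_cong[where f = "measure M"])

lemma AE_D: "AE y in D. - 1 \<le> y"
  unfolding D_def by (subst AE_distr_iff) (auto simp: lower)

lemma integrable_D: "integrable D (\<lambda>y. y)" and mean_D: "(\<integral>y. y \<partial>D) = 0"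
  using integrable_1 mean_1 integral_identical[of "\<lambda>x. x" 1] by simp_all

lemma mean_weight_le:
  assumes \<beta>: "0 \<le> \<beta>" "\<beta> \<le> 1"
  shows "(\<integral>\<^sup>+y. ennreal (1 * (exp h * (\<beta> * y + 1))) \<partial>D) \<le> ennreal (exp h)"
proof -
  interpret D: prob_space D by (rule prob_space_D)
  have "AE y in D. 0 \<le> 1 * (exp h * (\<beta> * y + 1))"
    using AE_D
  proof eventually_elim
    case (elim y)
    have "\<beta> * - 1 \<le> \<beta> * y" using elim \<beta> by (intro mult_left_mono) auto
    then show ?case using \<beta> by simp
  qed
  then show ?thesis using integrable_D mean_D by (subst nn_integral_eq_integral) auto
qed

lemma integrable_D_indicator: "integrable D (indicator {t..} :: real \<Rightarrow> real)"
proof -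
  interpret D: prob_space D by (rule prob_space_D)
  show ?thesis by (rule integrable_real_indicator) (simp_all add: less_top[symmetric])
qed

lemma measure_D_UNIV [simp]: "measure D UNIV = 1"
  using prob_space.prob_space[OF prob_space_D] by simp

text \<open>Up to the factor e^h, halving the weight at y >= t removes (\<beta> y + 1) / 2 >=
  \<beta> t / 2, and this happens with probability \<open>tl t\<close>. The mean weight, which is
  e^h before damping, drops accordingly.\<close>

lemma damp_step:
  assumes "0 < \<beta>" "\<beta> \<le> 1" "0 < t"
  shows "(\<integral>\<^sup>+y. ennreal (damp t y * (exp h * (\<beta> * y + 1))) \<partial>D) \<le> ennreal (exp (h - \<beta> * t * tl t / 2))"
proof -
  interpret D: prob_space D by (rule prob_space_D)
  let ?k = "\<lambda>y. exp h * ((\<beta> * y + 1) - \<beta> * t / 2 * indicator {t..} y)"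
  have kint: "integrable D ?k" and kval: "(\<integral>y. ?k y \<partial>D) = exp h * (1 - \<beta> * t / 2 * tl t)"
    using integrable_D integrable_D_indicator mean_D by (simp_all add: measure_D_tail)
  have AE: "AE y in D. 0 \<le> ?k y \<and> damp t y * (exp h * (\<beta> * y + 1)) \<le> ?k y"
    using AE_D
  proof eventually_elim
    case (elim y)
    have "\<beta> * - 1 \<le> \<beta> * y" using elim assms by (intro mult_left_mono) auto
    then have "0 \<le> \<beta> * y + 1" using assms by linarith
    moreover have "\<beta> * t / 2 \<le> (\<beta> * y + 1) / 2" if "t \<le> y"
    proof -
      have "\<beta> * t \<le> \<beta> * y" using that assms by (intro mult_left_mono) auto
      then have "\<beta> * t \<le> \<beta> * y + 1" by simp
      then show ?thesis by (rule divide_right_mono) simp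
    qed
    ultimately have "0 \<le> (\<beta> * y + 1) - \<beta> * t / 2 * indicator {t..} y
        \<and> damp t y * (\<beta> * y + 1) \<le> (\<beta> * y + 1) - \<beta> * t / 2 * indicator {t..} y"
      by (auto simp: damp_def indicator_def)
    then show ?case
      using mult_left_mono[of "damp t y * (\<beta> * y + 1)" _ "exp h"] by (simp only: mult.left_commute) simp
  qed
  have "(\<integral>\<^sup>+y. ennreal (damp t y * (exp h * (\<beta> * y + 1))) \<partial>D) \<le> (\<integral>\<^sup>+y. ennreal (?k y) \<partial>D)"
    using AE by (intro nn_integral_mono_AE) (erule eventually_mono, intro ennreal_leI, elim conjE)
  also have "\<dots> = ennreal (exp h * (1 - \<beta> * t / 2 * tl t))"
  proof -
    have "AE y in D. 0 \<le> ?k y" using AE by (rule eventually_mono) (elim conjE)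
    then show ?thesis by (subst nn_integral_eq_integral[OF kint]) (simp_all only: kval)
  qed
  also have "\<dots> \<le> ennreal (exp h * exp (- (\<beta> * t / 2 * tl t)))"
    using exp_ge_add_one_self[of "- (\<beta> * t / 2 * tl t)"] by (intro ennreal_leI mult_left_mono) auto
  finally show ?thesis by (simp add: exp_add[symmetric])
qed

text \<open>A damped site contributes 2^s but is rare, so each of the independent factors has mean
  at most 1 + 2^s \<open>tl t\<close>. The price is governed by \<open>n * tl t\<close>, the
  expected number of damped sites.\<close>

lemma damp_moment:
  assumes "0 < s"
  shows "(\<integral>\<^sup>+x. ennreal ((\<Prod>i=1..n. damp t (env x i)) powr (- s)) \<partial>M) \<le> ennreal (exp (2 powr s * (real n * tl t)))"
proof -
  interpret D: prob_space D by (rule prob_space_D)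
  have "indep_vars (\<lambda>_. borel) (\<lambda>i x. ennreal (damp t (\<omega> i x) powr (- s))) {1..n}"
    by (rule indep_vars_compose2[OF indep_vars_subset[OF indep]]) auto
  then have "(\<integral>\<^sup>+x. (\<Prod>i=1..n. ennreal (damp t (\<omega> i x) powr (- s))) \<partial>M)
      = (\<Prod>i=1..n. \<integral>\<^sup>+x. ennreal (damp t (\<omega> i x) powr (- s)) \<partial>M)"
    by (intro indep_vars_nn_integral) auto
  also have "(\<integral>\<^sup>+x. ennreal (damp t (\<omega> i x) powr (- s)) \<partial>M) \<le> ennreal (exp (2 powr s * tl t))" for i
  proof -
    have "(\<integral>\<^sup>+x. ennreal (damp t (\<omega> i x) powr (- s)) \<partial>M) = (\<integral>\<^sup>+y. ennreal (damp t y powr (- s)) \<partial>D)"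
      by (rule nn_identical) simp
    also have "\<dots> \<le> (\<integral>\<^sup>+y. ennreal (1 + 2 powr s * indicator {t..} y) \<partial>D)"
      using assms by (intro nn_integral_mono ennreal_leI) (auto simp: damp_def powr_minus powr_divide indicator_def)
    also have "\<dots> = ennreal (1 + 2 powr s * tl t)"
      using integrable_D_indicator
      by (subst nn_integral_eq_integral) (auto simp: measure_D_tail)
    also have "\<dots> \<le> ennreal (exp (2 powr s * tl t))"
      by (intro ennreal_leI exp_ge_add_one_self)
    finally show ?thesis .
  qed
  then have "(\<Prod>i=1..n. \<integral>\<^sup>+x. ennreal (damp t (\<omega> i x) powr (- s)) \<partial>M)
      \<le> (\<Prod>i=1..n. ennreal (exp (2 powr s * tl t)))"
    by (intro prod_mono_ennreal)
  also have "\<dots> = ennreal (exp (2 powr s * (real n * tl t)))"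
    by (simp add: ennreal_power exp_of_nat_mult[symmetric] mult_ac)
  finally have *: "(\<integral>\<^sup>+x. (\<Prod>i=1..n. ennreal (damp t (\<omega> i x) powr (- s))) \<partial>M) \<le> ennreal (exp (2 powr s * (real n * tl t)))" .
  have "(\<Prod>i=1..n. damp t (env x i)) powr (- s) = (\<Prod>i=1..n. damp t (\<omega> i x) powr (- s))" for x
    unfolding env_def by (rule prod_powr_distrib)
  then show ?thesis using * by (simp add: prod_ennreal)
qed

end

section \<open>Inequalities for sums of fractional powers\<close>

lemma powr_sum_le:
  fixes f :: "'i \<Rightarrow> real"
  assumes "finite I" "\<And>i. i \<in> I \<Longrightarrow> 0 \<le> f i" "0 < s" "s \<le> 1"
  shows "(\<Sum>i\<in>I. f i) powr s \<le> (\<Sum>i\<in>I. f i powr s)"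
  using assms(1,2)
proof (induction I rule: finite_induct)
  case (insert i I)
  have "(\<Sum>i\<in>insert i I. f i) powr s \<le> f i powr s + (\<Sum>i\<in>I. f i) powr s"
    using insert assms(3,4) by (auto intro!: powr_add_le sum_nonneg)
  also have "\<dots> \<le> f i powr s + (\<Sum>i\<in>I. f i powr s)"
    using insert by simp
  finally show ?case using insert by simp
qed simp

text \<open>One of j and l - j is at least l / 2; the corresponding factor is replaced by its value
  at l / 2 and the other one is summed.\<close>

lemma sum_powr_convolution_le:
  fixes \<theta> \<kappa> :: real
  assumes "0 \<le> \<theta>" "\<theta> < 1" "0 \<le> \<kappa>" "\<kappa> < 1"
  shows "\<exists>C>0. \<forall>l\<ge>1. (\<Sum>j=1..<l. real j powr (- \<theta>) * real (l - j) powr (- \<kappa>)) \<le> C * real l powr (1 - \<theta> - \<kappa>)"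
proof -
  define C where "C = 2 powr \<kappa> / (1 - \<theta>) + 2 powr \<theta> / (1 - \<kappa>)"
  have C: "0 < C" unfolding C_def using assms by (intro add_pos_pos divide_pos_pos) auto
  have "(\<Sum>j=1..<l. real j powr (- \<theta>) * real (l - j) powr (- \<kappa>)) \<le> C * real l powr (1 - \<theta> - \<kappa>)"
    if l: "l \<ge> 1" for l :: nat
  proof -
    let ?h = "real l / 2"
    have h: "0 < ?h" using l by simp
    have "(\<Sum>j=1..<l. real j powr (- \<theta>) * real (l - j) powr (- \<kappa>))
        \<le> (\<Sum>j=1..<l. real j powr (- \<theta>) * ?h powr (- \<kappa>) + ?h powr (- \<theta>) * real (l - j) powr (- \<kappa>))"
    proof (rule sum_mono)
      fix j assume j: "j \<in> {1..<l}"
      show "real j powr (- \<theta>) * real (l - j) powr (- \<kappa>)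
          \<le> real j powr (- \<theta>) * ?h powr (- \<kappa>) + ?h powr (- \<theta>) * real (l - j) powr (- \<kappa>)"
      proof (cases "real j \<le> ?h")
        case True
        have "real (l - j) powr (- \<kappa>) \<le> ?h powr (- \<kappa>)"
          using True j h assms by (intro powr_mono2') (auto simp: of_nat_diff)
        then show ?thesis by (intro add_increasing2 mult_left_mono) auto
      next
        case False
        have "real j powr (- \<theta>) \<le> ?h powr (- \<theta>)"
          using False h assms by (intro powr_mono2') auto
        then show ?thesis by (intro add_increasing mult_right_mono) auto
      qed
    qed
    also have "\<dots> = ?h powr (- \<kappa>) * (\<Sum>j=1..<l. real j powr (- \<theta>)) + ?h powr (- \<theta>) * (\<Sum>j=1..<l. real (l - j) powr (- \<kappa>))"
      by (simp add: sum.distrib sum_distrib_left mult_ac)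
    also have "(\<Sum>j=1..<l. real (l - j) powr (- \<kappa>)) = (\<Sum>j=1..<l. real j powr (- \<kappa>))"
      by (rule sum.reindex_bij_witness[of _ "\<lambda>j. l - j" "\<lambda>j. l - j"]) auto
    also have "?h powr (- \<kappa>) * (\<Sum>j=1..<l. real j powr (- \<theta>)) + ?h powr (- \<theta>) * (\<Sum>j=1..<l. real j powr (- \<kappa>))
        \<le> ?h powr (- \<kappa>) * (real l powr (1 - \<theta>) / (1 - \<theta>)) + ?h powr (- \<theta>) * (real l powr (1 - \<kappa>) / (1 - \<kappa>))"
      using assms by (intro add_mono mult_left_mono order_trans[OF sum_mono2 sum_powr_le]) auto
    also have "\<dots> = C * real l powr (1 - \<theta> - \<kappa>)"
    proof -
      have "?h powr (- \<kappa>) * real l powr (1 - \<theta>) = 2 powr \<kappa> * (real l powr (- \<kappa>) * real l powr (1 - \<theta>))"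
        using l by (simp add: powr_divide powr_minus divide_simps)
      moreover have "?h powr (- \<theta>) * real l powr (1 - \<kappa>) = 2 powr \<theta> * (real l powr (- \<theta>) * real l powr (1 - \<kappa>))"
        using l by (simp add: powr_divide powr_minus divide_simps)
      ultimately show ?thesis
        by (simp add: C_def powr_add[symmetric] distrib_right)
          (simp add: algebra_simps)
    qed
    finally show ?thesis .
  qed
  then show ?thesis using C by blast
qed

section \<open>Fractional moments and their recursion\<close>

context pinning
begin

definition A :: "real \<Rightarrow> real \<Rightarrow> real \<Rightarrow> nat \<Rightarrow> ennreal" where
  "A \<beta> h \<theta> n = (\<integral>\<^sup>+x. ennreal (Z (wt \<beta> h (env x)) n powr \<theta>) \<partial>M)"

text \<open>The change of measure in the form of Young's inequality:
  \<open>Z\<^sup>\<theta> = m\<^sup>\<theta> (G Z / m)\<^sup>\<theta> (G\<^sup>-\<^sup>s)\<^sup>1\<^sup>-\<^sup>\<theta>\<close> with \<open>s = \<theta> / (1 - \<theta>)\<close>.\<close>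

lemma A_le_tilted:
  fixes G :: "'a \<Rightarrow> real"
  assumes \<theta>: "0 < \<theta>" "\<theta> < 1" and m: "0 < m" and B: "0 \<le> B" and \<beta>: "0 \<le> \<beta>" "\<beta> \<le> 1"
    and G: "\<And>x. 0 < G x" and Gm [measurable]: "G \<in> borel_measurable M"
    and 1: "(\<integral>\<^sup>+x. ennreal (G x * Z (wt \<beta> h (env x)) n) \<partial>M) \<le> ennreal m"
    and 2: "(\<integral>\<^sup>+x. ennreal (G x powr (- (\<theta> / (1 - \<theta>)))) \<partial>M) \<le> ennreal B"
  shows "A \<beta> h \<theta> n \<le> ennreal (m powr \<theta> * (1 + B))"
proof -
  let ?Z = "\<lambda>x. Z (wt \<beta> h (env x)) n" and ?s = "\<theta> / (1 - \<theta>)"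
  have le: "?Z x powr \<theta> \<le> m powr \<theta> / m * (G x * ?Z x) + m powr \<theta> * (G x powr (- ?s))" for x
  proof (cases "?Z x = 0")
    case False
    then have Z: "0 < ?Z x" using Z_wt_nonneg[OF \<beta>, of h x n] by simp
    have "- ?s * (1 - \<theta>) = - \<theta>" using \<theta> by simp
    then have e: "(G x powr (- ?s)) powr (1 - \<theta>) = G x powr (- \<theta>)" by (simp only: powr_powr)
    have "?Z x powr \<theta> = m powr \<theta> * ((G x * ?Z x / m) powr \<theta> * (G x powr (- ?s)) powr (1 - \<theta>))"
      unfolding e using Z G[of x] m \<theta> by (simp add: powr_mult powr_divide powr_minus field_simps)
    also have "\<dots> \<le> m powr \<theta> * (\<theta> * (G x * ?Z x / m) + (1 - \<theta>) * (G x powr (- ?s)))"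
      using Z G[of x] m \<theta> by (intro mult_left_mono Youngs_inequality_0) auto
    also have "\<dots> \<le> m powr \<theta> * (1 * (G x * ?Z x / m) + 1 * (G x powr (- ?s)))"
      using Z G[of x] m \<theta> by (intro mult_left_mono add_mono mult_right_mono) auto
    finally show ?thesis by (simp add: algebra_simps)
  qed (use m in simp)
  have "A \<beta> h \<theta> n \<le> (\<integral>\<^sup>+x. ennreal (m powr \<theta> / m) * ennreal (G x * ?Z x)
      + ennreal (m powr \<theta>) * ennreal (G x powr (- ?s)) \<partial>M)"
    unfolding A_def
  proof (rule nn_integral_mono)
    fix x
    have "ennreal (?Z x powr \<theta>) \<le> ennreal (m powr \<theta> / m * (G x * ?Z x) + m powr \<theta> * (G x powr (- ?s)))"
      by (rule ennreal_leI[OF le])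
    also have "\<dots> = ennreal (m powr \<theta> / m) * ennreal (G x * ?Z x) + ennreal (m powr \<theta>) * ennreal (G x powr (- ?s))"
    proof -
      have p: "0 \<le> m powr \<theta> / m" "0 \<le> m powr \<theta>" "0 \<le> G x * ?Z x"
        using m G[of x] Z_wt_nonneg[OF \<beta>, of h x n] by auto
      show ?thesis
        by (simp only: ennreal_plus[OF mult_nonneg_nonneg[OF p(1,3)] mult_nonneg_nonneg[OF p(2) powr_ge_zero]]
            ennreal_mult[OF p(1,3)] ennreal_mult[OF p(2) powr_ge_zero])
    qed
    finally show "ennreal (?Z x powr \<theta>) \<le> \<dots>" .
  qed
  also have "\<dots> = ennreal (m powr \<theta> / m) * (\<integral>\<^sup>+x. ennreal (G x * ?Z x) \<partial>M)
      + ennreal (m powr \<theta>) * (\<integral>\<^sup>+x. ennreal (G x powr (- ?s)) \<partial>M)"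
    by (subst nn_integral_add) (simp_all add: nn_integral_cmult)
  also have "\<dots> \<le> ennreal (m powr \<theta> / m) * ennreal m + ennreal (m powr \<theta>) * ennreal B"
    by (intro add_mono mult_left_mono 1 2) auto
  also have "\<dots> = ennreal (m powr \<theta> * (1 + B))"
    using m B by (simp add: ennreal_mult[symmetric] ennreal_plus[symmetric] algebra_simps del: ennreal_plus)
  finally show ?thesis .
qed

text \<open>More than L contacts are suppressed by the factor r^k <= exp(-\<eta> L), at most L
  contacts by the assumed bound on \<open>kap\<close>; the value u j <= 1 takes care of the
  rest.\<close>

lemma tilted_kap_sum_le:
  assumes C: "\<And>L n. 1 \<le> n \<Longrightarrow> (\<Sum>k\<le>L. kap k n) \<le> C * real L / real n"
    and \<eta>: "0 \<le> \<eta>" and r: "0 \<le> r" "r \<le> exp (- \<eta>)" and j: "1 \<le> j"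
  shows "(\<Sum>k\<le>j. r ^ k * kap k j) \<le> C * real L / real j + exp (- \<eta> * real L)"
proof -
  have r1: "r \<le> 1" using \<eta> by (intro order_trans[OF r(2)]) simp
  have "(\<Sum>k\<le>j. r ^ k * kap k j) \<le> (\<Sum>k\<le>j. (if k \<in> {..L} then kap k j else 0) + exp (- \<eta> * real L) * kap k j)"
  proof (rule sum_mono)
    fix k
    show "r ^ k * kap k j \<le> (if k \<in> {..L} then kap k j else 0) + exp (- \<eta> * real L) * kap k j"
    proof (cases "k \<le> L")
      case True
      have "r ^ k * kap k j \<le> 1 * kap k j"
        using r r1 by (intro mult_right_mono power_le_one kap_nonneg) auto
      then show ?thesis using True by (simp add: add_increasing2 kap_nonneg)
    next
      case False
      have "r ^ k \<le> r ^ L" using False r r1 by (intro power_decreasing) auto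
      also have "\<dots> \<le> exp (- \<eta>) ^ L" using r by (intro power_mono) auto
      also have "\<dots> = exp (- \<eta> * real L)" by (simp add: exp_of_nat_mult[symmetric] mult.commute)
      finally show ?thesis using False by (simp add: mult_right_mono kap_nonneg)
    qed
  qed
  also have "\<dots> = (\<Sum>k\<in>{..j} \<inter> {..L}. kap k j) + exp (- \<eta> * real L) * u j"
    by (simp only: sum.distrib sum.inter_restrict[OF finite_atMost] sum_distrib_left Z_def)
  also have "\<dots> \<le> (\<Sum>k\<le>L. kap k j) + exp (- \<eta> * real L) * 1"
    by (intro add_mono sum_mono2 mult_left_mono u_le_1 kap_nonneg) auto
  finally show ?thesis using C[OF j, of L] by simp
qed

text \<open>Damping above l^(1/\<gamma>) lowers the log-weight of a contact by order \<beta>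
  l^(1/\<gamma> - 1), which is at least l^(\<epsilon> - a) by hypothesis, while h is kept to a
  smaller multiple of that. More than l^(a - \<epsilon>/2) contacts then cost exp(-c
  l^(\<epsilon>/2)), and fewer have probability O(l^(a - \<epsilon>/2) / j).\<close>

lemma fractional_moment_bound:
  assumes \<epsilon>: "0 < \<epsilon>" "\<epsilon> < a" and \<theta>: "0 < \<theta>" "\<theta> < 1"
  shows "\<exists>c>0. c \<le> 1 \<and> (\<exists>C>0. \<exists>l0\<ge>1. \<forall>\<beta> l h j. 0 < \<beta> \<longrightarrow> \<beta> < 1 \<longrightarrow> l0 \<le> l \<longrightarrow>
    real l powr (\<epsilon> - a) \<le> \<beta> * real l powr (1 / \<gamma> - 1) \<longrightarrow> h \<le> c * real l powr (\<epsilon> - a) \<longrightarrow>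
    1 \<le> j \<longrightarrow> j \<le> l \<longrightarrow> A \<beta> h \<theta> j \<le> ennreal (C * (real l powr (a - \<epsilon> / 2) / real j) powr \<theta>))"
proof -
  obtain c1 C1 t0 where tl: "c1 > 0" "C1 > 0" "t0 \<ge> 1" "\<And>t. t \<ge> t0 \<Longrightarrow> c1 * t powr (- \<gamma>) \<le> tl t"
    "\<And>t. t > 0 \<Longrightarrow> tl t \<le> C1 * t powr (- \<gamma>)"
    using tl_bounds by blast
  obtain C2 where C2: "C2 > 0" "\<And>L n. 1 \<le> n \<Longrightarrow> (\<Sum>k\<le>L. kap k n) \<le> C2 * real L / real n"
    using few_contacts by blast
  define s where "s = \<theta> / (1 - \<theta>)"
  have s: "0 < s" unfolding s_def using \<theta> by simp
  define B where "B = exp (2 powr s * C1)"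
  define C where "C = (2 * C2 + 1) powr \<theta> * (1 + B)"
  define c where "c = min (c1 / 4) 1"
  have ev: "eventually (\<lambda>l::nat. exp (- (c1 / 4) * real l powr (\<epsilon> / 2)) \<le> real l powr (a - \<epsilon> / 2 - 1)) sequentially"
    using tl(1) \<epsilon> by real_asymp
  have ev2: "eventually (\<lambda>l::nat. t0 \<le> real l powr (1 / \<gamma>)) sequentially"
    using \<gamma>_range by real_asymp
  obtain l0 where l0: "\<And>l. l \<ge> l0 \<Longrightarrow> exp (- (c1 / 4) * real l powr (\<epsilon> / 2)) \<le> real l powr (a - \<epsilon> / 2 - 1)"
    "\<And>l. l \<ge> l0 \<Longrightarrow> t0 \<le> real l powr (1 / \<gamma>)"
    using eventually_conj[OF ev ev2] unfolding eventually_at_top_linorder by blast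
  have main: "A \<beta> h \<theta> j \<le> ennreal (C * (real l powr (a - \<epsilon> / 2) / real j) powr \<theta>)"
    if \<beta>: "0 < \<beta>" "\<beta> < 1" and l: "max 1 l0 \<le> l"
      and rel: "real l powr (\<epsilon> - a) \<le> \<beta> * real l powr (1 / \<gamma> - 1)"
      and h: "h \<le> c * real l powr (\<epsilon> - a)" and j: "1 \<le> j" "j \<le> l" for \<beta> l h j
  proof -
    \<comment> \<open>At this threshold the expected number of damped sites in a block of length
      \<open>l\<close> stays bounded, so the price \<open>B\<close> does not depend on
      \<open>l\<close>.\<close>
    define t where "t = real l powr (1 / \<gamma>)"
    have lpos: "0 < real l" "1 \<le> l" "l0 \<le> l" using l by auto
    have t: "0 < t" "t0 \<le> t" using l0(2)[of l] lpos by (auto simp: t_def)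
    have t\<gamma>: "t powr (- \<gamma>) = 1 / real l"
      using \<gamma>_range lpos by (simp add: t_def powr_powr powr_minus_divide)
    \<comment> \<open>The guaranteed effect of damping is 2 \<eta>; one half compensates h, the
      other half is the net loss per contact.\<close>
    define \<eta> where "\<eta> = c1 / 4 * real l powr (\<epsilon> - a)"
    have \<eta>: "0 \<le> \<eta>" using tl(1) by (simp add: \<eta>_def)
    have "2 * \<eta> \<le> c1 / 2 * (\<beta> * real l powr (1 / \<gamma> - 1))"
      using mult_left_mono[OF rel, of "c1 / 2"] tl(1) by (simp add: \<eta>_def)
    also have "real l powr (1 / \<gamma> - 1) = t / real l"
      using lpos by (simp add: t_def powr_diff)
    also have "c1 / 2 * (\<beta> * (t / real l)) = \<beta> * t / 2 * (c1 * t powr (- \<gamma>))"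
      by (simp add: t\<gamma>)
    also have "\<dots> \<le> \<beta> * t / 2 * tl t"
      using tl(4)[OF t(2)] \<beta> t by (intro mult_left_mono) auto
    finally have 2: "2 * \<eta> \<le> \<beta> * t * tl t / 2" by simp
    have "h \<le> c1 / 4 * real l powr (\<epsilon> - a)"
      using h by (rule order_trans) (intro mult_right_mono, auto simp: c_def)
    then have h\<eta>: "h - \<beta> * t * tl t / 2 \<le> - \<eta>" using 2 by (simp add: \<eta>_def)
    define r where "r = exp (h - \<beta> * t * tl t / 2)"
    have r: "0 \<le> r" "r \<le> exp (- \<eta>)" using h\<eta> by (auto simp: r_def)
    \<comment> \<open>Half of \<epsilon> makes \<eta> L grow like l^(\<epsilon>/2), so that its
      exponential beats every power of l; the other half is the gain over l^a.\<close>
    define L where "L = nat \<lceil>real l powr (a - \<epsilon> / 2)\<rceil>"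
    have p1: "1 \<le> real l powr (a - \<epsilon> / 2)" using lpos \<epsilon> by (intro ge_one_powr_ge_zero) auto
    have L: "real l powr (a - \<epsilon> / 2) \<le> real L" "real L \<le> 2 * real l powr (a - \<epsilon> / 2)"
      unfolding L_def using p1 by linarith+
    define m where "m = (2 * C2 + 1) * (real l powr (a - \<epsilon> / 2) / real j)"
    have m: "0 < m" unfolding m_def using C2(1) lpos j by (intro mult_pos_pos divide_pos_pos) auto
    have sum_le: "(\<Sum>k\<le>j. r ^ k * kap k j) \<le> m"
    proof -
      have "(\<Sum>k\<le>j. r ^ k * kap k j) \<le> C2 * real L / real j + exp (- \<eta> * real L)"
        by (rule tilted_kap_sum_le[OF C2(2) \<eta> r j(1)])
      also have "C2 * real L / real j \<le> C2 * (2 * real l powr (a - \<epsilon> / 2)) / real j"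
        using L C2(1) by (intro divide_right_mono mult_left_mono) auto
      also have "exp (- \<eta> * real L) \<le> exp (- \<eta> * real l powr (a - \<epsilon> / 2))"
        using L \<eta> by (simp add: mult_left_mono)
      also have "- \<eta> * real l powr (a - \<epsilon> / 2) = - (c1 / 4) * (real l powr (\<epsilon> - a) * real l powr (a - \<epsilon> / 2))"
        by (simp add: \<eta>_def)
      also have "real l powr (\<epsilon> - a) * real l powr (a - \<epsilon> / 2) = real l powr (\<epsilon> / 2)"
        by (simp add: powr_add[symmetric])
      also have "exp (- (c1 / 4) * real l powr (\<epsilon> / 2)) \<le> real l powr (a - \<epsilon> / 2 - 1)"
        by (rule l0(1)[OF lpos(3)])
      also have "\<dots> = real l powr (a - \<epsilon> / 2) / real l" using lpos by (simp add: powr_diff)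
      also have "\<dots> \<le> real l powr (a - \<epsilon> / 2) / real j" using j by (intro divide_left_mono) auto
      finally show ?thesis by (simp add: m_def algebra_simps add_divide_distrib)
    qed
    let ?G = "\<lambda>x. \<Prod>i=1..j. damp t (env x i)"
    have mG: "?G \<in> borel_measurable M"
      by (rule measurable_compose[OF measurable_env measurable_prod_coordinates]) simp
    have "A \<beta> h \<theta> j \<le> ennreal (m powr \<theta> * (1 + B))"
    proof (rule A_le_tilted[where G = ?G])
      show "0 < ?G x" for x by (intro prod_pos) (auto simp: damp_def)
      have "(\<integral>\<^sup>+x. ennreal (?G x * Z (wt \<beta> h (env x)) j) \<partial>M) \<le> ennreal (\<Sum>k\<le>j. r ^ k * kap k j)"
        using \<beta> r t damp_step[of \<beta> t h]
        by (intro tilted_Z_le) (auto simp: damp_def r_def)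
      also have "\<dots> \<le> ennreal m" by (rule ennreal_leI[OF sum_le])
      finally show "(\<integral>\<^sup>+x. ennreal (?G x * Z (wt \<beta> h (env x)) j) \<partial>M) \<le> ennreal m" .
      have "(\<integral>\<^sup>+x. ennreal (?G x powr (- s)) \<partial>M) \<le> ennreal (exp (2 powr s * (real j * tl t)))"
        by (rule damp_moment[OF s])
      also have "real j * tl t \<le> real l * (C1 * t powr (- \<gamma>))"
        using tl(5)[OF t(1)] j by (intro mult_mono) (auto simp: tl_def)
      also have "real l * (C1 * t powr (- \<gamma>)) = C1" using lpos by (simp add: t\<gamma>)
      finally have "(\<integral>\<^sup>+x. ennreal (?G x powr (- s)) \<partial>M) \<le> ennreal (exp (2 powr s * C1))"
        by (simp add: ennreal_leI mult_left_mono)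
      then show "(\<integral>\<^sup>+x. ennreal (?G x powr (- (\<theta> / (1 - \<theta>)))) \<partial>M) \<le> ennreal B"
        by (simp only: s_def B_def)
    qed (use \<theta> m \<beta> mG in \<open>auto simp: B_def\<close>)
    also have "m powr \<theta> * (1 + B) = C * (real l powr (a - \<epsilon> / 2) / real j) powr \<theta>"
      unfolding m_def C_def powr_mult by simp
    finally show ?thesis .
  qed
  have "0 < c" "c \<le> 1" "0 < C" using tl(1) C2(1) by (auto simp: c_def C_def B_def intro!: mult_pos_pos add_pos_pos)
  then show ?thesis
    by (intro exI[of _ c] conjI exI[of _ C] exI[of _ "max 1 l0"] allI impI) (use main in auto)
qed

text \<open>Bounding x^\<theta> by 1 + x reduces the claim to the mean 1 + e^h; the constant 4 is 1
  + 3 with e \<le> 3.\<close>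

lemma weight_moment:
  assumes \<beta>: "0 \<le> \<beta>" "\<beta> \<le> 1" and h: "h \<le> 1" and \<theta>: "0 < \<theta>" "\<theta> < 1"
  shows "(\<integral>\<^sup>+x. ennreal (wt \<beta> h (env x) b powr \<theta>) \<partial>M) \<le> 4"
proof -
  have le: "wt \<beta> h (env x) b powr \<theta> \<le> 1 + wt \<beta> h (env x) b" for x
  proof (cases "wt \<beta> h (env x) b \<le> 1")
    case True
    then have "wt \<beta> h (env x) b powr \<theta> \<le> 1 powr \<theta>"
      using wt_nonneg[OF \<beta>] \<theta> by (intro powr_mono2) auto
    then show ?thesis using wt_nonneg[OF \<beta>, of h x b] by simp
  next
    case False
    then have "wt \<beta> h (env x) b powr \<theta> \<le> wt \<beta> h (env x) b powr 1"
      using \<theta> by (intro powr_mono) auto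
    then show ?thesis using False by simp
  qed
  have int: "integrable M (\<lambda>x. 1 + wt \<beta> h (env x) b)"
    unfolding wt_def env_def using integrable_\<omega>[of b] by simp
  have val: "(\<integral>x. 1 + wt \<beta> h (env x) b \<partial>M) = 1 + exp h"
    unfolding wt_def env_def using integrable_\<omega>[of b] mean_\<omega>[of b] by (simp add: prob_space)
  have "(\<integral>\<^sup>+x. ennreal (wt \<beta> h (env x) b powr \<theta>) \<partial>M) \<le> (\<integral>\<^sup>+x. ennreal (1 + wt \<beta> h (env x) b) \<partial>M)"
    by (intro nn_integral_mono ennreal_leI le)
  also have "\<dots> = ennreal (1 + exp h)"
    using wt_nonneg[OF \<beta>, of h _ b] by (subst nn_integral_eq_integral[OF int]) (auto simp: val)
  also have "\<dots> \<le> ennreal 4"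
    using exp_le h exp_le_cancel_iff[of h 1] by (intro ennreal_leI) linarith
  finally show ?thesis by simp
qed

text \<open>The factors of each term of \<open>Z_split\<close> use the disorder on 1..i, at
  \<open>b\<close> and after \<open>b\<close>, hence are independent. Subadditivity of x^\<theta>
  takes the power inside the sum, stationarity identifies the last factor, and 4 is the bound of
  \<open>weight_moment\<close>.\<close>

lemma A_recursion:
  assumes \<beta>: "0 \<le> \<beta>" "\<beta> \<le> 1" and h: "h \<le> 1" and \<theta>: "0 < \<theta>" "\<theta> < 1" and mN: "m < N"
  shows "A \<beta> h \<theta> N \<le> (\<Sum>i\<le>m. \<Sum>b\<in>{m<..N}. A \<beta> h \<theta> i * (ennreal (K (b - i) powr \<theta>) * (4 * A \<beta> h \<theta> (N - b))))"
proof -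
  let ?R = "\<lambda>b y. Z (wt \<beta> h (\<lambda>j. y (b + j))) (N - b)"
  let ?F = "\<lambda>i y. ennreal (Z (wt \<beta> h y) i powr \<theta>)"
  let ?G = "\<lambda>b y. ennreal (wt \<beta> h y b powr \<theta>) * ennreal (?R b y powr \<theta>)"
  have mR: "(\<lambda>y. ?R b y) \<in> borel_measurable seq_space" for b
    unfolding wt_def
    by (intro measurable_Z borel_measurable_times borel_measurable_add borel_measurable_const measurable_coordinate)
  have mF: "?F i \<in> borel_measurable seq_space" for i by measurable
  have mw: "(\<lambda>y. ennreal (wt \<beta> h y b powr \<theta>)) \<in> borel_measurable seq_space" for b by measurable
  have mR': "(\<lambda>y. ennreal (?R b y powr \<theta>)) \<in> borel_measurable seq_space" for b
    using mR[of b] by measurable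
  have mG: "?G b \<in> borel_measurable seq_space" for b
    by (intro borel_measurable_times_ennreal mw mR')
  have Rnn: "0 \<le> ?R b (env x)" for b x
    using wt_nonneg[OF \<beta>, of h x] by (intro Z_nonneg) (simp add: wt_shift[symmetric])
  have le: "ennreal (Z (wt \<beta> h (env x)) N powr \<theta>)
      \<le> (\<Sum>i\<le>m. \<Sum>b\<in>{m<..N}. ennreal (K (b - i) powr \<theta>) * (?F i (env x) * ?G b (env x)))" for x
  proof -
    let ?t = "\<lambda>(i, b). Z (wt \<beta> h (env x)) i * K (b - i) * (wt \<beta> h (env x) b * ?R b (env x))"
    have "Z (wt \<beta> h (env x)) N = (\<Sum>p\<in>{..m} \<times> {m<..N}. ?t p)"
      by (subst Z_split[OF mN]) (simp add: sum.cartesian_product wt_shift)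
    then have "Z (wt \<beta> h (env x)) N powr \<theta> \<le> (\<Sum>p\<in>{..m} \<times> {m<..N}. ?t p powr \<theta>)"
      using \<theta> by (auto intro!: powr_sum_le mult_nonneg_nonneg Z_wt_nonneg wt_nonneg K_nonneg Rnn \<beta>)
    also have "\<dots> = (\<Sum>i\<le>m. \<Sum>b\<in>{m<..N}. K (b - i) powr \<theta> * (Z (wt \<beta> h (env x)) i powr \<theta> * (wt \<beta> h (env x) b powr \<theta> * ?R b (env x) powr \<theta>)))"
      unfolding sum.cartesian_product by (intro sum.cong refl) (simp add: split_def powr_mult mult_ac)
    finally have "ennreal (Z (wt \<beta> h (env x)) N powr \<theta>) \<le> ennreal \<dots>"
      by (rule ennreal_leI)
    also have "\<dots> = (\<Sum>i\<le>m. \<Sum>b\<in>{m<..N}. ennreal (K (b - i) powr \<theta> * (Z (wt \<beta> h (env x)) i powr \<theta> * (wt \<beta> h (env x) b powr \<theta> * ?R b (env x) powr \<theta>))))"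
      by (subst sum_ennreal[symmetric], intro sum_nonneg mult_nonneg_nonneg powr_ge_zero)
        (intro sum.cong refl sum_ennreal[symmetric] mult_nonneg_nonneg powr_ge_zero)
    also have "\<dots> = (\<Sum>i\<le>m. \<Sum>b\<in>{m<..N}. ennreal (K (b - i) powr \<theta>) * (?F i (env x) * ?G b (env x)))"
      by (intro sum.cong refl) (simp add: ennreal_mult)
    finally show ?thesis .
  qed
  have int: "(\<integral>\<^sup>+x. ?F i (env x) * ?G b (env x) \<partial>M) \<le> A \<beta> h \<theta> i * (4 * A \<beta> h \<theta> (N - b))"
    if "i \<le> m" "b \<in> {m<..N}" for i b
  proof -
    have "(\<integral>\<^sup>+x. ?F i (env x) * ?G b (env x) \<partial>M) = (\<integral>\<^sup>+x. ?F i (env x) \<partial>M) * (\<integral>\<^sup>+x. ?G b (env x) \<partial>M)"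
    proof (rule nn_indep[where A = "{1..i}" and B = "{b..}", OF mF _ mG])
      show "depends_on {1..i} (?F i)"
        by (rule depends_onI, rule arg_cong[where f = "\<lambda>z. ennreal (z powr \<theta>)"], rule depends_onD[OF depends_Z])
      show "depends_on {b..} (?G b)"
      proof (rule depends_onI)
        fix y y' :: "nat \<Rightarrow> real" assume *: "\<And>j. j \<in> {b..} \<Longrightarrow> y j = y' j"
        have "?R b y = ?R b y'" by (rule Z_cong) (simp add: wt_def *)
        moreover have "wt \<beta> h y b = wt \<beta> h y' b" by (simp add: wt_def *)
        ultimately show "?G b y = ?G b y'" by simp
      qed
    qed (use that in auto)
    also have "(\<integral>\<^sup>+x. ?G b (env x) \<partial>M)
        = (\<integral>\<^sup>+x. ennreal (wt \<beta> h (env x) b powr \<theta>) \<partial>M) * (\<integral>\<^sup>+x. ennreal (?R b (env x) powr \<theta>) \<partial>M)"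
    proof (rule nn_indep[where A = "{b}" and B = "{b<..}", OF mw _ mR'])
      show "depends_on {b} (\<lambda>y. ennreal (wt \<beta> h y b powr \<theta>))"
        by (rule depends_onI) (simp add: wt_def)
      show "depends_on {b<..} (\<lambda>y. ennreal (?R b y powr \<theta>))"
      proof (rule depends_onI)
        fix y y' :: "nat \<Rightarrow> real" assume *: "\<And>j. j \<in> {b<..} \<Longrightarrow> y j = y' j"
        have "?R b y = ?R b y'" by (rule Z_cong) (simp add: wt_def *)
        then show "ennreal (?R b y powr \<theta>) = ennreal (?R b y' powr \<theta>)" by simp
      qed
    qed auto
    also have "(\<integral>\<^sup>+x. ennreal (?R b (env x) powr \<theta>) \<partial>M) = A \<beta> h \<theta> (N - b)"
      unfolding A_def by (rule nn_shift[of "\<lambda>y. ennreal (Z (wt \<beta> h y) (N - b) powr \<theta>)"]) measurable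
    finally show ?thesis
      unfolding A_def[of _ _ _ i] using weight_moment[OF \<beta> h \<theta>, of b]
      by (simp add: mult_left_mono mult_right_mono)
  qed
  have "A \<beta> h \<theta> N \<le> (\<integral>\<^sup>+x. (\<Sum>i\<le>m. \<Sum>b\<in>{m<..N}. ennreal (K (b - i) powr \<theta>) * (?F i (env x) * ?G b (env x))) \<partial>M)"
    unfolding A_def by (intro nn_integral_mono le)
  also have "\<dots> = (\<Sum>i\<le>m. \<Sum>b\<in>{m<..N}. ennreal (K (b - i) powr \<theta>) * (\<integral>\<^sup>+x. ?F i (env x) * ?G b (env x) \<partial>M))"
  proof -
    have mFG: "(\<lambda>x. ?F i (env x) * ?G b (env x)) \<in> borel_measurable M" for i b
      by (rule measurable_compose[OF measurable_env]) (intro borel_measurable_times_ennreal mF mG)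
    have mFG': "(\<lambda>x. ennreal (K (b - i) powr \<theta>) * (?F i (env x) * ?G b (env x))) \<in> borel_measurable M" for i b
      by (rule borel_measurable_times_ennreal[OF borel_measurable_const mFG])
    show ?thesis
      by (subst nn_integral_sum, rule borel_measurable_sum, rule mFG', intro sum.cong refl,
        subst nn_integral_sum, rule mFG', intro sum.cong refl nn_integral_cmult mFG)
  qed
  also have "\<dots> \<le> (\<Sum>i\<le>m. \<Sum>b\<in>{m<..N}. ennreal (K (b - i) powr \<theta>) * (A \<beta> h \<theta> i * (4 * A \<beta> h \<theta> (N - b))))"
    by (intro sum_mono mult_left_mono int) auto
  finally show ?thesis by (simp only: mult.left_commute)
qed

text \<open>Cutting at N - l makes the part after \<open>b\<close> shorter than \<open>l\<close>, so
  \<open>f\<close> covers it, while the part up to \<open>i\<close> is covered by induction with the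
  sum of \<open>f\<close>. Summing the gap kernel over \<open>i\<close> leaves (b - m)^(1 - q), and
  the smallness hypothesis reproduces the same bound.\<close>

lemma A_bounded:
  assumes \<beta>: "0 \<le> \<beta>" "\<beta> \<le> 1" and h: "h \<le> 1" and \<theta>: "0 < \<theta>" "\<theta> < 1" and q: "1 < q"
    and C: "0 \<le> C" "\<And>n. 1 \<le> n \<Longrightarrow> K n powr \<theta> \<le> C * real n powr (- q)"
    and l: "1 \<le> l" and f: "\<And>j. 0 \<le> f j" "\<And>j. j < l \<Longrightarrow> A \<beta> h \<theta> j \<le> ennreal (f j)"
    and \<rho>: "4 * C * (q / (q - 1)) * (\<Sum>j<l. f j * real (l - j) powr (1 - q)) \<le> 1"
  shows "A \<beta> h \<theta> N \<le> ennreal (\<Sum>j<l. f j)"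
proof (induction N rule: less_induct)
  case (less N)
  define B where "B = (\<Sum>j<l. f j)"
  have B: "0 \<le> B" unfolding B_def by (intro sum_nonneg f)
  show ?case
  proof (cases "N < l")
    case True
    have "f N \<le> (\<Sum>j<l. f j)" using True f by (intro member_le_sum) auto
    then show ?thesis using f(2)[OF True] by (meson ennreal_leI order_trans)
  next
    case False
    define m where "m = N - l"
    have m: "m < N" using False l by (auto simp: m_def)
    have "A \<beta> h \<theta> N \<le> (\<Sum>i\<le>m. \<Sum>b\<in>{m<..N}. A \<beta> h \<theta> i * (ennreal (K (b - i) powr \<theta>) * (4 * A \<beta> h \<theta> (N - b))))"
      by (rule A_recursion[OF \<beta> h \<theta> m])
    also have "\<dots> \<le> (\<Sum>i\<le>m. \<Sum>b\<in>{m<..N}. ennreal (B * (C * real (b - i) powr (- q) * (4 * f (N - b)))))"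
    proof (intro sum_mono)
      fix i b assume ib: "i \<in> {..m}" "b \<in> {m<..N}"
      have "A \<beta> h \<theta> i * (ennreal (K (b - i) powr \<theta>) * (4 * A \<beta> h \<theta> (N - b)))
          \<le> ennreal B * (ennreal (C * real (b - i) powr (- q)) * (ennreal 4 * ennreal (f (N - b))))"
        using ib m False less.IH[of i] C(2)[of "b - i"] f(2)[of "N - b"]
        by (intro mult_mono ennreal_leI) (auto simp: m_def B_def)
      also have "\<dots> = ennreal (B * (C * real (b - i) powr (- q) * (4 * f (N - b))))"
        using B C(1) f(1)[of "N - b"] by (simp only: ennreal_mult[symmetric] mult_nonneg_nonneg powr_ge_zero zero_le_numeral)
      finally show "A \<beta> h \<theta> i * (ennreal (K (b - i) powr \<theta>) * (4 * A \<beta> h \<theta> (N - b)))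
          \<le> ennreal (B * (C * real (b - i) powr (- q) * (4 * f (N - b))))" .
    qed
    also have "\<dots> = ennreal (\<Sum>i\<le>m. \<Sum>b\<in>{m<..N}. B * (C * real (b - i) powr (- q) * (4 * f (N - b))))"
      using B C(1) f(1)
      by (subst sum_ennreal[symmetric], intro sum_nonneg mult_nonneg_nonneg; simp)

    also have "(\<Sum>i\<le>m. \<Sum>b\<in>{m<..N}. B * (C * real (b - i) powr (- q) * (4 * f (N - b))))
        = B * (4 * C * (\<Sum>b\<in>{m<..N}. f (N - b) * (\<Sum>i\<le>m. real (b - i) powr (- q))))"
      by (subst sum.swap) (simp add: sum_distrib_left mult_ac)
    also have "(\<Sum>b\<in>{m<..N}. f (N - b) * (\<Sum>i\<le>m. real (b - i) powr (- q)))
        \<le> (\<Sum>b\<in>{m<..N}. f (N - b) * (q / (q - 1) * real (b - m) powr (1 - q)))"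
    proof (intro sum_mono mult_left_mono f)
      fix b assume b: "b \<in> {m<..N}"
      have "(\<Sum>i\<le>m. real (b - i) powr (- q)) = (\<Sum>n=b-m..b. real n powr (- q))"
        by (rule sum.reindex_bij_witness[of _ "\<lambda>n. b - n" "\<lambda>i. b - i"]) (use b in auto)
      also have "\<dots> \<le> q / (q - 1) * real (b - m) powr (1 - q)"
        using b by (intro sum_powr_tail_le[OF q]) auto
      finally show "(\<Sum>i\<le>m. real (b - i) powr (- q)) \<le> q / (q - 1) * real (b - m) powr (1 - q)" .
    qed
    also have "(\<Sum>b\<in>{m<..N}. f (N - b) * (q / (q - 1) * real (b - m) powr (1 - q)))
        = (\<Sum>j<l. f j * (q / (q - 1) * real (l - j) powr (1 - q)))"
    \<comment> \<open>Substituting j = N - b gives b - m = l - j, so the condition no longer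
      involves N.\<close>
    proof -
      have e: "b - m = l - (N - b)" if "b \<in> {m<..N}" for b
        using that False by (auto simp: m_def)
      have "(\<Sum>b\<in>{m<..N}. f (N - b) * (q / (q - 1) * real (b - m) powr (1 - q)))
          = (\<Sum>b\<in>{m<..N}. f (N - b) * (q / (q - 1) * real (l - (N - b)) powr (1 - q)))"
        by (intro sum.cong refl) (simp only: e)
      also have "\<dots> = (\<Sum>j<l. f j * (q / (q - 1) * real (l - j) powr (1 - q)))"
        by (rule sum.reindex_bij_witness[of _ "\<lambda>j. N - j" "\<lambda>b. N - b"])
          (use False in \<open>auto simp: m_def simp del: of_nat_diff\<close>)
      finally show ?thesis .
    qed
    also have "\<dots> = q / (q - 1) * (\<Sum>j<l. f j * real (l - j) powr (1 - q))"
      by (simp add: sum_distrib_left mult_ac)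
    also have "B * (4 * C * (q / (q - 1) * (\<Sum>j<l. f j * real (l - j) powr (1 - q)))) \<le> B * 1"
      using B \<rho> by (intro mult_left_mono) (simp_all add: mult_ac)
    finally show ?thesis using B C(1) by (simp add: B_def ennreal_leI mult_left_mono)
  qed
qed

section \<open>Almost sure consequences of bounded fractional moments\<close>

definition lnZ :: "real \<Rightarrow> real \<Rightarrow> nat \<Rightarrow> 'a \<Rightarrow> real" where
  "lnZ \<beta> h N x = ln (Z (wt \<beta> h (env x)) N)"

lemma Z_wt_lower:
  assumes \<beta>: "0 \<le> \<beta>" "\<beta> < 1" and N: "0 < N"
  shows "exp h * (1 - \<beta>) * K N \<le> Z (wt \<beta> h (env x)) N"
proof -
  have "exp h * (1 - \<beta>) * K N \<le> wt \<beta> h (env x) N * K N"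
    by (intro mult_right_mono wt_lower K_nonneg \<beta>)
  also have "\<dots> \<le> Z (wt \<beta> h (env x)) N"
    using \<beta> by (intro Z_ge_single N wt_nonneg) auto
  finally show ?thesis .
qed

text \<open>A single gap from 0 to N costs a power of N uniformly in the environment, since every
  weight is at least e^h (1 - \<beta>). So ln Z / N can never have a negative limit.\<close>

lemma lnZ_lower:
  "\<exists>n0\<ge>1. \<exists>c>0. \<forall>\<beta> h N x. 0 \<le> \<beta> \<longrightarrow> \<beta> < 1 \<longrightarrow> n0 \<le> N \<longrightarrow>
    0 < Z (wt \<beta> h (env x)) N \<and> h + ln (1 - \<beta>) + ln c - (1 + \<alpha>) * ln (real N) \<le> lnZ \<beta> h N x"
proof -
  obtain c n0 where c: "c > 0" "n0 \<ge> 1" "\<And>n. n \<ge> n0 \<Longrightarrow> c * real n powr (- (1 + \<alpha>)) \<le> K n"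
    using K_lower by blast
  have "0 < Z (wt \<beta> h (env x)) N \<and> h + ln (1 - \<beta>) + ln c - (1 + \<alpha>) * ln (real N) \<le> lnZ \<beta> h N x"
    if \<beta>: "0 \<le> \<beta>" "\<beta> < 1" and N: "n0 \<le> N" for \<beta> h N x
  proof -
    have N0: "0 < N" using N c(2) by simp
    have pos: "0 < exp h * (1 - \<beta>) * (c * real N powr (- (1 + \<alpha>)))"
      using \<beta> c(1) N0 by simp
    have le: "exp h * (1 - \<beta>) * (c * real N powr (- (1 + \<alpha>))) \<le> Z (wt \<beta> h (env x)) N"
      using \<beta> by (intro order_trans[OF mult_left_mono[OF c(3)[OF N]] Z_wt_lower[OF \<beta> N0]]) simp
    have "ln (exp h * (1 - \<beta>) * (c * real N powr (- (1 + \<alpha>)))) \<le> lnZ \<beta> h N x"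
      unfolding lnZ_def using pos le by (subst ln_le_cancel_iff) auto
    also have "ln (exp h * (1 - \<beta>) * (c * real N powr (- (1 + \<alpha>)))) = h + ln (1 - \<beta>) + ln c - (1 + \<alpha>) * ln (real N)"
      using \<beta> c(1) N0 by (simp add: ln_mult ln_powr) (simp add: left_diff_distrib distrib_right)
    finally show ?thesis using less_le_trans[OF pos le] by blast
  qed
  then show ?thesis using c(1,2) by blast
qed

text \<open>A Borel-Cantelli argument in summed form: the series of Z_N^\<theta> / N^2 has finite
  mean, so almost surely ln Z_N exceeds at most a multiple of ln N; the one-gap lower bound is
  logarithmic as well.\<close>

lemma delocalized_of_bounded:
  assumes \<beta>: "0 \<le> \<beta>" "\<beta> < 1" and \<theta>: "0 < \<theta>"
    and B: "\<And>N. A \<beta> h \<theta> N \<le> ennreal B"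
  shows "AE x in M. (\<lambda>N. 1 / real N * lnZ \<beta> h N x) \<longlonglongrightarrow> 0"
proof -
  obtain n0 c where lo: "n0 \<ge> 1" "c > 0" "\<And>h N x. n0 \<le> N \<Longrightarrow> 0 < Z (wt \<beta> h (env x)) N"
    "\<And>h N x. n0 \<le> N \<Longrightarrow> h + ln (1 - \<beta>) + ln c - (1 + \<alpha>) * ln (real N) \<le> lnZ \<beta> h N x"
    using lnZ_lower \<beta> by blast
  let ?Z = "\<lambda>N x. Z (wt \<beta> h (env x)) N"
  let ?f = "\<lambda>N x. ennreal (inverse (real N ^ 2)) * ennreal (?Z N x powr \<theta>)"
  have mZ: "(\<lambda>x. ennreal (?Z N x powr \<theta>)) \<in> borel_measurable M" for N
    using measurable_compose[OF measurable_env measurable_Z_wt] by measurable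
  have mf: "?f N \<in> borel_measurable M" for N
    by (rule borel_measurable_times_ennreal[OF borel_measurable_const mZ])
  have B0: "0 \<le> max B 0" by simp
  have sm: "summable (\<lambda>N. inverse (real N ^ 2) * max B 0)"
    using inverse_power_summable[of 2, where 'a = real] by (intro summable_mult2) simp
  have "(\<integral>\<^sup>+x. (\<Sum>N. ?f N x) \<partial>M) = (\<Sum>N. ennreal (inverse (real N ^ 2)) * A \<beta> h \<theta> N)"
    unfolding A_def by (subst nn_integral_suminf[OF mf]) (simp only: nn_integral_cmult[OF mZ])
  also have "\<dots> \<le> (\<Sum>N. ennreal (inverse (real N ^ 2) * max B 0))"
  proof (rule suminf_le)
    fix N
    have "A \<beta> h \<theta> N \<le> ennreal (max B 0)" by (rule order_trans[OF B ennreal_leI]) simp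
    then show "ennreal (inverse (real N ^ 2)) * A \<beta> h \<theta> N \<le> ennreal (inverse (real N ^ 2) * max B 0)"
      by (simp add: ennreal_mult mult_left_mono)
  qed auto
  also have "\<dots> = ennreal (\<Sum>N. inverse (real N ^ 2) * max B 0)"
    by (rule suminf_ennreal2[OF _ sm]) simp
  finally have "(\<integral>\<^sup>+x. (\<Sum>N. ?f N x) \<partial>M) \<noteq> \<infinity>"
    using neq_top_trans[OF ennreal_neq_top] by (simp add: infinity_ennreal_def)
  then have "AE x in M. (\<Sum>N. ?f N x) \<noteq> \<infinity>"
    by (intro nn_integral_noteq_infinite borel_measurable_suminf_order mf)
  then show ?thesis
  proof eventually_elim
    case (elim x)
    define S where "S = max 1 (enn2real (\<Sum>N. ?f N x))"
    have S: "1 \<le> S" by (simp add: S_def)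
    have up: "lnZ \<beta> h N x \<le> (ln S + 2 * ln (real N)) / \<theta>" if N: "n0 \<le> N" for N
    proof -
      have N0: "0 < N" using N lo(1) by simp
      have "?f N x \<le> (\<Sum>N. ?f N x)"
        using sum_le_suminf[of "\<lambda>N. ?f N x" "{N}"] by simp
      also have "\<dots> = ennreal (enn2real (\<Sum>N. ?f N x))"
        using elim by (simp add: less_top)
      also have "\<dots> \<le> ennreal S" by (rule ennreal_leI) (simp add: S_def)
      finally have "inverse (real N ^ 2) * ?Z N x powr \<theta> \<le> S"
        using S by (simp add: ennreal_mult[symmetric])
      then have "?Z N x powr \<theta> \<le> S * real N ^ 2"
        using N0 by (simp add: field_simps)
      then have "ln (?Z N x powr \<theta>) \<le> ln (S * real N ^ 2)"
        using lo(3)[OF N, of h x] S N0 by (subst ln_le_cancel_iff) auto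
      then have "\<theta> * lnZ \<beta> h N x \<le> ln S + 2 * ln (real N)"
        using S N0 lo(3)[OF N, of h x] by (simp add: lnZ_def ln_powr ln_mult ln_realpow)
      then show ?thesis using \<theta> by (simp add: field_simps)
    qed
    define C1 where "C1 = h + ln (1 - \<beta>) + ln c"
    show "(\<lambda>N. 1 / real N * lnZ \<beta> h N x) \<longlonglongrightarrow> 0"
    proof (rule tendsto_sandwich)
      show "\<forall>\<^sub>F N in sequentially. 1 / real N * (C1 - (1 + \<alpha>) * ln (real N)) \<le> 1 / real N * lnZ \<beta> h N x"
        using eventually_ge_at_top[of n0]
        by eventually_elim (use lo(4)[of _ h x] in \<open>auto simp: C1_def intro!: divide_right_mono\<close>)
      show "\<forall>\<^sub>F N in sequentially. 1 / real N * lnZ \<beta> h N x \<le> 1 / real N * ((ln S + 2 * ln (real N)) / \<theta>)"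
        using eventually_ge_at_top[of n0]
        by eventually_elim (intro mult_left_mono up, auto)
      show "(\<lambda>N. 1 / real N * (C1 - (1 + \<alpha>) * ln (real N))) \<longlonglongrightarrow> 0" by real_asymp
      show "(\<lambda>N. 1 / real N * ((ln S + 2 * ln (real N)) / \<theta>)) \<longlonglongrightarrow> 0" using \<theta> by real_asymp
    qed
  qed
qed

text \<open>Summed against the gap kernel to the power \<theta>, the block bound tends to 0 as a
  power of l. That is the smallness demanded by \<open>A_bounded\<close>, which extends the bound to
  all lengths.\<close>

lemma delocalized:
  assumes \<epsilon>: "0 < \<epsilon>" "\<epsilon> < a"
  shows "\<exists>c>0. \<exists>l0\<ge>1. \<forall>\<beta> l h. 0 < \<beta> \<longrightarrow> \<beta> < 1 \<longrightarrow> l0 \<le> l \<longrightarrow>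
    real l powr (\<epsilon> - a) \<le> \<beta> * real l powr (1 / \<gamma> - 1) \<longrightarrow> h \<le> c * real l powr (\<epsilon> - a) \<longrightarrow>
    (AE x in M. (\<lambda>N. 1 / real N * lnZ \<beta> h N x) \<longlonglongrightarrow> 0)"
proof -
  \<comment> \<open>The sum in \<open>A_bounded\<close> is of order l to the power (a -
    \<epsilon>/2) \<theta> + 2 - \<theta> - q = 2 - (2 + \<epsilon>/2) \<theta>, apart from its term
    j = 0. With \<theta> = 1 - \<epsilon>/8 this exponent is -(\<epsilon>/4 - \<epsilon>^2/16), the
    number -\<open>e2\<close> below.\<close>
  define \<theta> where "\<theta> = 1 - \<epsilon> / 8"
  define q where "q = (1 + a) * \<theta>"
  have \<epsilon>1: "\<epsilon> < 1" using \<epsilon> a_bounds by simp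
  have \<theta>: "0 < \<theta>" "\<theta> < 1" using \<epsilon> \<epsilon>1 by (auto simp: \<theta>_def)
  have "a * \<theta> > 7/8 * a" using mult_strict_left_mono[of "7/8" \<theta> a] \<epsilon>1 a_bounds by (simp add: \<theta>_def)
  then have q: "1 < q" using \<epsilon> a_bounds by (simp add: q_def \<theta>_def algebra_simps)
  have "q \<le> 2 * \<theta>" unfolding q_def using a_bounds \<theta> by (intro mult_right_mono) auto
  then have q2: "q < 2" using \<theta> by simp
  obtain c C l1 where c: "0 < c" "c \<le> 1" and C: "0 < C" and l1: "1 \<le> l1"
    and bnd: "\<And>\<beta> l h j. 0 < \<beta> \<Longrightarrow> \<beta> < 1 \<Longrightarrow> l1 \<le> l \<Longrightarrow>
      real l powr (\<epsilon> - a) \<le> \<beta> * real l powr (1 / \<gamma> - 1) \<Longrightarrow> h \<le> c * real l powr (\<epsilon> - a) \<Longrightarrow>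
      1 \<le> j \<Longrightarrow> j \<le> l \<Longrightarrow> A \<beta> h \<theta> j \<le> ennreal (C * (real l powr (a - \<epsilon> / 2) / real j) powr \<theta>)"
    using fractional_moment_bound[OF \<epsilon> \<theta>] by blast
  obtain CK where CK: "CK > 0" "\<And>n. 1 \<le> n \<Longrightarrow> K n \<le> CK * real n powr (- (1 + \<alpha>))"
    using K_upper by blast
  \<comment> \<open>For \<alpha> > 1 the decay is weakened to the exponent 1 + a, because the
    convolution estimate requires q - 1 < 1.\<close>
  have CK\<theta>: "K n powr \<theta> \<le> CK powr \<theta> * real n powr (- q)" if n: "1 \<le> n" for n
  proof -
    have "K n \<le> CK * real n powr (- (1 + \<alpha>))" by (rule CK(2)[OF n])
    also have "\<dots> \<le> CK * real n powr (- (1 + a))"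
      using CK(1) n a_bounds by (intro mult_left_mono powr_mono) auto
    finally have "K n powr \<theta> \<le> (CK * real n powr (- (1 + a))) powr \<theta>"
      using \<theta> K_nonneg by (intro powr_mono2) auto
    also have "\<dots> = CK powr \<theta> * real n powr (- (1 + a) * \<theta>)"
      unfolding powr_mult powr_powr ..
    finally show ?thesis by (simp add: q_def algebra_simps)
  qed
  have "0 \<le> q - 1" "q - 1 < 1" using q q2 by auto
  then obtain C3 where C3: "C3 > 0" "\<And>l. 1 \<le> l \<Longrightarrow>
      (\<Sum>j=1..<l. real j powr (- \<theta>) * real (l - j) powr (- (q - 1))) \<le> C3 * real l powr (1 - \<theta> - (q - 1))"
    using sum_powr_convolution_le[of \<theta> "q - 1"] \<theta> by auto
  define C4 where "C4 = 4 * CK powr \<theta> * (q / (q - 1))"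
  have C4: "0 < C4" using CK(1) q by (simp add: C4_def)
  define e1 where "e1 = q - 1"
  define e2 where "e2 = \<epsilon> / 4 - \<epsilon> ^ 2 / 16"
  have e1: "0 < e1" using q by (simp add: e1_def)
  have "\<epsilon> * \<epsilon> < \<epsilon> * 1" using \<epsilon> \<epsilon>1 by (intro mult_strict_left_mono) auto
  then have e2: "0 < e2" using \<epsilon> by (simp add: e2_def power2_eq_square)
  have e2_eq: "(a - \<epsilon> / 2) * \<theta> + (1 - \<theta> - (q - 1)) = - e2"
    by (simp add: e2_def q_def \<theta>_def power2_eq_square field_simps)
  have "(\<lambda>l::nat. C4 * (real l powr (- e1) + C * C3 * real l powr (- e2))) \<longlonglongrightarrow> 0"
  proof -
    have p: "(\<lambda>l::nat. real l powr (- e)) \<longlonglongrightarrow> 0" if "0 < e" for e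
      using that by (intro tendsto_neg_powr filterlim_real_sequentially) simp
    have "(\<lambda>l::nat. C4 * (real l powr (- e1) + C * C3 * real l powr (- e2))) \<longlonglongrightarrow> C4 * (0 + C * C3 * 0)"
      by (intro tendsto_intros p e1 e2)
    then show ?thesis by simp
  qed
  then have "eventually (\<lambda>l::nat. C4 * (real l powr (- e1) + C * C3 * real l powr (- e2)) < 1) sequentially"
    by (rule order_tendstoD) simp
  then obtain l2 where l2: "\<And>l. l2 \<le> l \<Longrightarrow> C4 * (real l powr (- e1) + C * C3 * real l powr (- e2)) < 1"
    by (auto simp: eventually_at_top_linorder)
  have main: "AE x in M. (\<lambda>N. 1 / real N * lnZ \<beta> h N x) \<longlonglongrightarrow> 0"
    if \<beta>: "0 < \<beta>" "\<beta> < 1" and l: "max l1 l2 \<le> l"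
      and rel: "real l powr (\<epsilon> - a) \<le> \<beta> * real l powr (1 / \<gamma> - 1)"
      and h: "h \<le> c * real l powr (\<epsilon> - a)" for \<beta> l h
  proof -
    have l': "l1 \<le> l" "l2 \<le> l" "1 \<le> l" using l l1 by auto
    \<comment> \<open>The value at 0 is exact, as \<open>Z\<close> is 1 there; it contributes the
      separate term l^(1 - q).\<close>
    define f where "f j = (if j = 0 then 1 else C * (real l powr (a - \<epsilon> / 2) / real j) powr \<theta>)" for j :: nat
    have fnn: "0 \<le> f j" for j using C by (simp add: f_def)
    have "real l powr (\<epsilon> - a) \<le> 1"
    proof -
      have "real l powr (\<epsilon> - a) \<le> real l powr 0" using \<epsilon> l'(3) by (intro powr_mono) auto
      then show ?thesis using l'(3) by simp
    qed
    then have "c * real l powr (\<epsilon> - a) \<le> 1 * 1" using c by (intro mult_mono) auto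
    then have h1: "h \<le> 1" using h by simp
    have Aj: "A \<beta> h \<theta> j \<le> ennreal (f j)" if "j < l" for j
    proof (cases "j = 0")
      case True
      then show ?thesis by (simp add: A_def f_def emeasure_space_1)
    next
      case False
      then show ?thesis using bnd[OF \<beta> l'(1) rel h, of j] that by (simp add: f_def)
    qed
    have "(\<Sum>j<l. f j * real (l - j) powr (1 - q)) = real l powr (1 - q) + (\<Sum>j=1..<l. f j * real (l - j) powr (1 - q))"
    proof -
      have s: "{..<l} = insert 0 {1..<l}" using l' by auto
      show ?thesis unfolding s by (subst sum.insert) (auto simp: f_def)
    qed
    also have "(\<Sum>j=1..<l. f j * real (l - j) powr (1 - q))
        = C * real l powr ((a - \<epsilon> / 2) * \<theta>) * (\<Sum>j=1..<l. real j powr (- \<theta>) * real (l - j) powr (- (q - 1)))"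
      unfolding sum_distrib_left
    proof (rule sum.cong[OF refl])
      fix j assume j: "j \<in> {1..<l}"
      have "f j = C * (real l powr ((a - \<epsilon> / 2) * \<theta>) * real j powr (- \<theta>))"
      proof -
        have "f j = C * ((real l powr (a - \<epsilon> / 2)) powr \<theta> / real j powr \<theta>)"
          using j by (simp add: f_def powr_divide)
        then show ?thesis by (simp only: powr_powr powr_minus divide_inverse)
      qed
      then show "f j * real (l - j) powr (1 - q)
          = C * real l powr ((a - \<epsilon> / 2) * \<theta>) * (real j powr (- \<theta>) * real (l - j) powr (- (q - 1)))"
        by simp
    qed
    also have "\<dots> \<le> C * real l powr ((a - \<epsilon> / 2) * \<theta>) * (C3 * real l powr (1 - \<theta> - (q - 1)))"
      using C by (intro mult_left_mono C3(2) l') auto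
    also have "\<dots> = C * C3 * real l powr (- e2)"
      unfolding e2_eq[symmetric] powr_add by simp
    finally have "(\<Sum>j<l. f j * real (l - j) powr (1 - q)) \<le> real l powr (- e1) + C * C3 * real l powr (- e2)"
      by (simp add: e1_def)
    then have "C4 * (\<Sum>j<l. f j * real (l - j) powr (1 - q)) \<le> C4 * (real l powr (- e1) + C * C3 * real l powr (- e2))"
      using C4 by (intro mult_left_mono) auto
    also have "\<dots> \<le> 1" using l2[OF l'(2)] by simp
    finally have \<rho>: "4 * CK powr \<theta> * (q / (q - 1)) * (\<Sum>j<l. f j * real (l - j) powr (1 - q)) \<le> 1"
      by (simp only: C4_def)
    have "A \<beta> h \<theta> N \<le> ennreal (\<Sum>j<l. f j)" for N
      using \<beta> by (intro A_bounded[OF _ _ h1 \<theta> q _ CK\<theta> l'(3) fnn Aj \<rho>]) auto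
    then show ?thesis using \<beta> by (intro delocalized_of_bounded[OF _ _ \<theta>(1)]) auto
  qed
  show ?thesis using c(1) l1
    by (intro exI[of _ c] conjI exI[of _ "max l1 l2"] allI impI) (use main in auto)
qed

end

subsection \<open>Existence of the free energy\<close>

lemma (in prob_space) integrable_of_square:
  fixes f :: "'a \<Rightarrow> real"
  assumes "f \<in> borel_measurable M" "integrable M (\<lambda>x. (f x)\<^sup>2)"
  shows "integrable M f"
  by (rule square_integrable_imp_integrable[OF assms])

text \<open>The variance is at most the mean square deviation from any constant, here
  \<open>c\<close>, and \<open>g\<close> controls that deviation.\<close>

lemma (in prob_space) second_moment_le:
  fixes f g :: "'a \<Rightarrow> real"
  assumes f [measurable]: "f \<in> borel_measurable M" and g: "integrable M (\<lambda>y. (g y - g y0)\<^sup>2)"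
    and le: "\<And>y. y \<in> space M \<Longrightarrow> \<bar>f y - c\<bar> \<le> \<bar>g y - g y0\<bar>"
  shows "integrable M (\<lambda>y. (f y)\<^sup>2)"
    and "(\<integral>y. (f y)\<^sup>2 \<partial>M) \<le> (\<integral>y. f y \<partial>M)\<^sup>2 + (\<integral>y. (g y - g y0)\<^sup>2 \<partial>M)"
proof -
  have sq: "(f y - c)\<^sup>2 \<le> (g y - g y0)\<^sup>2" if "y \<in> space M" for y
    using le[OF that] by (simp add: abs_le_square_iff)
  have int1: "integrable M (\<lambda>y. (f y - c)\<^sup>2)"
    by (rule Bochner_Integration.integrable_bound[OF g]) (auto simp: sq)
  have int2: "integrable M (\<lambda>y. f y - c)" by (rule integrable_of_square[OF _ int1]) measurable
  have eq: "(f y)\<^sup>2 = (f y - c)\<^sup>2 + (2 * c * (f y - c) + c\<^sup>2)" for y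
    by (simp add: power2_eq_square algebra_simps)
  show int: "integrable M (\<lambda>y. (f y)\<^sup>2)"
    unfolding eq
    by (intro Bochner_Integration.integrable_add integrable_mult_right int1 int2 integrable_const)
  have intf: "integrable M f" by (rule integrable_of_square[OF f int])
  have "(\<integral>y. (f y)\<^sup>2 \<partial>M) = (\<integral>y. (f y - c)\<^sup>2 \<partial>M) + (2 * c * ((\<integral>y. f y \<partial>M) - c) + c\<^sup>2)"
    unfolding eq using int1 int2 intf by (simp add: prob_space)
  also have "\<dots> \<le> (\<integral>y. (g y - g y0)\<^sup>2 \<partial>M) + (2 * c * ((\<integral>y. f y \<partial>M) - c) + c\<^sup>2)"
    by (intro add_right_mono integral_mono int1 g sq)
  also have "2 * c * ((\<integral>y. f y \<partial>M) - c) + c\<^sup>2 \<le> (\<integral>y. f y \<partial>M)\<^sup>2"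
    using zero_le_power2[of "(\<integral>y. f y \<partial>M) - c"] by (simp add: power2_eq_square algebra_simps)
  finally show "(\<integral>y. (f y)\<^sup>2 \<partial>M) \<le> (\<integral>y. f y \<partial>M)\<^sup>2 + (\<integral>y. (g y - g y0)\<^sup>2 \<partial>M)" by simp
qed

text \<open>Integrating out one coordinate preserves the Lipschitz condition in the others, so the
  variance picks up at most the one-coordinate contribution in each step.\<close>

lemma efron_stein:
  fixes D :: "real measure" and g :: "real \<Rightarrow> real" and I :: "'i set"
  assumes D: "prob_space D" and g: "integrable D (\<lambda>y. (g y - g y0)\<^sup>2)" and y0: "y0 \<in> space D"
    and I: "finite I" and f: "f \<in> borel_measurable (PiM I (\<lambda>_. D))"
    and lip: "\<And>x i y. x \<in> space (PiM I (\<lambda>_. D)) \<Longrightarrow> i \<in> I \<Longrightarrow> y \<in> space D \<Longrightarrow>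
      \<bar>f (x(i := y)) - f x\<bar> \<le> \<bar>g y - g (x i)\<bar>"
  shows "integrable (PiM I (\<lambda>_. D)) (\<lambda>x. (f x)\<^sup>2) \<and>
    (\<integral>x. (f x)\<^sup>2 \<partial>PiM I (\<lambda>_. D)) \<le> (\<integral>x. f x \<partial>PiM I (\<lambda>_. D))\<^sup>2 + real (card I) * (\<integral>y. (g y - g y0)\<^sup>2 \<partial>D)"
  using I f lip
proof (induction I arbitrary: f rule: finite_induct)
  case empty
  have "integrable (PiM {} (\<lambda>_. D)) h" for h :: "('i \<Rightarrow> real) \<Rightarrow> real"
    unfolding PiM_empty by (rule integrable_count_space) simp
  moreover have "(\<integral>x. h x \<partial>PiM {} (\<lambda>_. D)) = h (\<lambda>_. undefined)" for h :: "('i \<Rightarrow> real) \<Rightarrow> real"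
    unfolding PiM_empty by (subst lebesgue_integral_count_space_finite) auto
  ultimately show ?case by simp
next
  case (insert i I)
  interpret D: prob_space D by (rule D)
  interpret product_sigma_finite "\<lambda>_::'i. D" by unfold_locales
  let ?P = "PiM I (\<lambda>_. D)" and ?P' = "PiM (insert i I) (\<lambda>_. D)"
  interpret P: prob_space ?P by (intro prob_space_PiM D)
  interpret P': prob_space ?P' by (intro prob_space_PiM D)
  let ?V = "\<integral>y. (g y - g y0)\<^sup>2 \<partial>D"
  have sp: "x(i := y) \<in> space ?P'" if "x \<in> space ?P" "y \<in> space D" for x y
    using that by (auto simp: space_PiM PiE_def extensional_def)
  note f = insert.prems(1) and lip = insert.prems(2)
  have mpair: "(\<lambda>(x, y). f (x(i := y))) \<in> borel_measurable (?P \<Otimes>\<^sub>M D)"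
    using measurable_compose[OF measurable_add_dim f] by (simp add: split_def fun_upd_def)
  have msec: "(\<lambda>y. f (x(i := y))) \<in> borel_measurable D" if "x \<in> space ?P" for x
    using measurable_Pair2[OF mpair that] by simp
  have le1: "\<bar>f (x(i := y)) - f (x(i := y0))\<bar> \<le> \<bar>g y - g y0\<bar>" if "x \<in> space ?P" "y \<in> space D" for x y
    using lip[OF sp[OF that(1) y0] insertI1 that(2)] by (simp only: fun_upd_upd fun_upd_same)
  have lip2: "\<bar>f ((x(j := z))(i := y)) - f (x(i := y))\<bar> \<le> \<bar>g z - g (x j)\<bar>"
    if "x \<in> space ?P" "j \<in> I" "z \<in> space D" "y \<in> space D" for x j y z
  proof -
    have ji: "j \<noteq> i" using that insert.hyps by auto
    have e: "(x(j := z))(i := y) = (x(i := y))(j := z)" by (rule fun_upd_twist[OF ji])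
    have e': "(x(i := y)) j = x j" using ji by simp
    show ?thesis
      using lip[OF sp[OF that(1,4)] insertI2[OF that(2)] that(3)] unfolding e by (simp only: e')
  qed
  note sec = D.second_moment_le[OF msec g le1]
  have IH0: "integrable ?P (\<lambda>x. (f (x(i := y0)))\<^sup>2)"
  proof (rule insert.IH[THEN conjunct1])
    show "(\<lambda>x. f (x(i := y0))) \<in> borel_measurable ?P"
      using measurable_Pair1[OF mpair y0] by simp
    fix x j y assume x: "x \<in> space ?P" "j \<in> I" "y \<in> space D"
    then show "\<bar>f ((x(j := y))(i := y0)) - f (x(i := y0))\<bar> \<le> \<bar>g y - g (x j)\<bar>"
      by (intro lip2 y0)
  qed
  \<comment> \<open>Fubini for real integrals needs square integrability first. It follows by
    comparing each section with its value at \<open>y0\<close> through v^2 <= 2 w^2 + 2 (v -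
    w)^2.\<close>
  have intf2: "integrable ?P' (\<lambda>x. (f x)\<^sup>2)"
  proof (rule integrableI_bounded)
    have "(\<integral>\<^sup>+x. ennreal (norm ((f x)\<^sup>2)) \<partial>?P') = (\<integral>\<^sup>+x. (\<integral>\<^sup>+y. ennreal ((f (x(i := y)))\<^sup>2) \<partial>D) \<partial>?P)"
      using f insert.hyps by (subst product_nn_integral_insert) auto
    also have "\<dots> \<le> (\<integral>\<^sup>+x. (\<integral>\<^sup>+y. ennreal (2 * (f (x(i := y0)))\<^sup>2 + 2 * (g y - g y0)\<^sup>2) \<partial>D) \<partial>?P)"
    proof (intro nn_integral_mono ennreal_leI)
      fix x y assume xy: "x \<in> space ?P" "y \<in> space D"
      have "(f (x(i := y)) - f (x(i := y0)))\<^sup>2 \<le> (g y - g y0)\<^sup>2"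
        using le1[OF xy] by (simp add: abs_le_square_iff)
      moreover have "(f (x(i := y)))\<^sup>2 \<le> 2 * (f (x(i := y0)))\<^sup>2 + 2 * (f (x(i := y)) - f (x(i := y0)))\<^sup>2"
        using zero_le_power2[of "f (x(i := y)) - 2 * f (x(i := y0))"] by (simp add: power2_eq_square algebra_simps)
      ultimately show "(f (x(i := y)))\<^sup>2 \<le> 2 * (f (x(i := y0)))\<^sup>2 + 2 * (g y - g y0)\<^sup>2" by linarith
    qed
    also have "\<dots> = (\<integral>\<^sup>+x. ennreal (2 * (f (x(i := y0)))\<^sup>2 + 2 * ?V) \<partial>?P)"
      using g by (subst nn_integral_eq_integral) (auto simp: D.prob_space)
    also have "\<dots> = ennreal (\<integral>x. 2 * (f (x(i := y0)))\<^sup>2 + 2 * ?V \<partial>?P)"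
      using IH0 by (intro nn_integral_eq_integral) auto
    finally show "(\<integral>\<^sup>+x. ennreal (norm ((f x)\<^sup>2)) \<partial>?P') < \<infinity>" by (rule le_less_trans) simp
  qed (use f in measurable)
  have intf: "integrable ?P' f" by (rule P'.integrable_of_square[OF f intf2])
  define m where "m x = (\<integral>y. f (x(i := y)) \<partial>D)" for x
  have mm: "m \<in> borel_measurable ?P"
    unfolding m_def using mpair by (intro D.borel_measurable_lebesgue_integral) simp
  have secint: "integrable D (\<lambda>y. f (x(i := y)))" if "x \<in> space ?P" for x
    by (rule D.integrable_of_square[OF msec[OF that] sec(1)[OF that that]])
  have IHm: "integrable ?P (\<lambda>x. (m x)\<^sup>2) \<and> (\<integral>x. (m x)\<^sup>2 \<partial>?P) \<le> (\<integral>x. m x \<partial>?P)\<^sup>2 + real (card I) * ?V"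
  proof (rule insert.IH[OF mm])
    fix x j z assume x: "x \<in> space ?P" "j \<in> I" "z \<in> space D"
    have x': "x(j := z) \<in> space ?P" using x by (auto simp: space_PiM PiE_def extensional_def)
    have "\<bar>m (x(j := z)) - m x\<bar> = \<bar>\<integral>y. f ((x(j := z))(i := y)) - f (x(i := y)) \<partial>D\<bar>"
      unfolding m_def using secint[OF x'] secint[OF x(1)] by (subst Bochner_Integration.integral_diff) auto
    also have "\<dots> \<le> (\<integral>y. \<bar>f ((x(j := z))(i := y)) - f (x(i := y))\<bar> \<partial>D)"
      by (rule integral_abs_bound)
    also have "\<dots> \<le> (\<integral>y. \<bar>g z - g (x j)\<bar> \<partial>D)"
    proof (rule integral_mono)
      show "integrable D (\<lambda>y. \<bar>f ((x(j := z))(i := y)) - f (x(i := y))\<bar>)"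
        using secint[OF x'] secint[OF x(1)] by auto
      fix y assume y: "y \<in> space D"
      show "\<bar>f ((x(j := z))(i := y)) - f (x(i := y))\<bar> \<le> \<bar>g z - g (x j)\<bar>"
        by (rule lip2[OF x y])
    qed simp
    finally show "\<bar>m (x(j := z)) - m x\<bar> \<le> \<bar>g z - g (x j)\<bar>" by (simp add: D.prob_space)
  qed
  have mean: "(\<integral>x. f x \<partial>?P') = (\<integral>x. m x \<partial>?P)"
    unfolding m_def using insert.hyps intf by (intro product_integral_insert) auto
  have "(\<integral>x. (f x)\<^sup>2 \<partial>?P') = (\<integral>x. (\<integral>y. (f (x(i := y)))\<^sup>2 \<partial>D) \<partial>?P)"
    using insert.hyps intf2 by (intro product_integral_insert) auto
  also have "\<dots> \<le> (\<integral>x. (m x)\<^sup>2 + ?V \<partial>?P)"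
  proof (rule integral_mono')
    show "integrable ?P (\<lambda>x. (m x)\<^sup>2 + ?V)" using IHm by auto
    show "(\<integral>y. (f (x(i := y)))\<^sup>2 \<partial>D) \<le> (m x)\<^sup>2 + ?V" if "x \<in> space ?P" for x
      unfolding m_def by (rule sec(2)[OF that that])
  qed simp
  also have "\<dots> = (\<integral>x. (m x)\<^sup>2 \<partial>?P) + ?V" using IHm by (simp add: P.prob_space)
  also have "\<dots> \<le> (\<integral>x. m x \<partial>?P)\<^sup>2 + real (card I) * ?V + ?V" using IHm by simp
  finally show ?case using intf2 insert.hyps by (simp add: mean algebra_simps)
qed

text \<open>Superadditivity is required only from \<open>n0\<close> on, since shorter blocks may
  have Z = 0. The limit is the supremum of the ratios, so a single positive ratio makes it
  positive.\<close>

lemma fekete: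
  fixes s :: "nat \<Rightarrow> real"
  assumes super: "\<And>m n. n0 \<le> m \<Longrightarrow> n0 \<le> n \<Longrightarrow> s m + s n \<le> s (m + n)"
    and upper: "\<And>n. n0 \<le> n \<Longrightarrow> s n \<le> C * real n" and n0: "1 \<le> n0"
  shows "\<exists>f. (\<lambda>n. s n / real n) \<longlonglongrightarrow> f \<and> (\<forall>m\<ge>n0. s m / real m \<le> f)"
proof -
  define f where "f = (SUP m\<in>{n0..}. s m / real m)"
  have bdd: "bdd_above ((\<lambda>m. s m / real m) ` {n0..})"
  proof (rule bdd_aboveI2)
    fix m assume m: "m \<in> {n0..}"
    then show "s m / real m \<le> C" using upper[of m] n0 by (simp add: divide_le_eq)
  qed
  have le: "s m / real m \<le> f" if "n0 \<le> m" for m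
    unfolding f_def using that by (intro cSUP_upper[OF _ bdd]) auto
  have iter: "real q * s m + s r \<le> s (q * m + r)" if "n0 \<le> m" "n0 \<le> r" for q m r
  proof (induction q)
    case (Suc q)
    have "real (Suc q) * s m + s r = s m + (real q * s m + s r)" by (simp add: algebra_simps)
    also have "\<dots> \<le> s m + s (q * m + r)" using Suc by simp
    also have "\<dots> \<le> s (m + (q * m + r))" using that by (intro super) auto
    finally show ?case by (simp add: add_ac)
  qed simp
  have lo: "eventually (\<lambda>n. e < s n / real n) sequentially" if e: "e < f" for e
  proof -
    have "\<exists>m\<in>{n0..}. e < s m / real m"
      using e unfolding f_def by (subst (asm) less_cSUP_iff[OF _ bdd]) auto
    then obtain m where m: "n0 \<le> m" "e < s m / real m" by auto
    have m0: "0 < m" using m n0 by simp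
    define B where "B = (\<Sum>r\<in>{n0..<n0+m}. \<bar>s r\<bar>) + real (n0 + m) * \<bar>s m / real m\<bar>"
    have key: "s m / real m - B / real n \<le> s n / real n" if n: "n0 \<le> n" for n
    proof -
      have npos: "0 < n" using n n0 by simp
      define q where "q = (n - n0) div m"
      \<comment> \<open>The remainder is shifted into [n0, n0 + m), so that superadditivity applies
        to it as well.\<close>
      define r where "r = n0 + (n - n0) mod m"
      have eq: "n = q * m + r" using n by (simp add: q_def r_def)
      have r: "n0 \<le> r" "r < n0 + m" using m0 by (auto simp: r_def)
      have "\<bar>s r\<bar> \<le> (\<Sum>r\<in>{n0..<n0+m}. \<bar>s r\<bar>)" using r by (intro member_le_sum) auto
      moreover have "real r * (s m / real m) \<le> real (n0 + m) * \<bar>s m / real m\<bar>"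
        using r by (intro order_trans[OF mult_left_mono[OF abs_ge_self] mult_right_mono]) auto
      ultimately have "real n * (s m / real m) - B \<le> (real n - real r) * (s m / real m) + s r"
        unfolding B_def by (simp only: left_diff_distrib)
      also have "real n - real r = real q * real m" by (simp add: eq)
      also have "real q * real m * (s m / real m) + s r = real q * s m + s r" using m0 by simp
      also have "\<dots> \<le> s n" unfolding eq by (rule iter[OF m(1) r(1)])
      finally have "(real n * (s m / real m) - B) / real n \<le> s n / real n"
        by (rule divide_right_mono) simp
      then show ?thesis using npos by (simp add: diff_divide_distrib)
    qed
    have "(\<lambda>n. s m / real m - B / real n) \<longlonglongrightarrow> s m / real m - 0"
      by (intro tendsto_intros lim_const_over_n)
    then have "eventually (\<lambda>n. e < s m / real m - B / real n) sequentially"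
      by (rule order_tendstoD) (use m in simp)
    then show ?thesis using eventually_ge_at_top[of n0]
      by eventually_elim (use key in force)
  qed
  have "(\<lambda>n. s n / real n) \<longlonglongrightarrow> f"
  proof (rule order_tendstoI)
    fix e assume "f < e"
    show "eventually (\<lambda>n. s n / real n < e) sequentially"
      using eventually_ge_at_top[of n0]
      by eventually_elim (use le \<open>f < e\<close> in force)
  qed (rule lo)
  then show ?thesis using le by blast
qed

text \<open>The squares around n are O(sqrt n) away, so their ratio to n tends to 1. The one-sided
  gap condition, used once from the square below and once towards the square above, encloses
  \<open>z n\<close> up to a logarithm.\<close>

lemma tendsto_of_squares:
  fixes z :: "nat \<Rightarrow> real"
  assumes sq: "(\<lambda>k. z (k\<^sup>2) / real (k\<^sup>2)) \<longlonglongrightarrow> f"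
    and gap: "\<And>m n. n0 \<le> m \<Longrightarrow> n0 \<le> n - m \<Longrightarrow> z m - C - B * ln (real (n - m)) \<le> z n" and B: "0 \<le> B" and n0: "1 \<le> n0"
  shows "(\<lambda>n. z n / real n) \<longlonglongrightarrow> f"
proof -
  define k where "k n = nat \<lfloor>sqrt (real n)\<rfloor>" for n :: nat
  have k_le: "real (k n) \<le> sqrt (real n)" "sqrt (real n) < real (k n) + 1" for n
    unfolding k_def by (simp_all add: of_nat_nat)
  have k2: "(k n)\<^sup>2 \<le> n" "n < (k n + 1)\<^sup>2" for n
  proof -
    have "(real (k n))\<^sup>2 \<le> (sqrt (real n))\<^sup>2" using k_le(1)[of n] by (intro power_mono) auto
    then have "real ((k n)\<^sup>2) \<le> real n" by simp
    then show "(k n)\<^sup>2 \<le> n" by (simp only: of_nat_le_iff)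
    have "(sqrt (real n))\<^sup>2 < (real (k n) + 1)\<^sup>2" using k_le(2)[of n] by (intro power_strict_mono) auto
    then have "real n < real ((k n + 1)\<^sup>2)" by (simp add: add.commute)
    then show "n < (k n + 1)\<^sup>2" by (simp only: of_nat_less_iff)
  qed
  have k_top: "filterlim k at_top sequentially"
  proof -
    have "filterlim (\<lambda>n. \<lfloor>sqrt (real n)\<rfloor>) at_top sequentially"
      by (intro filterlim_compose[OF filterlim_floor_sequentially] filterlim_compose[OF sqrt_at_top filterlim_real_sequentially])
    then show ?thesis unfolding k_def by (rule filterlim_compose[OF filterlim_nat_sequentially])
  qed
  have k1_top: "filterlim (\<lambda>n. k n - 1) at_top sequentially"
    by (rule filterlim_compose[OF filterlim_minus_const_nat_at_top k_top])
  have k2_top: "filterlim (\<lambda>n. k n + 2) at_top sequentially"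
    by (rule filterlim_compose[OF filterlim_add_const_nat_at_top k_top])
  have kn: "(\<lambda>n. real (k n) / sqrt (real n)) \<longlonglongrightarrow> 1"
  proof (rule tendsto_sandwich)
    show "\<forall>\<^sub>F n in sequentially. 1 - 1 / sqrt (real n) \<le> real (k n) / sqrt (real n)"
      using eventually_gt_at_top[of 0]
    proof eventually_elim
      case (elim n)
      have "(sqrt (real n) - 1) / sqrt (real n) \<le> real (k n) / sqrt (real n)"
        using k_le(2)[of n] by (intro divide_right_mono) auto
      then show ?case using elim by (simp add: diff_divide_distrib)
    qed
    show "\<forall>\<^sub>F n in sequentially. real (k n) / sqrt (real n) \<le> 1"
      using eventually_gt_at_top[of 0] by eventually_elim (use k_le(1) in auto)
    show "(\<lambda>n. 1 - 1 / sqrt (real n)) \<longlonglongrightarrow> 1" by real_asymp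
  qed simp
  have shift: "(\<lambda>n. (real (k n) + d)\<^sup>2 / real n) \<longlonglongrightarrow> 1" for d :: real
  proof -
    have "(\<lambda>n. (real (k n) / sqrt (real n) + d / sqrt (real n))\<^sup>2) \<longlonglongrightarrow> (1 + 0)\<^sup>2"
      by (intro tendsto_intros kn) real_asymp
    then have "(\<lambda>n. (real (k n) / sqrt (real n) + d / sqrt (real n))\<^sup>2) \<longlonglongrightarrow> 1" by simp
    moreover have "(real (k n) / sqrt (real n) + d / sqrt (real n))\<^sup>2 = (real (k n) + d)\<^sup>2 / real n" for n
      by (simp add: add_divide_distrib[symmetric] power_divide)
    ultimately show ?thesis by simp
  qed
  have err: "(\<lambda>n. (\<bar>C\<bar> + B * ln (4 * real n + 8)) / real n) \<longlonglongrightarrow> 0" by real_asymp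
  have ev: "eventually (\<lambda>n. n0 + 2 \<le> k n) sequentially"
    using k_top by (simp add: filterlim_at_top)
  \<comment> \<open>The squares of k - 1 and k + 2 are used instead of the nearest ones: the gap
    condition needs a distance of at least \<open>n0\<close>, which they have once k >= n0 +
    2.\<close>
  have lo: "\<forall>\<^sub>F n in sequentially. z ((k n - 1)\<^sup>2) / real ((k n - 1)\<^sup>2) * ((real (k n) + (- 1))\<^sup>2 / real n)
      - (\<bar>C\<bar> + B * ln (4 * real n + 8)) / real n \<le> z n / real n"
    using ev
  proof eventually_elim
    case (elim n)
    obtain j where j: "k n = Suc j" "n0 + 1 \<le> j" using elim by (cases "k n") auto
    have kn': "j\<^sup>2 + 2 * j + 1 \<le> n" using k2(1)[of n] by (simp add: j power2_eq_square)
    have npos: "0 < n" using kn' by simp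
    have "j * 1 \<le> j * j" using j by (intro mult_le_mono) auto
    moreover have "n0 \<le> j * 1" using j by simp
    ultimately have m: "n0 \<le> j\<^sup>2" unfolding power2_eq_square by (rule order_trans[rotated])
    have "z (j\<^sup>2) - C - B * ln (real (n - j\<^sup>2)) \<le> z n"
      using kn' j by (intro gap m) auto
    moreover have "B * ln (real (n - j\<^sup>2)) \<le> B * ln (4 * real n + 8)"
    proof (intro mult_left_mono B)
      have "0 < n - j\<^sup>2" "n - j\<^sup>2 \<le> 4 * n + 8" using kn' by auto
      then have "0 < real (n - j\<^sup>2)" "real (n - j\<^sup>2) \<le> real (4 * n + 8)"
        by (simp_all only: of_nat_0_less_iff of_nat_le_iff)
      then show "ln (real (n - j\<^sup>2)) \<le> ln (4 * real n + 8)"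
        by (subst ln_le_cancel_iff) (auto simp del: of_nat_diff)
    qed
    ultimately have "z (j\<^sup>2) - (\<bar>C\<bar> + B * ln (4 * real n + 8)) \<le> z n" by linarith
    then have "(z (j\<^sup>2) - (\<bar>C\<bar> + B * ln (4 * real n + 8))) / real n \<le> z n / real n"
      by (rule divide_right_mono) simp
    moreover have "z ((k n - 1)\<^sup>2) / real ((k n - 1)\<^sup>2) * ((real (k n) + (- 1))\<^sup>2 / real n) = z (j\<^sup>2) / real n"
      using j by simp
    ultimately show ?case by (simp add: diff_divide_distrib)
  qed
  have hi: "\<forall>\<^sub>F n in sequentially. z n / real n \<le> z ((k n + 2)\<^sup>2) / real ((k n + 2)\<^sup>2) * ((real (k n) + 2)\<^sup>2 / real n)
      + (\<bar>C\<bar> + B * ln (4 * real n + 8)) / real n"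
    using ev eventually_ge_at_top[of n0]
  proof eventually_elim
    case (elim n)
    let ?j = "k n"
    have kn': "n \<le> ?j\<^sup>2 + 2 * ?j" using k2(2)[of n] by (simp add: power2_eq_square)
    have kn'': "?j\<^sup>2 \<le> n" by (rule k2)
    have sq2: "(?j + 2)\<^sup>2 = ?j\<^sup>2 + 4 * ?j + 4" by (simp add: power2_eq_square algebra_simps)
    have jn: "?j \<le> n" using kn'' by (rule order_trans[rotated]) (simp add: power2_eq_square)
    have npos: "0 < n" using elim n0 by simp
    have "z n - C - B * ln (real ((?j + 2)\<^sup>2 - n)) \<le> z ((?j + 2)\<^sup>2)"
    proof (rule gap)
      show "n0 \<le> (?j + 2)\<^sup>2 - n" unfolding sq2 using kn' elim by linarith
    qed (use elim in simp)
    moreover have "B * ln (real ((?j + 2)\<^sup>2 - n)) \<le> B * ln (4 * real n + 8)"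
    proof (intro mult_left_mono B)
      have "0 < (?j + 2)\<^sup>2 - n" "(?j + 2)\<^sup>2 - n \<le> 4 * n + 8"
        unfolding sq2 using kn' kn'' jn by linarith+
      then have "0 < real ((?j + 2)\<^sup>2 - n)" "real ((?j + 2)\<^sup>2 - n) \<le> real (4 * n + 8)"
        by (simp_all only: of_nat_0_less_iff of_nat_le_iff)
      then show "ln (real ((?j + 2)\<^sup>2 - n)) \<le> ln (4 * real n + 8)"
        by (subst ln_le_cancel_iff) (auto simp del: of_nat_diff)
    qed
    ultimately have "z n \<le> z ((?j + 2)\<^sup>2) + (\<bar>C\<bar> + B * ln (4 * real n + 8))" by linarith
    then have "z n / real n \<le> (z ((?j + 2)\<^sup>2) + (\<bar>C\<bar> + B * ln (4 * real n + 8))) / real n"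
      by (rule divide_right_mono) simp
    moreover have "z ((?j + 2)\<^sup>2) / real ((?j + 2)\<^sup>2) * ((real ?j + 2)\<^sup>2 / real n) = z ((?j + 2)\<^sup>2) / real n"
    proof -
      have "real ((?j + 2)\<^sup>2) = (real ?j + 2)\<^sup>2" by simp
      moreover have "(real ?j + 2)\<^sup>2 \<noteq> 0" by simp
      ultimately show ?thesis by (simp only: nonzero_mult_div_cancel_right times_divide_times_eq mult.commute) simp
    qed
    ultimately show ?case by (simp add: add_divide_distrib)
  qed
  show ?thesis
  proof (rule tendsto_sandwich[OF lo hi])
    have "(\<lambda>n. z ((k n - 1)\<^sup>2) / real ((k n - 1)\<^sup>2) * ((real (k n) + (- 1))\<^sup>2 / real n)
        - (\<bar>C\<bar> + B * ln (4 * real n + 8)) / real n) \<longlonglongrightarrow> f * 1 - 0"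
      by (intro tendsto_diff tendsto_mult shift err filterlim_compose[OF sq k1_top])
    then show "(\<lambda>n. z ((k n - 1)\<^sup>2) / real ((k n - 1)\<^sup>2) * ((real (k n) + (- 1))\<^sup>2 / real n)
        - (\<bar>C\<bar> + B * ln (4 * real n + 8)) / real n) \<longlonglongrightarrow> f" by simp
    have "(\<lambda>n. z ((k n + 2)\<^sup>2) / real ((k n + 2)\<^sup>2) * ((real (k n) + 2)\<^sup>2 / real n)
      + (\<bar>C\<bar> + B * ln (4 * real n + 8)) / real n) \<longlonglongrightarrow> f * 1 + 0"
      by (intro tendsto_add tendsto_mult shift err filterlim_compose[OF sq k2_top])
    then show "(\<lambda>n. z ((k n + 2)\<^sup>2) / real ((k n + 2)\<^sup>2) * ((real (k n) + 2)\<^sup>2 / real n)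
      + (\<bar>C\<bar> + B * ln (4 * real n + 8)) / real n) \<longlonglongrightarrow> f" by simp
  qed
qed

section \<open>Variance of the logarithm of the partition function\<close>

context renewal_kernel
begin

text \<open>A trajectory meets site \<open>i\<close> at most once, so a changed weight there costs
  it at most one factor \<open>c\<close>; c >= 1 covers the trajectories that avoid
  \<open>i\<close>.\<close>

lemma Z_change_le:
  assumes pos: "\<And>j. 0 < \<xi> j" "\<And>j. 0 < \<xi>' j" and same: "\<And>j. j \<noteq> i \<Longrightarrow> \<xi>' j = \<xi> j"
    and c: "1 \<le> c" "\<xi>' i \<le> c * \<xi> i"
  shows "Z \<xi>' n \<le> (if i \<le> n then c else 1) * Z \<xi> n"
proof (induction n rule: less_induct)
  case (less n)
  have nn: "0 \<le> Z \<xi> m" for m using pos by (intro Z_nonneg less_imp_le)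
  show ?case
  proof (cases "n = 0")
    case True
    then show ?thesis using c by simp
  next
    case False
    let ?d = "if i < n then c else 1"
    have "(\<Sum>m<n. Z \<xi>' m * K (n - m)) \<le> (\<Sum>m<n. ?d * Z \<xi> m * K (n - m))"
    proof (intro sum_mono mult_right_mono K_nonneg)
      fix m assume m: "m \<in> {..<n}"
      have "Z \<xi>' m \<le> (if i \<le> m then c else 1) * Z \<xi> m" using m by (intro less.IH) auto
      also have "\<dots> \<le> ?d * Z \<xi> m" using m c by (intro mult_right_mono nn) auto
      finally show "Z \<xi>' m \<le> ?d * Z \<xi> m" .
    qed
    also have "\<dots> = ?d * (\<Sum>m<n. Z \<xi> m * K (n - m))" by (simp add: sum_distrib_left mult_ac)
    finally have le: "(\<Sum>m<n. Z \<xi>' m * K (n - m)) \<le> ?d * (\<Sum>m<n. Z \<xi> m * K (n - m))" .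
    have S: "0 \<le> (\<Sum>m<n. Z \<xi> m * K (n - m))" by (intro sum_nonneg mult_nonneg_nonneg nn K_nonneg)
    have "Z \<xi>' n \<le> \<xi>' n * (?d * (\<Sum>m<n. Z \<xi> m * K (n - m)))"
      using False pos(2)[of n] le by (subst Z_rec) (auto intro: mult_left_mono)
    also have "\<dots> \<le> (if i \<le> n then c else 1) * (\<xi> n * (\<Sum>m<n. Z \<xi> m * K (n - m)))"
    proof (cases "n = i")
      case True
      then show ?thesis using mult_right_mono[OF c(2) S] by (simp add: mult_ac)
    next
      case False
      then show ?thesis by (auto simp: same mult_ac)
    qed
    also have "\<xi> n * (\<Sum>m<n. Z \<xi> m * K (n - m)) = Z \<xi> n" using False by (simp add: Z_rec)
    finally show ?thesis .
  qed
qed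

text \<open>Using the previous bound in both directions yields the Lipschitz condition of
  \<open>efron_stein\<close>, with \<open>g\<close> the logarithm of a single weight.\<close>

lemma ln_Z_lipschitz:
  assumes pos: "\<And>j. 0 < \<xi> j" "\<And>j. 0 < \<xi>' j" and same: "\<And>j. j \<noteq> i \<Longrightarrow> \<xi>' j = \<xi> j"
    and Z: "0 < Z \<xi> n" "0 < Z \<xi>' n"
  shows "\<bar>ln (Z \<xi>' n) - ln (Z \<xi> n)\<bar> \<le> \<bar>ln (\<xi>' i) - ln (\<xi> i)\<bar>"
proof -
  have *: "ln (Z \<xi>' n) \<le> ln (Z \<xi> n) + \<bar>ln (\<xi>' i) - ln (\<xi> i)\<bar>"
    if pos: "\<And>j. 0 < \<xi> j" "\<And>j. 0 < \<xi>' j" and same: "\<And>j. j \<noteq> i \<Longrightarrow> \<xi>' j = \<xi> j"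
      and Z: "0 < Z \<xi> n" "0 < Z \<xi>' n" for \<xi> \<xi>'
  proof -
    define c where "c = exp \<bar>ln (\<xi>' i) - ln (\<xi> i)\<bar>"
    have c: "1 \<le> c" by (simp add: c_def)
    have "\<xi>' i = exp (ln (\<xi>' i) - ln (\<xi> i)) * \<xi> i" using pos(1)[of i] pos(2)[of i] by (simp add: exp_diff)
    also have "\<dots> \<le> c * \<xi> i" unfolding c_def using pos(1)[of i] by (intro mult_right_mono) auto
    finally have "Z \<xi>' n \<le> (if i \<le> n then c else 1) * Z \<xi> n"
      using Z_change_le[OF pos same c] by simp
    also have "\<dots> \<le> c * Z \<xi> n" using c Z by (intro mult_right_mono) auto
    finally have "ln (Z \<xi>' n) \<le> ln (c * Z \<xi> n)" using Z c by (subst ln_le_cancel_iff) auto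
    also have "\<dots> = \<bar>ln (\<xi>' i) - ln (\<xi> i)\<bar> + ln (Z \<xi> n)" using Z by (simp add: c_def ln_mult)
    finally show ?thesis by simp
  qed
  have "ln (Z \<xi>' n) \<le> ln (Z \<xi> n) + \<bar>ln (\<xi>' i) - ln (\<xi> i)\<bar>" by (rule *[OF pos same Z])
  moreover have "ln (Z \<xi> n) \<le> ln (Z \<xi>' n) + \<bar>ln (\<xi> i) - ln (\<xi>' i)\<bar>"
    by (rule *[OF pos(2,1) same[symmetric] Z(2,1)])
  ultimately show ?thesis by linarith
qed

end

context pinning
begin

lemma lnZ_measurable [measurable]: "lnZ \<beta> h N \<in> borel_measurable M"
  unfolding lnZ_def[abs_def] using measurable_compose[OF measurable_env measurable_Z_wt] by measurable

text \<open>Below 1 the logarithm is bounded by that of 1 - \<beta>, where \<beta> < 1 enters; above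
  1, ln v = 2 ln (sqrt v) gives (ln v)^2 <= 4 v, so a first moment suffices. Truncation at -1 keeps
  the argument positive at all reals.\<close>

lemma log_weight_square_integrable:
  assumes \<beta>: "0 \<le> \<beta>" "\<beta> < 1"
  shows "integrable D (\<lambda>y. (ln (\<beta> * max (- 1) y + 1))\<^sup>2)"
proof -
  interpret D: prob_space D by (rule prob_space_D)
  have int: "integrable D (\<lambda>y. (ln (1 - \<beta>))\<^sup>2 + 4 * (1 + \<bar>y\<bar>))"
    using integrable_D by simp
  show ?thesis
  proof (rule Bochner_Integration.integrable_bound[OF int])
    show "AE y in D. norm ((ln (\<beta> * max (- 1) y + 1))\<^sup>2) \<le> norm ((ln (1 - \<beta>))\<^sup>2 + 4 * (1 + \<bar>y\<bar>))"
    proof (rule AE_I2)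
      fix y
      define v where "v = \<beta> * max (- 1) y + 1"
      have "\<beta> * - 1 \<le> \<beta> * max (- 1) y" using \<beta> by (intro mult_left_mono) auto
      then have v: "1 - \<beta> \<le> v" "0 < v" using \<beta> by (auto simp: v_def)
      have "(ln v)\<^sup>2 \<le> (ln (1 - \<beta>))\<^sup>2 + 4 * (1 + \<bar>y\<bar>)"
      proof (cases "v \<le> 1")
        case True
        have "ln (1 - \<beta>) \<le> ln v" using v \<beta> by (subst ln_le_cancel_iff) auto
        moreover have "ln v \<le> 0" using True v by simp
        ultimately have "(ln v)\<^sup>2 \<le> (ln (1 - \<beta>))\<^sup>2" by (simp add: abs_le_square_iff[symmetric])
        then show ?thesis by (simp add: add_increasing2)
      next
        case False
        have "ln v = 2 * ln (sqrt v)" using v by (simp add: ln_sqrt)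
        also have "\<dots> \<le> 2 * sqrt v" using ln_le_minus_one[of "sqrt v"] v by simp
        finally have "(ln v)\<^sup>2 \<le> (2 * sqrt v)\<^sup>2" using False by (intro power_mono) auto
        also have "\<dots> = 4 * v" using v by (simp add: power_mult_distrib)
        also have "v \<le> 1 + \<bar>y\<bar>"
        proof -
          have "0 < \<beta> * max (- 1) y" using False by (simp add: v_def)
          then have "0 \<le> max (- 1) y" using \<beta> by (auto simp: zero_less_mult_iff)
          then have "\<beta> * max (- 1) y \<le> 1 * \<bar>y\<bar>" using \<beta> by (intro mult_mono) auto
          then show ?thesis by (simp add: v_def)
        qed
        finally show ?thesis by (simp add: add_increasing)
      qed
      then show "norm ((ln (\<beta> * max (- 1) y + 1))\<^sup>2) \<le> norm ((ln (1 - \<beta>))\<^sup>2 + 4 * (1 + \<bar>y\<bar>))"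
        unfolding v_def by simp
    qed
  qed measurable
qed

lemma distr_finite: "1 \<le> N \<Longrightarrow> distr M (PiM {1..N} (\<lambda>_. borel)) (\<lambda>x. \<lambda>i\<in>{1..N}. \<omega> i x) = PiM {1..N} (\<lambda>_. D)"
  using indep_vars_iff_distr_eq_PiM'[of "{1..N}" \<omega> "\<lambda>_. borel"] indep_vars_subset[OF indep, of "{1..N}"]
  by (simp add: distr_\<omega>)

lemma lnZ_variance:
  assumes \<beta>: "0 \<le> \<beta>" "\<beta> < 1" and N: "1 \<le> N" and K: "0 < K N"
  shows "integrable M (\<lambda>x. (lnZ \<beta> h N x)\<^sup>2)"
    and "expectation (\<lambda>x. (lnZ \<beta> h N x - expectation (lnZ \<beta> h N))\<^sup>2)
      \<le> real N * (\<integral>y. (ln (\<beta> * max (- 1) y + 1))\<^sup>2 \<partial>D)"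
proof -
  let ?P = "PiM {1..N} (\<lambda>_. D)" and ?B = "PiM {1..N} (\<lambda>_. borel :: real measure)"
  \<comment> \<open>\<open>efron_stein\<close> asks for the Lipschitz condition at every point of
    the product space, so the weights are made positive for all arguments; outside 1..N the disorder
    is set to 0.\<close>
  define \<xi> where "\<xi> z i = exp h * (\<beta> * max (- 1) (if i \<in> {1..N} then z i else 0) + 1)" for z :: "nat \<Rightarrow> real" and i
  define f where "f z = ln (Z (\<xi> z) N)" for z
  let ?g = "\<lambda>y. ln (\<beta> * max (- 1) y + 1)"
  have wpos: "0 < \<beta> * max (- 1) y + 1" for y
  proof -
    have "\<beta> * - 1 \<le> \<beta> * max (- 1) y" using \<beta> by (intro mult_left_mono) auto
    then show ?thesis using \<beta> by simp
  qed
  have \<xi>pos: "0 < \<xi> z i" for z i unfolding \<xi>_def by (intro mult_pos_pos wpos) simp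
  have Zpos: "0 < Z (\<xi> z) N" for z
  proof -
    have "0 < \<xi> z N * K N" using \<xi>pos K by simp
    also have "\<dots> \<le> Z (\<xi> z) N" using N by (intro Z_ge_single less_imp_le[OF \<xi>pos]) auto
    finally show ?thesis .
  qed
  have m\<xi>: "(\<lambda>z. \<xi> z i) \<in> borel_measurable ?B" for i
  proof (cases "i \<in> {1..N}")
    case True
    have [measurable]: "(\<lambda>z. z i) \<in> borel_measurable ?B" by (rule measurable_component_singleton[OF True])
    show ?thesis using True unfolding \<xi>_def by simp
  next
    case False
    show ?thesis unfolding \<xi>_def if_not_P[OF False] by simp
  qed
  have mf: "f \<in> borel_measurable ?B"
    unfolding f_def[abs_def] by (intro borel_measurable_ln measurable_Z m\<xi>)
  have sets: "sets ?P = sets ?B" by (intro sets_PiM_cong) auto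
  have mfP: "f \<in> borel_measurable ?P" using mf by (simp cong: measurable_cong_sets add: sets)
  have lip: "\<bar>f (z(i := y)) - f z\<bar> \<le> \<bar>?g y - ?g (z i)\<bar>" if i: "i \<in> {1..N}" for z i y
  proof -
    have "\<bar>f (z(i := y)) - f z\<bar> \<le> \<bar>ln (\<xi> (z(i := y)) i) - ln (\<xi> z i)\<bar>"
      unfolding f_def by (rule ln_Z_lipschitz[OF \<xi>pos \<xi>pos _ Zpos Zpos]) (simp add: \<xi>_def)
    also have "ln (\<xi> (z(i := y)) i) - ln (\<xi> z i) = ?g y - ?g (z i)"
      using i wpos[of y] wpos[of "z i"] by (simp add: \<xi>_def ln_mult)
    finally show ?thesis .
  qed
  have g0: "?g 0 = 0" by simp
  have es: "integrable ?P (\<lambda>z. (f z)\<^sup>2) \<and>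
    (\<integral>z. (f z)\<^sup>2 \<partial>?P) \<le> (\<integral>z. f z \<partial>?P)\<^sup>2 + real (card {1..N}) * (\<integral>y. (?g y - ?g 0)\<^sup>2 \<partial>D)"
  proof (rule efron_stein[OF prob_space_D _ _ _ mfP])
    show "integrable D (\<lambda>y. (?g y - ?g 0)\<^sup>2)"
      unfolding g0 using log_weight_square_integrable[OF \<beta>] by simp
  qed (use lip in auto)
  let ?r = "\<lambda>x. \<lambda>i\<in>{1..N}. \<omega> i x"
  have mr: "?r \<in> measurable M ?B" by (intro measurable_restrict) simp
  have fr: "f (?r x) = lnZ \<beta> h N x" for x
  proof -
    have "Z (\<xi> (?r x)) N = Z (wt \<beta> h (env x)) N"
    proof (rule Z_cong)
      fix i assume "1 \<le> i" "i \<le> N"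
      then show "\<xi> (?r x) i = wt \<beta> h (env x) i"
        using lower[of i x] by (simp add: \<xi>_def wt_def env_def max_def)
    qed
    then show ?thesis by (simp add: f_def lnZ_def)
  qed
  have i1: "(\<integral>z. f z \<partial>?P) = expectation (lnZ \<beta> h N)"
    unfolding distr_finite[OF N, symmetric] by (subst integral_distr[OF mr mf]) (simp only: fr)
  have mf2: "(\<lambda>z. (f z)\<^sup>2) \<in> borel_measurable ?B" using mf by measurable
  have i2: "(\<integral>z. (f z)\<^sup>2 \<partial>?P) = expectation (\<lambda>x. (lnZ \<beta> h N x)\<^sup>2)"
    unfolding distr_finite[OF N, symmetric] by (subst integral_distr[OF mr mf2]) (simp only: fr)
  have i3: "integrable ?P (\<lambda>z. (f z)\<^sup>2) \<longleftrightarrow> integrable M (\<lambda>x. (lnZ \<beta> h N x)\<^sup>2)"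
    unfolding distr_finite[OF N, symmetric] by (subst integrable_distr_eq[OF mr mf2]) (simp only: fr)
  show int: "integrable M (\<lambda>x. (lnZ \<beta> h N x)\<^sup>2)" using es i3 by simp
  have int1: "integrable M (lnZ \<beta> h N)" by (rule integrable_of_square[OF lnZ_measurable int])
  show "expectation (\<lambda>x. (lnZ \<beta> h N x - expectation (lnZ \<beta> h N))\<^sup>2) \<le> real N * (\<integral>y. (?g y)\<^sup>2 \<partial>D)"
    using es unfolding i1 i2 by (subst variance_eq[OF int1 int]) simp
qed

text \<open>\<open>Z_supermult\<close> and stationarity make the means superadditive; the variance
  bound carries their limit over to almost every environment along squares. The second clause
  reduces a positive free energy to one block with positive mean of ln Z.\<close>

lemma free_energy_exists:
  assumes \<beta>: "0 \<le> \<beta>" "\<beta> < 1" and n0: "1 \<le> n0" and c: "0 < c"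
    and K_lo: "\<And>n. n0 \<le> n \<Longrightarrow> c * real n powr (- (1 + \<alpha>)) \<le> K n"
  shows "\<exists>f. (AE x in M. (\<lambda>N. 1 / real N * lnZ \<beta> h N x) \<longlonglongrightarrow> f) \<and>
    (\<forall>m\<ge>n0. integrable M (lnZ \<beta> h m) \<and> expectation (lnZ \<beta> h m) / real m \<le> f)"
proof -
  define V where "V = (\<integral>y. (ln (\<beta> * max (- 1) y + 1))\<^sup>2 \<partial>D)"
  define s where "s N = expectation (lnZ \<beta> h N)" for N
  have Kpos: "0 < K n" if "n0 \<le> n" for n
  proof -
    have "0 < c * real n powr (- (1 + \<alpha>))" using c n0 that by simp
    then show ?thesis using K_lo[OF that] by simp
  qed
  have N1: "1 \<le> n" if "n0 \<le> n" for n using that n0 by simp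
  have sq: "integrable M (\<lambda>x. (lnZ \<beta> h N x)\<^sup>2)" if "n0 \<le> N" for N
    by (rule lnZ_variance(1)[OF \<beta> N1[OF that] Kpos[OF that]])
  have var: "expectation (\<lambda>x. (lnZ \<beta> h N x - s N)\<^sup>2) \<le> real N * V" if "n0 \<le> N" for N
    unfolding s_def V_def by (rule lnZ_variance(2)[OF \<beta> N1[OF that] Kpos[OF that]])
  have int: "integrable M (lnZ \<beta> h N)" if "n0 \<le> N" for N
    by (rule integrable_of_square[OF lnZ_measurable sq[OF that]])
  have wt0: "0 < wt \<beta> h (env x) i" for x i by (rule wt_pos[OF \<beta>])
  define R where "R m n x = Z (wt \<beta> h (\<lambda>i. env x (m + i))) n" for m n x
  have R_lo: "exp h * (1 - \<beta>) * K n \<le> R m n x" if "n0 \<le> n" for m n x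
  proof -
    have "exp h * (1 - \<beta>) * K n \<le> wt \<beta> h (env x) (m + n) * K n"
      by (intro mult_right_mono wt_lower K_nonneg \<beta>)
    also have "\<dots> \<le> R m n x"
    proof -
      have e: "(\<lambda>i. wt \<beta> h (env x) (m + i)) = wt \<beta> h (\<lambda>i. env x (m + i))"
        by (simp add: fun_eq_iff wt_shift)
      show ?thesis
        unfolding R_def e[symmetric] using N1[OF that] wt0[of x]
        by (intro Z_ge_single[where \<xi> = "\<lambda>i. wt \<beta> h (env x) (m + i)"]) (auto intro: less_imp_le)
    qed
    finally show ?thesis .
  qed
  have R_pos: "0 < R m n x" if "n0 \<le> n" for m n x
    by (rule less_le_trans[OF _ R_lo[OF that]]) (use \<beta> Kpos[OF that] in simp)
  have Z_pos: "0 < Z (wt \<beta> h (env x)) n" if "n0 \<le> n" for n x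
    using R_pos[OF that, of 0 x] by (simp add: R_def)
  have super: "lnZ \<beta> h m x + ln (R m n x) \<le> lnZ \<beta> h (m + n) x" if "n0 \<le> m" "n0 \<le> n" for m n x
  proof -
    have "Z (wt \<beta> h (env x)) m * R m n x \<le> Z (wt \<beta> h (env x)) (m + n)"
      unfolding R_def using Z_supermult[of "wt \<beta> h (env x)" m n] wt0[of x]
      by (simp add: wt_shift less_imp_le)
    then have "ln (Z (wt \<beta> h (env x)) m * R m n x) \<le> lnZ \<beta> h (m + n) x"
      unfolding lnZ_def using Z_pos[of m x] R_pos[of n m x] Z_pos[of "m + n" x] that
      by (subst ln_le_cancel_iff) auto
    then show ?thesis
      unfolding lnZ_def using Z_pos[of m x] R_pos[of n m x] that by (simp add: ln_mult)
  qed
  have mlnZ: "(\<lambda>y. ln (Z (wt \<beta> h y) n)) \<in> borel_measurable seq_space" for n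
    by (rule borel_measurable_ln[OF measurable_Z_wt])
  have R_int: "integrable M (\<lambda>x. ln (R m n x))" "expectation (\<lambda>x. ln (R m n x)) = s n" if "n0 \<le> n" for m n
    using integral_shift[OF mlnZ, of m n] int[OF that] unfolding R_def s_def lnZ_def[abs_def] by simp_all
  have superE: "s m + s n \<le> s (m + n)" if mn: "n0 \<le> m" "n0 \<le> n" for m n
  proof -
    have "s m + s n = expectation (\<lambda>x. lnZ \<beta> h m x + ln (R m n x))"
      using int[OF mn(1)] R_int[OF mn(2), of m] by (simp add: s_def)
    also have "\<dots> \<le> s (m + n)"
      unfolding s_def using mn int[OF mn(1)] R_int[OF mn(2), of m] int[of "m + n"]
      by (intro integral_mono super) auto
    finally show ?thesis .
  qed
  \<comment> \<open>Annealed bound: the mean of \<open>Z\<close> is at most e^(|h| n), and ln v <= v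
    - 1 at the normalised value takes the place of Jensen's inequality.\<close>
  have upper: "s n \<le> \<bar>h\<bar> * real n" if n: "n0 \<le> n" for n
  proof -
    let ?Z = "\<lambda>x. Z (wt \<beta> h (env x)) n" and ?C = "exp (\<bar>h\<bar> * real n)"
    have Znn: "0 \<le> ?Z x" for x using Z_pos[OF n, of x] by simp
    have "(\<integral>\<^sup>+x. ennreal (?Z x) \<partial>M) \<le> ennreal (\<Sum>k\<le>n. exp h ^ k * kap k n)"
      using tilted_Z_le[of "\<lambda>_. 1" \<beta> "exp h" h n] mean_weight_le[of \<beta> h] \<beta> by simp
    also have "(\<Sum>k\<le>n. exp h ^ k * kap k n) \<le> (\<Sum>k\<le>n. ?C * kap k n)"
    proof (intro sum_mono mult_right_mono kap_nonneg)
      fix k assume k: "k \<in> {..n}"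
      have "exp h ^ k = exp (real k * h)" by (simp add: exp_of_nat_mult)
      also have "\<dots> \<le> ?C"
      proof -
        have "real k * h \<le> real k * \<bar>h\<bar>" by (intro mult_left_mono) auto
        also have "\<dots> \<le> real n * \<bar>h\<bar>" using k by (intro mult_right_mono) auto
        finally have "real k * h \<le> real n * \<bar>h\<bar>" .
        then show ?thesis by (simp add: mult.commute)
      qed
      finally show "exp h ^ k \<le> ?C" .
    qed
    also have "(\<Sum>k\<le>n. ?C * kap k n) = ?C * u n" by (simp only: sum_distrib_left Z_def)
    also have "\<dots> \<le> ?C * 1" by (intro mult_left_mono u_le_1) simp
    finally have EZ: "(\<integral>\<^sup>+x. ennreal (?Z x) \<partial>M) \<le> ennreal ?C" by (simp add: ennreal_leI)
    have mZ: "?Z \<in> borel_measurable M" by (rule measurable_compose[OF measurable_env measurable_Z_wt])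
    have intZ: "integrable M ?Z"
      by (rule integrableI_nonneg[OF mZ]) (use Znn EZ in \<open>auto intro: le_less_trans\<close>)
    have EZ': "expectation ?Z \<le> ?C"
      using EZ nn_integral_eq_integral[OF intZ] Znn by simp
    have "lnZ \<beta> h n x \<le> exp (- (\<bar>h\<bar> * real n)) * ?Z x + (\<bar>h\<bar> * real n - 1)" for x
    proof -
      have "ln (exp (- (\<bar>h\<bar> * real n)) * ?Z x) \<le> exp (- (\<bar>h\<bar> * real n)) * ?Z x - 1"
        using Z_pos[OF n, of x] by (intro ln_le_minus_one) auto
      then show ?thesis using Z_pos[OF n, of x] by (simp add: lnZ_def ln_mult)
    qed
    then have "s n \<le> expectation (\<lambda>x. exp (- (\<bar>h\<bar> * real n)) * ?Z x + (\<bar>h\<bar> * real n - 1))"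
      unfolding s_def using int[OF n] intZ by (intro integral_mono) auto
    also have "\<dots> = exp (- (\<bar>h\<bar> * real n)) * expectation ?Z + (\<bar>h\<bar> * real n - 1)"
      using intZ by (simp add: prob_space)
    also have "\<dots> \<le> exp (- (\<bar>h\<bar> * real n)) * ?C + (\<bar>h\<bar> * real n - 1)"
      using EZ' by (intro add_right_mono mult_left_mono) auto
    also have "\<dots> = \<bar>h\<bar> * real n" by (simp add: exp_minus_inverse exp_add[symmetric])
    finally show ?thesis .
  qed
  obtain f where f: "(\<lambda>n. s n / real n) \<longlonglongrightarrow> f" "\<And>m. n0 \<le> m \<Longrightarrow> s m / real m \<le> f"
    using fekete[of n0 s "\<bar>h\<bar>"] superE upper n0 by blast
  \<comment> \<open>The variance of ln Z at k^2 is at most k^2 \<open>V\<close>, so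
    \<open>d k\<close> has second moment at most V / k^2. This is summable, which is why squares are
    used.\<close>
  define d where "d k x = (lnZ \<beta> h (k\<^sup>2) x - s (k\<^sup>2)) / real (k\<^sup>2)" for k x
  have sm: "summable (\<lambda>k. inverse (real k ^ 2) * V)"
    using inverse_power_summable[of 2, where 'a = real] by (intro summable_mult2) simp
  have V0: "0 \<le> V" unfolding V_def by simp
  have k2: "n0 \<le> (k + n0)\<^sup>2" for k
  proof -
    have "n0 * 1 \<le> (k + n0) * (k + n0)" using n0 by (intro mult_le_mono) auto
    then show ?thesis by (simp add: power2_eq_square)
  qed
  have dk: "(\<integral>\<^sup>+x. ennreal ((d (k + n0) x)\<^sup>2) \<partial>M) \<le> ennreal (inverse (real (k + n0) ^ 2) * V)" for k
  proof -
    let ?N = "(k + n0)\<^sup>2"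
    have Npos: "0 < real ?N" using n0 by simp
    have e: "(d (k + n0) x)\<^sup>2 = inverse (real ?N ^ 2) * (lnZ \<beta> h ?N x - s ?N)\<^sup>2" for x
      by (simp only: d_def divide_inverse power_mult_distrib power_inverse mult.commute)
    have intd: "integrable M (\<lambda>x. (lnZ \<beta> h ?N x - s ?N)\<^sup>2)"
      unfolding power2_diff using int[OF k2] sq[OF k2] by auto
    have "(\<integral>\<^sup>+x. ennreal ((d (k + n0) x)\<^sup>2) \<partial>M) = ennreal (inverse (real ?N ^ 2) * expectation (\<lambda>x. (lnZ \<beta> h ?N x - s ?N)\<^sup>2))"
      unfolding e using intd by (subst nn_integral_eq_integral) auto
    also have "\<dots> \<le> ennreal (inverse (real ?N ^ 2) * (real ?N * V))"
      by (intro ennreal_leI mult_left_mono var[OF k2]) simp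
    also have "inverse (real ?N ^ 2) * (real ?N * V) = inverse (real ?N) * V"
    proof -
      have "inverse (r ^ 2) * (r * V) = inverse r * V" if "0 < r" for r :: real
        using that by (simp add: power2_eq_square)
      then show ?thesis using Npos by blast
    qed
    finally show ?thesis by simp
  qed
  have md: "(\<lambda>x. ennreal ((d k x)\<^sup>2)) \<in> borel_measurable M" for k
    unfolding d_def by measurable
  have "(\<integral>\<^sup>+x. (\<Sum>k. ennreal ((d (k + n0) x)\<^sup>2)) \<partial>M) = (\<Sum>k. \<integral>\<^sup>+x. ennreal ((d (k + n0) x)\<^sup>2) \<partial>M)"
    by (rule nn_integral_suminf[OF md])
  also have "\<dots> \<le> (\<Sum>k. ennreal (inverse (real (k + n0) ^ 2) * V))"
    by (intro suminf_le dk) auto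
  also have "\<dots> = ennreal (\<Sum>k. inverse (real (k + n0) ^ 2) * V)"
    using summable_ignore_initial_segment[OF sm, of n0] V0 by (intro suminf_ennreal2) auto
  finally have "(\<integral>\<^sup>+x. (\<Sum>k. ennreal ((d (k + n0) x)\<^sup>2)) \<partial>M) < \<infinity>"
    unfolding infinity_ennreal_def by (rule le_less_trans) (rule ennreal_less_top)
  then have "AE x in M. (\<Sum>k. ennreal ((d (k + n0) x)\<^sup>2)) \<noteq> \<infinity>"
    by (intro nn_integral_noteq_infinite borel_measurable_suminf_order md less_imp_neq)
  then have "AE x in M. (\<lambda>N. lnZ \<beta> h N x / real N) \<longlonglongrightarrow> f"
  proof eventually_elim
    case (elim x)
    have "summable (\<lambda>k. (d (k + n0) x)\<^sup>2)"
      by (rule summable_suminf_not_top) (use elim in auto)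
    then have "(\<lambda>k. (d (k + n0) x)\<^sup>2) \<longlonglongrightarrow> 0" by (rule summable_LIMSEQ_zero)
    then have "(\<lambda>k. sqrt ((d (k + n0) x)\<^sup>2)) \<longlonglongrightarrow> sqrt 0" by (rule tendsto_real_sqrt)
    then have "(\<lambda>k. d (k + n0) x) \<longlonglongrightarrow> 0" by (simp add: tendsto_rabs_zero_iff)
    then have d0: "(\<lambda>k. d k x) \<longlonglongrightarrow> 0" by (rule LIMSEQ_offset)
    have "filterlim (\<lambda>k::nat. k\<^sup>2) at_top sequentially"
      by (rule filterlim_subseq) (simp add: strict_mono_def power_strict_mono)
    from tendsto_add[OF d0 filterlim_compose[OF f(1) this]]
    have sqs: "(\<lambda>k. lnZ \<beta> h (k\<^sup>2) x / real (k\<^sup>2)) \<longlonglongrightarrow> f"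
      by (simp add: d_def diff_divide_distrib)
    show ?case
    proof (rule tendsto_of_squares[OF sqs, where ?n0.0 = n0 and C = "- (h + ln (1 - \<beta>) + ln c)" and B = "1 + \<alpha>"])
      fix m n assume mn: "n0 \<le> m" "n0 \<le> n - m"
      then have n: "n = m + (n - m)" using n0 by simp
      have np: "0 < real (n - m)" using mn n0 by simp
      \<comment> \<open>One gap from \<open>m\<close> to \<open>n\<close> costs only a power of n -
        m in every environment; this is the one-sided comparison needed between squares.\<close>
      have "exp h * (1 - \<beta>) * (c * real (n - m) powr (- (1 + \<alpha>))) \<le> R m (n - m) x"
        using \<beta> by (intro order_trans[OF mult_left_mono[OF K_lo[OF mn(2)]] R_lo[OF mn(2)]]) simp
      then have "ln (exp h * (1 - \<beta>) * (c * real (n - m) powr (- (1 + \<alpha>)))) \<le> ln (R m (n - m) x)"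
        using \<beta> c np R_pos[OF mn(2), of m x] by (subst ln_le_cancel_iff) auto
      also have "ln (exp h * (1 - \<beta>) * (c * real (n - m) powr (- (1 + \<alpha>))))
          = h + ln (1 - \<beta>) + ln c - (1 + \<alpha>) * ln (real (n - m))"
        using \<beta> c np by (simp add: ln_mult ln_powr) (simp add: left_diff_distrib distrib_right)
      finally have "lnZ \<beta> h m x - - (h + ln (1 - \<beta>) + ln c) - (1 + \<alpha>) * ln (real (n - m)) \<le> lnZ \<beta> h m x + ln (R m (n - m) x)"
        by linarith
      also have "\<dots> \<le> lnZ \<beta> h n x" using super[OF mn, of x] n by simp
      finally show "lnZ \<beta> h m x - - (h + ln (1 - \<beta>) + ln c) - (1 + \<alpha>) * ln (real (n - m)) \<le> lnZ \<beta> h n x" .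
    qed (use \<alpha>_pos n0 in auto)
  qed
  then have "AE x in M. (\<lambda>N. 1 / real N * lnZ \<beta> h N x) \<longlonglongrightarrow> f" by simp
  then show ?thesis using f(2) int unfolding s_def by blast
qed

end

subsection \<open>Localization\<close>

lemma powr_diff_le:
  fixes x z s :: real
  assumes "0 \<le> x" "0 \<le> z" "0 < s" "s \<le> 1"
  shows "\<bar>z powr s - x powr s\<bar> \<le> \<bar>z - x\<bar> powr s"
proof -
  have *: "z powr s - x powr s \<le> \<bar>z - x\<bar> powr s \<and> 0 \<le> z powr s - x powr s" if "0 \<le> x" "x \<le> z" for x z :: real
    using powr_add_le[of x "z - x" s] powr_mono2[of s x z] that assms by simp
  show ?thesis
  proof (cases "x \<le> z")
    case True
    then show ?thesis using *[of x z] assms by simp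
  next
    case False
    then show ?thesis using *[of z x] assms by (simp add: abs_minus_commute)
  qed
qed

text \<open>The derivative of \<open>\<bar>x\<bar>\<^sup>p\<close> is Hoelder continuous of exponent \<open>p - 1\<close>.\<close>

lemma abs_powr_add_le:
  fixes x y p :: real
  assumes p: "1 < p" "p \<le> 2"
  shows "\<bar>x + y\<bar> powr p \<le> \<bar>x\<bar> powr p + p * sgn x * \<bar>x\<bar> powr (p - 1) * y + 2 * p * \<bar>y\<bar> powr p"
proof -
  have *: "\<bar>x + y\<bar> powr p \<le> x powr p + p * x powr (p - 1) * y + 2 * p * \<bar>y\<bar> powr p" if x: "0 \<le> x" for x y :: real
  proof (cases "0 \<le> x + y")
    case False
    \<comment> \<open>Here y < -x <= 0, so |y| dominates both x and |x + y|; the first-order term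
      and the left-hand side each use up one p |y|^p.\<close>
    have "x powr (p - 1) * \<bar>y\<bar> \<le> \<bar>y\<bar> powr (p - 1) * \<bar>y\<bar>"
      using False x p by (intro mult_right_mono powr_mono2) auto
    also have "\<dots> = \<bar>y\<bar> powr p" using False x by (simp add: powr_diff)
    finally have 1: "p * (x powr (p - 1) * \<bar>y\<bar>) \<le> p * \<bar>y\<bar> powr p" using p by (intro mult_left_mono) auto
    have "\<bar>x + y\<bar> powr p \<le> 1 * \<bar>y\<bar> powr p" using False x p by (simp add: powr_mono2)
    also have "\<dots> \<le> p * \<bar>y\<bar> powr p" using p by (intro mult_right_mono) auto
    finally have 2: "\<bar>x + y\<bar> powr p \<le> p * \<bar>y\<bar> powr p" .
    have "p * x powr (p - 1) * y = - (p * (x powr (p - 1) * \<bar>y\<bar>))" using False x by simp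
    moreover have "2 * p * \<bar>y\<bar> powr p = p * \<bar>y\<bar> powr p + p * \<bar>y\<bar> powr p" by simp
    moreover have "0 \<le> x powr p" by simp
    ultimately show ?thesis using 1 2 by linarith
  next
    case True
    have mvt: "\<exists>z. l < z \<and> z < u \<and> u powr p - l powr p = (u - l) * (p * z powr (p - 1))"
      if "0 \<le> l" "l < u" for l u :: real
    proof -
      have cont: "continuous_on {l..u} (\<lambda>x. x powr p)"
        using that p by (intro continuous_on_powr' continuous_intros) auto
      have der: "((\<lambda>x. x powr p) has_derivative (\<lambda>h. h * (p * z powr (p - 1)))) (at z)" if "l < z" "z < u" for z
      proof -
        have "(*) (p * z powr (p - 1)) = (\<lambda>h. h * (p * z powr (p - 1)))" by (simp add: fun_eq_iff)
        then show ?thesis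
          using that \<open>0 \<le> l\<close> has_real_derivative_powr[of z p] by (simp only: has_field_derivative_def)
      qed
      obtain z where "l < z" "z < u" "u powr p - l powr p = (u - l) * (p * z powr (p - 1))"
        by (rule mvt[OF \<open>l < u\<close> cont der])
      then show ?thesis by blast
    qed
    have "\<exists>z\<ge>0. \<bar>z - x\<bar> \<le> \<bar>y\<bar> \<and> (x + y) powr p - x powr p = y * (p * z powr (p - 1))"
    proof (cases y "0::real" rule: linorder_cases)
      case equal
      then show ?thesis using x by (intro exI[of _ x]) auto
    next
      case greater
      then obtain z where "x < z" "z < x + y" "(x + y) powr p - x powr p = (x + y - x) * (p * z powr (p - 1))"
        using mvt[of x "x + y"] x by auto
      then show ?thesis using x by (intro exI[of _ z]) auto
    next
      case less
      then obtain z where "x + y < z" "z < x" "x powr p - (x + y) powr p = (x - (x + y)) * (p * z powr (p - 1))"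
        using mvt[of "x + y" x] True by auto
      then show ?thesis using True less by (intro exI[of _ z]) auto
    qed
    then obtain z where z: "0 \<le> z" "\<bar>z - x\<bar> \<le> \<bar>y\<bar>" "(x + y) powr p - x powr p = y * (p * z powr (p - 1))" by blast
    have "y * (z powr (p - 1) - x powr (p - 1)) \<le> \<bar>y\<bar> * \<bar>z powr (p - 1) - x powr (p - 1)\<bar>"
      by (simp add: abs_mult[symmetric])
    also have "\<dots> \<le> \<bar>y\<bar> * \<bar>y\<bar> powr (p - 1)"
      using z x p by (intro mult_left_mono order_trans[OF powr_diff_le] powr_mono2) auto
    also have "\<dots> = \<bar>y\<bar> powr p" by (cases "y = 0") (simp_all add: powr_diff)
    finally have "p * (y * (z powr (p - 1) - x powr (p - 1))) \<le> p * \<bar>y\<bar> powr p" using p by (intro mult_left_mono) auto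
    moreover have "p * \<bar>y\<bar> powr p \<le> 2 * p * \<bar>y\<bar> powr p" using p by (intro mult_right_mono) auto
    ultimately show ?thesis using z(3) True by (simp add: algebra_simps)
  qed
  show ?thesis
  proof (cases "0 \<le> x")
    case True
    then show ?thesis using *[OF True, of y] by (cases "x = 0") (use p in auto)
  next
    case False
    have "\<bar>- x + - y\<bar> = \<bar>x + y\<bar>" by simp
    then show ?thesis using *[of "- x" "- y"] False by simp
  qed
qed

section \<open>Expansion of the free partition function around the pure renewal\<close>

context renewal_kernel
begin

text \<open>The pinned partition function without the weight of its final contact. It does not see
  the disorder at \<open>n\<close>, which creates the martingale structure.\<close>

definition Y :: "(nat \<Rightarrow> real) \<Rightarrow> nat \<Rightarrow> real" where "Y \<xi> n = (\<Sum>i<n. Z \<xi> i * K (n - i))"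

text \<open>The endpoint is unconstrained: \<open>n\<close> is the last contact up to
  \<open>N\<close>, and the gap after it passes beyond \<open>N\<close>.\<close>

definition free :: "(nat \<Rightarrow> real) \<Rightarrow> nat \<Rightarrow> real" where "free \<xi> N = (\<Sum>n\<le>N. Z \<xi> n * T (N - n))"

lemma Z_eq_Y: "0 < n \<Longrightarrow> Z \<xi> n = \<xi> n * Y \<xi> n"
  by (simp add: Z_rec Y_def)

lemma Y_nonneg: "(\<And>i. 0 \<le> \<xi> i) \<Longrightarrow> 0 \<le> Y \<xi> n"
  unfolding Y_def by (intro sum_nonneg mult_nonneg_nonneg Z_nonneg K_nonneg)

lemma sum_triangle:
  fixes f :: "nat \<Rightarrow> nat \<Rightarrow> real"
  shows "(\<Sum>n\<le>N. \<Sum>m=1..n. f m n) = (\<Sum>m=1..N. \<Sum>n=m..N. f m n)"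
  unfolding sum.Sigma[OF finite_atMost ballI[OF finite_atLeastAtMost]]
    sum.Sigma[OF finite_atLeastAtMost ballI[OF finite_atLeastAtMost]]
  by (rule sum.reindex_bij_witness[of _ "\<lambda>(b,c). (c,b)" "\<lambda>(b,c). (c,b)"]) auto

text \<open>Every weight is expanded as 1 + (\<xi> m - 1), and the terms are sorted by the last site
  \<open>m\<close> at which the second summand is chosen; beyond it the trajectory is a pure renewal
  of mass \<open>u (n - m)\<close>.\<close>

lemma Y_expansion:
  assumes "0 < n"
  shows "Y \<xi> n = u n + (\<Sum>m=1..n-1. (\<xi> m - 1) * Y \<xi> m * u (n - m))"
  using assms
proof (induction n rule: less_induct)
  case (less n)
  have IH: "Z \<xi> i = u i + (\<Sum>m=1..i. (\<xi> m - 1) * Y \<xi> m * u (i - m))" if "i < n" for i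
  proof (cases "i = 0")
    case False
    have z: "Z \<xi> i = Y \<xi> i + (\<xi> i - 1) * Y \<xi> i * u (i - i)"
      using False by (simp add: Z_eq_Y algebra_simps)
    have y: "Y \<xi> i = u i + (\<Sum>m=1..i-1. (\<xi> m - 1) * Y \<xi> m * u (i - m))"
      using False that by (intro less.IH) auto
    have "Z \<xi> i = u i + (\<Sum>m=1..i-1. (\<xi> m - 1) * Y \<xi> m * u (i - m)) + (\<xi> i - 1) * Y \<xi> i * u (i - i)"
      using z y by linarith
    also have "u i + (\<Sum>m=1..i-1. (\<xi> m - 1) * Y \<xi> m * u (i - m)) + (\<xi> i - 1) * Y \<xi> i * u (i - i)
        = u i + (\<Sum>m=1..i. (\<xi> m - 1) * Y \<xi> m * u (i - m))"
    proof -
      obtain j where "i = Suc j" using False by (cases i) auto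
      then show ?thesis by simp
    qed
    finally show ?thesis .
  qed simp
  obtain l where l: "n = Suc l" using less.prems by (cases n) auto
  have "Y \<xi> n = (\<Sum>i\<le>l. Z \<xi> i * K (n - i))" by (simp add: Y_def l lessThan_Suc_atMost)
  also have "\<dots> = (\<Sum>i\<le>l. u i * K (n - i) + (\<Sum>m=1..i. (\<xi> m - 1) * Y \<xi> m * (u (i - m) * K (n - i))))"
  proof (intro sum.cong refl)
    fix i assume "i \<in> {..l}"
    then have "Z \<xi> i = u i + (\<Sum>m=1..i. (\<xi> m - 1) * Y \<xi> m * u (i - m))" by (intro IH) (simp add: l)
    then show "Z \<xi> i * K (n - i) = u i * K (n - i) + (\<Sum>m=1..i. (\<xi> m - 1) * Y \<xi> m * (u (i - m) * K (n - i)))"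
      by (simp only: distrib_right sum_distrib_right mult.assoc)
  qed
  also have "\<dots> = (\<Sum>i\<le>l. u i * K (n - i)) + (\<Sum>m=1..l. \<Sum>i=m..l. (\<xi> m - 1) * Y \<xi> m * (u (i - m) * K (n - i)))"
    by (simp only: sum.distrib sum_triangle)
  also have "(\<Sum>i\<le>l. u i * K (n - i)) = u n"
    using Z_rec[of n "\<lambda>_. 1"] unfolding l lessThan_Suc_atMost by simp
  also have "(\<Sum>m=1..l. \<Sum>i=m..l. (\<xi> m - 1) * Y \<xi> m * (u (i - m) * K (n - i)))
      = (\<Sum>m=1..l. (\<xi> m - 1) * Y \<xi> m * u (n - m))"
  proof (intro sum.cong refl)
    fix m assume m: "m \<in> {1..l}"
    have "(\<Sum>i=m..l. u (i - m) * K (n - i)) = (\<Sum>i<n-m. u i * K (n - m - i))"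
      by (rule sum.reindex_bij_witness[of _ "\<lambda>i. i + m" "\<lambda>i. i - m"]) (use m l in \<open>auto simp: algebra_simps\<close>)
    also have "\<dots> = u (n - m)"
    proof -
      have p: "0 < n - m" using m l by auto
      show ?thesis by (simp add: Z_rec[OF p])
    qed
    finally show "(\<Sum>i=m..l. (\<xi> m - 1) * Y \<xi> m * (u (i - m) * K (n - i))) = (\<xi> m - 1) * Y \<xi> m * u (n - m)"
      by (simp only: sum_distrib_left[symmetric])
  qed
  finally show ?case by (simp add: l)
qed

lemma Z_expansion: "Z \<xi> n = u n + (\<Sum>m=1..n. (\<xi> m - 1) * Y \<xi> m * u (n - m))"
proof (cases n)
  case (Suc j)
  have "Z \<xi> n = Y \<xi> n + (\<xi> n - 1) * Y \<xi> n * u (n - n)"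
    using Suc by (simp add: Z_eq_Y algebra_simps)
  then show ?thesis using Y_expansion[of n \<xi>] Suc by simp
qed simp

text \<open>Beyond the last marked site the unconstrained pure renewal has total mass 1 by
  \<open>u_T\<close>. At h = 0 the summands are centred given the past, so \<open>free\<close> is a
  martingale with mean 1.\<close>

lemma free_expansion: "free \<xi> N = 1 + (\<Sum>m=1..N. (\<xi> m - 1) * Y \<xi> m)"
proof -
  have "free \<xi> N = (\<Sum>n\<le>N. u n * T (N - n) + (\<Sum>m=1..n. (\<xi> m - 1) * Y \<xi> m * (u (n - m) * T (N - n))))"
    unfolding free_def
    by (intro sum.cong refl, subst Z_expansion) (simp only: distrib_right sum_distrib_right mult.assoc)
  also have "\<dots> = (\<Sum>n\<le>N. u n * T (N - n)) + (\<Sum>m=1..N. \<Sum>n=m..N. (\<xi> m - 1) * Y \<xi> m * (u (n - m) * T (N - n)))"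
    by (simp only: sum.distrib sum_triangle)
  also have "(\<Sum>m=1..N. \<Sum>n=m..N. (\<xi> m - 1) * Y \<xi> m * (u (n - m) * T (N - n))) = (\<Sum>m=1..N. (\<xi> m - 1) * Y \<xi> m)"
  proof (intro sum.cong refl)
    fix m assume m: "m \<in> {1..N}"
    have "(\<Sum>n=m..N. u (n - m) * T (N - n)) = (\<Sum>n\<le>N-m. u n * T (N - m - n))"
      by (rule sum.reindex_bij_witness[of _ "\<lambda>i. i + m" "\<lambda>i. i - m"]) (use m in \<open>auto simp: algebra_simps\<close>)
    then show "(\<Sum>n=m..N. (\<xi> m - 1) * Y \<xi> m * (u (n - m) * T (N - n))) = (\<xi> m - 1) * Y \<xi> m"
      by (simp only: sum_distrib_left[symmetric] u_T mult_1_right)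
  qed
  finally show ?thesis by (simp only: u_T)
qed

text \<open>The share of \<open>free\<close> carried by trajectories with fewer than
  \<open>L\<close> contacts up to \<open>N\<close>.\<close>

definition low :: "(nat \<Rightarrow> real) \<Rightarrow> nat \<Rightarrow> nat \<Rightarrow> real" where
  "low \<xi> L N = (\<Sum>k<L. \<Sum>n\<le>N. W \<xi> k n * T (N - n))"

text \<open>Multiplying all weights by c >= 1 multiplies a trajectory with at least L contacts by at
  least c^L. In the application c = e^h.\<close>

lemma free_minus_low_le:
  assumes \<xi>: "\<And>i. 0 \<le> \<xi> i" and c: "1 \<le> c"
  shows "c ^ L * (free \<xi> N - low \<xi> L N) \<le> free (\<lambda>i. c * \<xi> i) N"
proof -
  have "free \<xi> N = (\<Sum>k\<le>N. \<Sum>n\<le>N. W \<xi> k n * T (N - n))"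
    unfolding free_def by (subst sum.swap) (auto simp: Z_eq_sum[of _ N] sum_distrib_right intro!: sum.cong)
  also have "\<dots> \<le> (\<Sum>k\<in>{..N} \<union> {..<L}. \<Sum>n\<le>N. W \<xi> k n * T (N - n))"
    by (intro sum_mono2 sum_nonneg mult_nonneg_nonneg W_nonneg T_nonneg \<xi>) auto
  also have "\<dots> = low \<xi> L N + (\<Sum>k\<in>{L..N}. \<Sum>n\<le>N. W \<xi> k n * T (N - n))"
  proof -
    have s: "{..N} \<union> {..<L} = {..<L} \<union> {L..N}" by auto
    show ?thesis unfolding s low_def by (rule sum.union_disjoint) auto
  qed
  finally have "c ^ L * (free \<xi> N - low \<xi> L N) \<le> c ^ L * (\<Sum>k\<in>{L..N}. \<Sum>n\<le>N. W \<xi> k n * T (N - n))"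
    using c by (intro mult_left_mono) auto
  also have "\<dots> \<le> (\<Sum>k\<in>{L..N}. c ^ k * (\<Sum>n\<le>N. W \<xi> k n * T (N - n)))"
    unfolding sum_distrib_left using c
    by (intro sum_mono mult_right_mono mult_nonneg_nonneg W_nonneg T_nonneg \<xi> power_increasing) auto
  also have "\<dots> \<le> (\<Sum>k\<le>N. c ^ k * (\<Sum>n\<le>N. W \<xi> k n * T (N - n)))"
    using c by (intro sum_mono2 mult_nonneg_nonneg sum_nonneg W_nonneg T_nonneg \<xi>) auto
  also have "\<dots> = (\<Sum>k\<le>N. \<Sum>n\<le>N. W (\<lambda>i. c * \<xi> i) k n * T (N - n))"
    by (simp only: sum_distrib_left W_scale mult.assoc)
  also have "\<dots> = free (\<lambda>i. c * \<xi> i) N"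
    unfolding free_def by (subst sum.swap) (auto simp: Z_eq_sum[of _ N] sum_distrib_right intro!: sum.cong)
  finally show ?thesis .
qed

text \<open>From the last contact up to \<open>N\<close> a single gap of length between N and 2N
  reaches the endpoint. Its price is a power of N, which a sufficiently large free partition
  function outweighs.\<close>

lemma free_le_pinned:
  assumes \<xi>: "\<And>i. 0 \<le> \<xi> i" and N: "1 \<le> N" and c: "0 \<le> c" "\<And>n. N \<le> n \<Longrightarrow> n \<le> 2 * N \<Longrightarrow> c \<le> K n"
  shows "\<xi> (2 * N) * c * free \<xi> N \<le> Z \<xi> (2 * N)"
proof -
  have Znn: "0 \<le> Z \<xi> n" for n by (intro Z_nonneg \<xi>)
  have "\<xi> (2 * N) * c * free \<xi> N = \<xi> (2 * N) * (\<Sum>n\<le>N. Z \<xi> n * (c * T (N - n)))"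
    by (simp add: free_def sum_distrib_left mult_ac)
  also have "\<dots> \<le> \<xi> (2 * N) * (\<Sum>n\<le>N. Z \<xi> n * K (2 * N - n))"
  proof (intro mult_left_mono sum_mono \<xi> Znn)
    fix n assume "n \<in> {..N}"
    then have "c \<le> K (2 * N - n)" by (intro c(2)) auto
    moreover have "c * T (N - n) \<le> c * 1" by (intro mult_left_mono T_le_1 c(1))
    ultimately show "c * T (N - n) \<le> K (2 * N - n)" by simp
  qed
  also have "\<dots> \<le> \<xi> (2 * N) * (\<Sum>n<2*N. Z \<xi> n * K (2 * N - n))"
    using N by (intro mult_left_mono \<xi> sum_mono2 mult_nonneg_nonneg Znn K_nonneg) auto
  also have "\<dots> = Z \<xi> (2 * N)" using N by (simp add: Z_rec[of "2 * N"])
  finally show ?thesis .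
qed

end

section \<open>Moments at h = 0\<close>

context pinning
begin

lemma measurable_Y_wt: "(\<lambda>y. Y (wt \<beta> h y) m) \<in> borel_measurable seq_space"
  unfolding Y_def by (intro borel_measurable_sum borel_measurable_times measurable_Z_wt borel_measurable_const)

lemma depends_Y: "depends_on {1..m - 1} (\<lambda>y. Y (wt \<beta> h y) m)"
proof (rule depends_onI)
  fix y y' :: "nat \<Rightarrow> real" assume *: "\<And>i. i \<in> {1..m - 1} \<Longrightarrow> y i = y' i"
  show "Y (wt \<beta> h y) m = Y (wt \<beta> h y') m"
    unfolding Y_def
  proof (intro sum.cong refl arg_cong2[where f = "(*)"])
    fix i assume "i \<in> {..<m}"
    then have "Z (wt \<beta> h y) i = Z (wt \<beta> h y') i"
      by (intro Z_cong) (auto simp: wt_def *)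
    then show "Z (wt \<beta> h y) i = Z (wt \<beta> h y') i" .
  qed
qed

lemma Y_wt_nonneg: "0 \<le> \<beta> \<Longrightarrow> \<beta> \<le> 1 \<Longrightarrow> 0 \<le> Y (wt \<beta> h (env x)) m"
  by (intro Y_nonneg wt_nonneg)

text \<open>A von Bahr--Esseen bound: the summands are martingale differences because \<open>Y\<^sub>m\<close> only
  depends on the environment before \<open>m\<close>.\<close>

lemma martingale_moment:
  fixes cf :: "nat \<Rightarrow> real" and c0 \<beta> :: real
  defines "Sm n y \<equiv> c0 + (\<Sum>m=1..n. cf m * (y m * Y (wt \<beta> 0 y) m))"
  assumes p: "1 < p" "p < \<gamma>" and \<beta>: "0 \<le> \<beta>" "\<beta> \<le> 1"
    and int: "\<And>m. 1 \<le> m \<Longrightarrow> m \<le> n \<Longrightarrow> integrable M (\<lambda>x. Y (wt \<beta> 0 (env x)) m powr p)"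
  shows "integrable M (\<lambda>x. \<bar>Sm n (env x)\<bar> powr p) \<and>
    expectation (\<lambda>x. \<bar>Sm n (env x)\<bar> powr p) \<le> \<bar>c0\<bar> powr p +
      2 * p * (\<integral>y. \<bar>y\<bar> powr p \<partial>D) * (\<Sum>m=1..n. \<bar>cf m\<bar> powr p * expectation (\<lambda>x. Y (wt \<beta> 0 (env x)) m powr p))"
  using int
proof (induction n)
  case 0
  then show ?case by (simp add: Sm_def prob_space)
next
  case (Suc n)
  let ?B = "\<integral>y. \<bar>y\<bar> powr p \<partial>D"
  let ?c = "cf (Suc n)"
  let ?Y = "\<lambda>x. Y (wt \<beta> 0 (env x)) (Suc n)"
  have p2: "p \<le> 2" using p \<gamma>_range by simp
  have Ynn: "0 \<le> ?Y x" for x by (rule Y_wt_nonneg[OF \<beta>])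
  have IH: "integrable M (\<lambda>x. \<bar>Sm n (env x)\<bar> powr p)"
    "expectation (\<lambda>x. \<bar>Sm n (env x)\<bar> powr p) \<le> \<bar>c0\<bar> powr p +
      2 * p * ?B * (\<Sum>m=1..n. \<bar>cf m\<bar> powr p * expectation (\<lambda>x. Y (wt \<beta> 0 (env x)) m powr p))"
    using Suc.IH Suc.prems by auto
  have intY: "integrable M (\<lambda>x. ?Y x powr p)" by (rule Suc.prems) auto
  have mS: "Sm k \<in> borel_measurable seq_space" for k
    unfolding Sm_def
    by (intro borel_measurable_add borel_measurable_sum borel_measurable_times borel_measurable_const
        measurable_coordinate measurable_Y_wt)
  have dS: "depends_on {1..n} (Sm n)"
  proof (rule depends_onI)
    fix y y' :: "nat \<Rightarrow> real" assume *: "\<And>i. i \<in> {1..n} \<Longrightarrow> y i = y' i"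
    show "Sm n y = Sm n y'"
      unfolding Sm_def
    proof (intro arg_cong2[where f = "(+)"] refl sum.cong arg_cong2[where f = "(*)"])
      fix m assume m: "m \<in> {1..n}"
      then show "y m = y' m" by (rule *)
      show "Y (wt \<beta> 0 y) m = Y (wt \<beta> 0 y') m"
        by (rule depends_onD[OF depends_Y]) (use m * in auto)
    qed
  qed
  have dY: "depends_on {1..n} (\<lambda>y. Y (wt \<beta> 0 y) (Suc n))" using depends_Y[of "Suc n" \<beta> 0] by simp
  have mY: "(\<lambda>y. Y (wt \<beta> 0 y) (Suc n)) \<in> borel_measurable seq_space" by (rule measurable_Y_wt)
  have int\<omega>: "integrable M (\<lambda>x. \<bar>env x (Suc n)\<bar> powr p)" and E\<omega>: "expectation (\<lambda>x. \<bar>env x (Suc n)\<bar> powr p) = ?B"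
    using integral_identical[of "\<lambda>y. \<bar>y\<bar> powr p" "Suc n"] \<omega>_moment[of p] p by (auto simp: env_def)
  have ind1: "indep_var borel (\<lambda>x. \<bar>env x (Suc n)\<bar> powr p) borel (\<lambda>x. ?Y x powr p)"
  proof (rule indep_depends_on[where A = "{Suc n}" and B = "{1..n}"])
    show "(\<lambda>y. \<bar>y (Suc n)\<bar> powr p) \<in> borel_measurable seq_space"
      by (rule measurable_compose[OF measurable_coordinate]) measurable
    show "depends_on {Suc n} (\<lambda>y. \<bar>y (Suc n)\<bar> powr p)" by (rule depends_onI) simp
    show "(\<lambda>y. Y (wt \<beta> 0 y) (Suc n) powr p) \<in> borel_measurable seq_space" using mY by measurable
    show "depends_on {1..n} (\<lambda>y. Y (wt \<beta> 0 y) (Suc n) powr p)"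
      by (rule depends_onI, rule arg_cong[where f = "\<lambda>z. z powr p"], rule depends_onD[OF dY])
  qed simp
  let ?v = "\<lambda>x. ?c * (env x (Suc n) * ?Y x)"
  have v_eq: "\<bar>?v x\<bar> powr p = \<bar>?c\<bar> powr p * (\<bar>env x (Suc n)\<bar> powr p * ?Y x powr p)" for x
    using Ynn[of x] by (simp add: abs_mult powr_mult)
  have int_v: "integrable M (\<lambda>x. \<bar>?v x\<bar> powr p)"
    unfolding v_eq by (intro integrable_mult_right indep_var_integrable[OF ind1 int\<omega> intY])
  have E_v: "expectation (\<lambda>x. \<bar>?v x\<bar> powr p) = \<bar>?c\<bar> powr p * (?B * expectation (\<lambda>x. ?Y x powr p))"
    unfolding v_eq using indep_var_lebesgue_integral[OF ind1 int\<omega> intY] by (simp add: E\<omega>)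
  \<comment> \<open>The first-order term of \<open>abs_powr_add_le\<close> without the disorder at
    \<open>Suc n\<close>. It depends on the first \<open>n\<close> sites only, so its product with
    that centred variable has mean 0.\<close>
  define Q where "Q y = p * sgn (Sm n y) * \<bar>Sm n y\<bar> powr (p - 1) * (?c * Y (wt \<beta> 0 y) (Suc n))" for y
  have mQ: "Q \<in> borel_measurable seq_space"
    unfolding Q_def using mS[of n] mY by measurable
  have dQ: "depends_on {1..n} Q"
  proof (rule depends_onI)
    fix y y' :: "nat \<Rightarrow> real" assume *: "\<And>i. i \<in> {1..n} \<Longrightarrow> y i = y' i"
    have "Sm n y = Sm n y'" by (rule depends_onD[OF dS *])
    moreover have "Y (wt \<beta> 0 y) (Suc n) = Y (wt \<beta> 0 y') (Suc n)" by (rule depends_onD[OF dY *])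
    ultimately show "Q y = Q y'" by (simp only: Q_def)
  qed
  have mQM: "(\<lambda>x. Q (env x)) \<in> borel_measurable M" by (rule measurable_compose[OF measurable_env mQ])
  have intQ: "integrable M (\<lambda>x. Q (env x))"
  proof (rule Bochner_Integration.integrable_bound[OF _ mQM])
    show "integrable M (\<lambda>x. p * \<bar>?c\<bar> * (\<bar>Sm n (env x)\<bar> powr p + ?Y x powr p))"
      using IH(1) intY by auto
    have Qle: "norm (Q (env x)) \<le> p * \<bar>?c\<bar> * (\<bar>Sm n (env x)\<bar> powr p + ?Y x powr p)" for x
    proof -
      let ?s = "\<bar>Sm n (env x)\<bar>"
      \<comment> \<open>Replacing both factors by their maximum shows that moments of order p
        suffice for the integrability of \<open>Q\<close>.\<close>
      have "?s powr (p - 1) * ?Y x \<le> max ?s (?Y x) powr (p - 1) * max ?s (?Y x)"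
        using p Ynn[of x] by (intro mult_mono powr_mono2) auto
      also have "\<dots> = max ?s (?Y x) powr p"
        using p by (cases "max ?s (?Y x) = 0") (auto simp: powr_diff)
      also have "\<dots> \<le> ?s powr p + ?Y x powr p" by (simp add: max_def)
      finally have le: "?s powr (p - 1) * ?Y x \<le> ?s powr p + ?Y x powr p" .
      have "norm (Q (env x)) = p * \<bar>?c\<bar> * (\<bar>sgn (Sm n (env x))\<bar> * (?s powr (p - 1) * ?Y x))"
        using p Ynn[of x] by (simp add: Q_def abs_mult)
      also have "\<dots> \<le> p * \<bar>?c\<bar> * (1 * (?s powr (p - 1) * ?Y x))"
        using p Ynn[of x] by (intro mult_left_mono mult_right_mono) (auto simp: sgn_if)
      also have "\<dots> \<le> p * \<bar>?c\<bar> * (?s powr p + ?Y x powr p)"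
        using p le by (intro mult_left_mono) auto
      finally show ?thesis .
    qed
    show "AE x in M. norm (Q (env x)) \<le> norm (p * \<bar>?c\<bar> * (\<bar>Sm n (env x)\<bar> powr p + ?Y x powr p))"
      by (rule AE_I2, rule order_trans[OF Qle], subst real_norm_def, rule abs_ge_self)
  qed
  have ind2: "indep_var borel (\<lambda>x. Q (env x)) borel (\<lambda>x. env x (Suc n))"
    by (rule indep_depends_on[OF mQ dQ measurable_coordinate, where B = "{Suc n}"]) (auto intro: depends_onI)
  have int\<omega>1: "integrable M (\<lambda>x. env x (Suc n))" "expectation (\<lambda>x. env x (Suc n)) = 0"
    using integrable_\<omega>[of "Suc n"] mean_\<omega>[of "Suc n"] by (simp_all add: env_def)
  have intQ\<omega>: "integrable M (\<lambda>x. Q (env x) * env x (Suc n))"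
    by (rule indep_var_integrable[OF ind2 intQ int\<omega>1(1)])
  have EQ\<omega>: "expectation (\<lambda>x. Q (env x) * env x (Suc n)) = 0"
    using indep_var_lebesgue_integral[OF ind2 intQ int\<omega>1(1)] by (simp add: int\<omega>1(2))
  have split: "Sm (Suc n) (env x) = Sm n (env x) + ?v x" for x by (simp add: Sm_def)
  let ?R = "\<lambda>x. \<bar>Sm n (env x)\<bar> powr p + Q (env x) * env x (Suc n) + 2 * p * \<bar>?v x\<bar> powr p"
  have le: "\<bar>Sm (Suc n) (env x)\<bar> powr p \<le> ?R x" for x
    unfolding split using abs_powr_add_le[OF p(1) p2, of "Sm n (env x)" "?v x"] by (simp add: Q_def mult_ac)
  have intR: "integrable M ?R" using IH(1) intQ\<omega> int_v by (intro Bochner_Integration.integrable_add integrable_mult_right)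
  have mSM: "(\<lambda>x. \<bar>Sm (Suc n) (env x)\<bar> powr p) \<in> borel_measurable M"
    using measurable_compose[OF measurable_env mS[of "Suc n"]] by measurable
  have int': "integrable M (\<lambda>x. \<bar>Sm (Suc n) (env x)\<bar> powr p)"
  proof (rule Bochner_Integration.integrable_bound[OF intR mSM], rule AE_I2)
    fix x show "norm (\<bar>Sm (Suc n) (env x)\<bar> powr p) \<le> norm (?R x)"
      using le[of x] by simp
  qed
  have "expectation (\<lambda>x. \<bar>Sm (Suc n) (env x)\<bar> powr p) \<le> expectation ?R"
    by (rule integral_mono[OF int' intR le])
  also have "\<dots> = expectation (\<lambda>x. \<bar>Sm n (env x)\<bar> powr p) + 0 + 2 * p * (\<bar>?c\<bar> powr p * (?B * expectation (\<lambda>x. ?Y x powr p)))"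
    using IH(1) intQ\<omega> int_v by (simp only: Bochner_Integration.integral_add Bochner_Integration.integrable_add
      integrable_mult_right integral_mult_right_zero EQ\<omega> E_v)
  finally show ?case using IH(2) int' by (simp add: algebra_simps)
qed

text \<open>\<open>Y_expansion\<close> is a martingale sum with coefficients \<beta> u (n - m), so
  the moments satisfy a renewal-type inequality in terms of the earlier ones.\<close>

lemma Y_moment:
  assumes p: "1 < p" "p < \<gamma>" and \<beta>: "0 \<le> \<beta>" "\<beta> \<le> 1" and n: "1 \<le> n"
  shows "integrable M (\<lambda>x. Y (wt \<beta> 0 (env x)) n powr p) \<and>
    expectation (\<lambda>x. Y (wt \<beta> 0 (env x)) n powr p) \<le> u n powr p +
      2 * p * (\<integral>y. \<bar>y\<bar> powr p \<partial>D) * (\<Sum>m=1..n-1. (\<beta> * u (n - m)) powr p * expectation (\<lambda>x. Y (wt \<beta> 0 (env x)) m powr p))"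
  using n
proof (induction n rule: less_induct)
  case (less n)
  have eq: "Y (wt \<beta> 0 (env x)) n powr p = \<bar>u n + (\<Sum>m=1..n-1. (\<beta> * u (n - m)) * (env x m * Y (wt \<beta> 0 (env x)) m))\<bar> powr p" for x
  proof -
    have "Y (wt \<beta> 0 (env x)) n = u n + (\<Sum>m=1..n-1. (wt \<beta> 0 (env x) m - 1) * Y (wt \<beta> 0 (env x)) m * u (n - m))"
      using less.prems by (intro Y_expansion) simp
    also have "(\<Sum>m=1..n-1. (wt \<beta> 0 (env x) m - 1) * Y (wt \<beta> 0 (env x)) m * u (n - m))
        = (\<Sum>m=1..n-1. (\<beta> * u (n - m)) * (env x m * Y (wt \<beta> 0 (env x)) m))"
      by (intro sum.cong refl) (simp add: wt_def mult_ac)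
    finally show ?thesis using Y_wt_nonneg[OF \<beta>, of 0 x n] by simp
  qed
  have "integrable M (\<lambda>x. Y (wt \<beta> 0 (env x)) m powr p)" if "1 \<le> m" "m \<le> n - 1" for m
    using less.IH[of m] that less.prems by auto
  from martingale_moment[OF p \<beta> this, of "n - 1" "u n" "\<lambda>m. \<beta> * u (n - m)"]
  show ?case unfolding eq[symmetric] using \<beta> u_nonneg by simp
qed

text \<open>Summing \<open>Y_moment\<close> over n bounds the total moment E by U + (Q \<beta>^p U)
  E, where U is the sum of u^p. Smallness makes the bracket at most 1/2, so E <= 2 U;
  \<open>free_expansion\<close> is then a martingale sum with these moments.\<close>

lemma free_moment:
  assumes p: "1 < p" "p < \<gamma>" and \<beta>: "0 \<le> \<beta>" "\<beta> \<le> 1"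
    and small: "2 * p * (\<integral>y. \<bar>y\<bar> powr p \<partial>D) * \<beta> powr p * (\<Sum>n=1..N. u n powr p) \<le> 1 / 2"
  shows "integrable M (\<lambda>x. \<bar>free (wt \<beta> 0 (env x)) N - 1\<bar> powr p) \<and>
    expectation (\<lambda>x. \<bar>free (wt \<beta> 0 (env x)) N - 1\<bar> powr p)
      \<le> 4 * p * (\<integral>y. \<bar>y\<bar> powr p \<partial>D) * \<beta> powr p * (\<Sum>n=1..N. u n powr p)"
proof -
  let ?B = "\<integral>y. \<bar>y\<bar> powr p \<partial>D" and ?U = "\<Sum>n=1..N. u n powr p"
  define e where "e n = expectation (\<lambda>x. Y (wt \<beta> 0 (env x)) n powr p)" for n
  define Q where "Q = 2 * p * ?B"
  have B: "0 \<le> ?B" by simp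
  have Q: "0 \<le> Q" using p B by (simp add: Q_def)
  have e0: "0 \<le> e n" for n unfolding e_def by simp
  \<comment> \<open>Zero at j = 0, so that the sum over m may include n although
    \<open>Y_expansion\<close> stops at n - 1.\<close>
  define v where "v j = (if j = 0 then 0 else u j powr p)" for j
  have v0: "0 \<le> v j" for j by (simp add: v_def)
  have U: "(\<Sum>j\<le>N. v j) = ?U"
    by (rule sum.mono_neutral_cong_right) (auto simp: v_def)
  have en: "e n \<le> u n powr p + Q * \<beta> powr p * (\<Sum>m=1..n. e m * v (n - m))" if n: "1 \<le> n" for n
  proof -
    have "e n \<le> u n powr p + Q * (\<Sum>m=1..n-1. (\<beta> * u (n - m)) powr p * e m)"
      using Y_moment[OF p \<beta> n] unfolding e_def Q_def by blast
    also have "(\<Sum>m=1..n-1. (\<beta> * u (n - m)) powr p * e m) = (\<Sum>m=1..n-1. \<beta> powr p * (e m * v (n - m)))"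
      by (intro sum.cong refl) (auto simp: v_def powr_mult)
    also have "\<dots> = (\<Sum>m=1..n. \<beta> powr p * (e m * v (n - m)))"
      by (rule sum.mono_neutral_left) (use n in \<open>auto simp: v_def\<close>)
    finally show ?thesis by (simp add: sum_distrib_left mult_ac)
  qed
  have "(\<Sum>n=1..N. \<Sum>m=1..n. e m * v (n - m)) = (\<Sum>n\<le>N. \<Sum>m=1..n. e m * v (n - m))"
    by (rule sum.mono_neutral_left) auto
  also have "\<dots> = (\<Sum>m=1..N. \<Sum>n=m..N. e m * v (n - m))" by (rule sum_triangle)
  also have "\<dots> \<le> (\<Sum>m=1..N. e m * ?U)"
  proof (rule sum_mono)
    fix m assume m: "m \<in> {1..N}"
    have "(\<Sum>n=m..N. v (n - m)) = (\<Sum>j\<le>N-m. v j)"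
      by (rule sum.reindex_bij_witness[of _ "\<lambda>i. i + m" "\<lambda>i. i - m"]) (use m in auto)
    also have "\<dots> \<le> (\<Sum>j\<le>N. v j)" by (intro sum_mono2 v0) auto
    finally show "(\<Sum>n=m..N. e m * v (n - m)) \<le> e m * ?U"
      unfolding U sum_distrib_left[symmetric] by (intro mult_left_mono e0)
  qed
  finally have dbl: "(\<Sum>n=1..N. \<Sum>m=1..n. e m * v (n - m)) \<le> (\<Sum>m=1..N. e m) * ?U"
    by (simp add: sum_distrib_right)
  let ?E = "\<Sum>m=1..N. e m"
  have E0: "0 \<le> ?E" by (intro sum_nonneg e0)
  have "?E \<le> (\<Sum>n=1..N. u n powr p + Q * \<beta> powr p * (\<Sum>m=1..n. e m * v (n - m)))"
    by (intro sum_mono en) auto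
  also have "\<dots> = ?U + Q * \<beta> powr p * (\<Sum>n=1..N. \<Sum>m=1..n. e m * v (n - m))"
    by (simp only: sum.distrib sum_distrib_left)
  also have "\<dots> \<le> ?U + Q * \<beta> powr p * (?E * ?U)"
    using Q by (intro add_left_mono mult_left_mono dbl) auto
  also have "Q * \<beta> powr p * (?E * ?U) = (Q * \<beta> powr p * ?U) * ?E" by (simp only: mult_ac)
  also have "\<dots> \<le> 1 / 2 * ?E" using small E0 by (intro mult_right_mono) (simp_all add: Q_def)
  finally have E2: "?E \<le> 2 * ?U" by linarith
  have eq: "\<bar>free (wt \<beta> 0 (env x)) N - 1\<bar> powr p = \<bar>0 + (\<Sum>m=1..N. \<beta> * (env x m * Y (wt \<beta> 0 (env x)) m))\<bar> powr p" for x
    unfolding free_expansion by (simp add: wt_def mult_ac)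
  have intY: "integrable M (\<lambda>x. Y (wt \<beta> 0 (env x)) m powr p)" if "1 \<le> m" "m \<le> N" for m
    using Y_moment[OF p \<beta> that(1)] by blast
  note mm = martingale_moment[OF p \<beta> intY, of N 0 "\<lambda>_. \<beta>", folded eq]
  have "expectation (\<lambda>x. \<bar>free (wt \<beta> 0 (env x)) N - 1\<bar> powr p) \<le> Q * (\<Sum>m=1..N. \<beta> powr p * e m)"
    using mm \<beta> unfolding Q_def e_def by simp
  also have "\<dots> = Q * \<beta> powr p * ?E" by (simp add: sum_distrib_left mult_ac)
  also have "\<dots> \<le> Q * \<beta> powr p * (2 * ?U)" using Q by (intro mult_left_mono E2) auto
  finally have "expectation (\<lambda>x. \<bar>free (wt \<beta> 0 (env x)) N - 1\<bar> powr p) \<le> 4 * p * ?B * \<beta> powr p * ?U"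
    by (simp add: Q_def mult_ac)
  then show ?thesis using mm by simp
qed

lemma W_mean:
  assumes \<beta>: "0 \<le> \<beta>" "\<beta> \<le> 1"
  shows "integrable M (\<lambda>x. W (wt \<beta> 0 (env x)) k n) \<and> expectation (\<lambda>x. W (wt \<beta> 0 (env x)) k n) \<le> kap k n"
proof -
  let ?W = "\<lambda>x. W (wt \<beta> 0 (env x)) k n"
  have nn: "0 \<le> ?W x" for x by (rule W_wt_nonneg[OF \<beta>])
  have m: "?W \<in> borel_measurable M" by (rule measurable_compose[OF measurable_env measurable_W_wt])
  have le: "(\<integral>\<^sup>+x. ennreal (?W x) \<partial>M) \<le> ennreal (kap k n)"
    using tilted_W_le[of "\<lambda>_. 1" \<beta> 1 0 n k] mean_weight_le[OF \<beta>, of 0] \<beta> by simp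
  have int: "integrable M ?W"
    by (rule integrableI_nonneg[OF m]) (use nn le in \<open>auto intro: le_less_trans\<close>)
  have "ennreal (expectation ?W) \<le> ennreal (kap k n)"
    using le nn_integral_eq_integral[OF int] nn by simp
  then show ?thesis using int kap_nonneg[of k n] by (simp add: ennreal_le_iff)
qed

text \<open>By \<open>kap_T_sum\<close> the bound is the probability that fewer than
  \<open>L\<close> contacts occur up to \<open>N\<close>, which \<open>S_lower\<close> makes
  small.\<close>

lemma low_mean:
  assumes \<beta>: "0 \<le> \<beta>" "\<beta> \<le> 1"
  shows "integrable M (\<lambda>x. low (wt \<beta> 0 (env x)) L N) \<and> expectation (\<lambda>x. low (wt \<beta> 0 (env x)) L N) \<le> 1 - S L N"
proof -
  have int: "integrable M (\<lambda>x. W (wt \<beta> 0 (env x)) k n * T (N - n))" for k n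
    using W_mean[OF \<beta>, of k n] by auto
  have "expectation (\<lambda>x. low (wt \<beta> 0 (env x)) L N) = (\<Sum>k<L. \<Sum>n\<le>N. expectation (\<lambda>x. W (wt \<beta> 0 (env x)) k n) * T (N - n))"
    unfolding low_def using int by (simp add: Bochner_Integration.integral_sum)
  also have "\<dots> \<le> (\<Sum>k<L. \<Sum>n\<le>N. kap k n * T (N - n))"
    using W_mean[OF \<beta>] by (intro sum_mono mult_right_mono T_nonneg) auto
  finally show ?thesis using int unfolding low_def kap_T_sum by auto
qed

text \<open>If mass 1/4 sits on trajectories with at least \<open>L\<close> contacts, switching on h
  multiplies it by e^(h L), and pinning at 2N costs only a power of N.\<close>

lemma lnZ_good_bound:
  assumes \<beta>: "0 \<le> \<beta>" "\<beta> < 1" and h: "0 \<le> h" and n0: "1 \<le> n0" and c: "0 < c"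
    and K_lo: "\<And>n. n0 \<le> n \<Longrightarrow> c * real n powr (- (1 + \<alpha>)) \<le> K n" and N: "n0 \<le> N"
    and good: "1 / 4 \<le> free (wt \<beta> 0 (env x)) N - low (wt \<beta> 0 (env x)) L N"
  shows "ln (1 - \<beta>) + ln c - (1 + \<alpha>) * ln (real (2 * N)) + (h * real L - ln 4) \<le> lnZ \<beta> h (2 * N) x"
proof -
  have N1: "1 \<le> N" using N n0 by simp
  let ?c = "c * real (2 * N) powr (- (1 + \<alpha>))"
  have c': "0 < ?c" using c N1 by simp
  have \<beta>1: "0 \<le> \<beta>" "\<beta> \<le> 1" using \<beta> by auto
  have wt_eq: "wt \<beta> h y = (\<lambda>i. exp h * wt \<beta> 0 y i)" for y by (simp add: wt_def fun_eq_iff)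
  have f: "exp (h * real L) * (1 / 4) \<le> free (wt \<beta> h (env x)) N"
  proof -
    have "exp (h * real L) * (1 / 4) \<le> exp h ^ L * (free (wt \<beta> 0 (env x)) N - low (wt \<beta> 0 (env x)) L N)"
      using good by (simp add: exp_of_nat_mult[symmetric] mult.commute)
    also have "\<dots> \<le> free (wt \<beta> h (env x)) N"
      unfolding wt_eq[of "env x"] using h by (intro free_minus_low_le wt_nonneg \<beta>1) simp
    finally show ?thesis .
  qed
  have "(1 - \<beta>) * ?c * (exp (h * real L) * (1 / 4)) \<le> wt \<beta> h (env x) (2 * N) * ?c * free (wt \<beta> h (env x)) N"
  proof (intro mult_mono f)
    have "1 * (1 - \<beta>) \<le> exp h * (1 - \<beta>)" using h \<beta> by (intro mult_right_mono) auto
    also have "\<dots> \<le> wt \<beta> h (env x) (2 * N)" by (rule wt_lower[OF \<beta>(1)])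
    finally show "1 - \<beta> \<le> wt \<beta> h (env x) (2 * N)" by simp
  qed (use c c' \<beta> wt_nonneg[OF \<beta>1, of h x "2 * N"] in auto)
  also have "\<dots> \<le> Z (wt \<beta> h (env x)) (2 * N)"
  proof (rule free_le_pinned[OF wt_nonneg[OF \<beta>1] N1 less_imp_le[OF c']])
    fix n assume n: "N \<le> n" "n \<le> 2 * N"
    have "?c \<le> c * real n powr (- (1 + \<alpha>))"
      using n N1 c \<alpha>_pos by (intro mult_left_mono powr_mono2') auto
    also have "\<dots> \<le> K n" using n N by (intro K_lo) simp
    finally show "?c \<le> K n" .
  qed
  finally have le: "(1 - \<beta>) * ?c * (exp (h * real L) * (1 / 4)) \<le> Z (wt \<beta> h (env x)) (2 * N)" .
  have pos: "0 < (1 - \<beta>) * ?c * (exp (h * real L) * (1 / 4))" using \<beta> c' by simp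
  have "ln ((1 - \<beta>) * ?c * (exp (h * real L) * (1 / 4))) \<le> lnZ \<beta> h (2 * N) x"
    unfolding lnZ_def using le pos by (subst ln_le_cancel_iff) auto
  also have "ln ((1 - \<beta>) * ?c * (exp (h * real L) * (1 / 4))) = ln ((1 - \<beta>) * ?c) + (h * real L - ln 4)"
    using \<beta> c N1 by (simp add: ln_mult ln_div)
  also have "ln ((1 - \<beta>) * ?c) = ln (1 - \<beta>) + (ln c + - (1 + \<alpha>) * ln (real (2 * N)))"
    using \<beta> c N1 by (simp add: ln_mult ln_powr)
  finally show ?thesis by (simp add: algebra_simps)
qed

text \<open>Even in a bad environment the one-gap bound holds, so ln Z never falls below the pinning
  cost. The gain h L - ln 4 on good environments therefore enters the mean with a fixed
  proportion.\<close>

lemma mean_lnZ_pos: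
  assumes p: "1 < p" "p < \<gamma>" and \<beta>: "0 \<le> \<beta>" "\<beta> < 1" and h: "0 \<le> h" and n0: "1 \<le> n0" and c: "0 < c"
    and K_lo: "\<And>n. n0 \<le> n \<Longrightarrow> c * real n powr (- (1 + \<alpha>)) \<le> K n" and N: "n0 \<le> N"
    and small: "4 * p * (\<integral>y. \<bar>y\<bar> powr p \<partial>D) * \<beta> powr p * (\<Sum>n=1..N. u n powr p) \<le> 1 / 64"
    and L: "1 - S L N \<le> 1 / 8" and big: "ln 4 \<le> h * real L"
  shows "ln (1 - \<beta>) + ln c - (1 + \<alpha>) * ln (real (2 * N)) + (h * real L - ln 4) / 2 \<le> expectation (lnZ \<beta> h (2 * N))"
proof -
  have \<beta>1: "0 \<le> \<beta>" "\<beta> \<le> 1" using \<beta> by auto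
  define A0 where "A0 = ln (1 - \<beta>) + ln c - (1 + \<alpha>) * ln (real (2 * N))"
  define H where "H = h * real L - ln 4"
  have H: "0 \<le> H" using big by (simp add: H_def)
  let ?f = "\<lambda>x. \<bar>free (wt \<beta> 0 (env x)) N - 1\<bar> powr p" and ?l = "\<lambda>x. low (wt \<beta> 0 (env x)) L N"
  have fm: "integrable M ?f" "expectation ?f \<le> 1 / 64"
    using free_moment[OF p \<beta>1, of N] small by auto
  have lm: "integrable M ?l" "expectation ?l \<le> 1 / 8"
    using low_mean[OF \<beta>1, of L N] L by auto
  have lnZ_int: "integrable M (lnZ \<beta> h (2 * N))"
    using free_energy_exists[OF \<beta> n0 c K_lo, of h] N by auto
  have lnZ_lo: "A0 \<le> lnZ \<beta> h (2 * N) x" for x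
  proof -
    have N2: "n0 \<le> 2 * N" "0 < 2 * N" using N n0 by auto
    have "exp h * (1 - \<beta>) * (c * real (2 * N) powr (- (1 + \<alpha>))) \<le> Z (wt \<beta> h (env x)) (2 * N)"
      using \<beta> by (intro order_trans[OF mult_left_mono[OF K_lo[OF N2(1)]] Z_wt_lower[OF \<beta> N2(2)]]) simp
    then have "ln (exp h * (1 - \<beta>) * (c * real (2 * N) powr (- (1 + \<alpha>)))) \<le> lnZ \<beta> h (2 * N) x"
      unfolding lnZ_def using \<beta> c N2 by (intro iffD2[OF ln_le_cancel_iff]) (auto intro: less_le_trans[rotated])
    also have "ln (exp h * (1 - \<beta>) * (c * real (2 * N) powr (- (1 + \<alpha>)))) = h + ln (1 - \<beta>) + (ln c + - (1 + \<alpha>) * ln (real (2 * N)))"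
      using \<beta> c N2 by (simp add: ln_mult ln_powr)
    finally show ?thesis using h by (simp add: A0_def algebra_simps)
  qed
  have low0: "0 \<le> ?l x" for x
    unfolding low_def by (intro sum_nonneg mult_nonneg_nonneg W_wt_nonneg T_nonneg \<beta>1)
  \<comment> \<open>A linear substitute for the indicator of a good environment. In a bad one,
    \<open>low\<close> is at least 1/2 or |free - 1| exceeds 1/4, and (1/4)^p >= 1/16 because p < 2,
    so the bracket is nonpositive. The mean bounds 1/64 and 1/8 leave 1 - 1/4 - 1/4 = 1/2.\<close>
  have le: "A0 + H * (1 - 16 * ?f x - 2 * ?l x) \<le> lnZ \<beta> h (2 * N) x" for x
  proof (cases "1 / 4 \<le> free (wt \<beta> 0 (env x)) N - ?l x")
    case True
    have "0 \<le> ?f x" by simp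
    then have "1 - 16 * ?f x - 2 * ?l x \<le> 1" using low0[of x] by linarith
    then have "H * (1 - 16 * ?f x - 2 * ?l x) \<le> H * 1" using H by (intro mult_left_mono)
    then show ?thesis
      using lnZ_good_bound[OF \<beta> h n0 c K_lo N True] by (simp add: A0_def H_def)
  next
    case False
    have "1 \<le> 16 * ?f x + 2 * ?l x"
    proof (cases "1 / 2 \<le> ?l x")
      case True
      moreover have "0 \<le> ?f x" by simp
      ultimately show ?thesis by linarith
    next
      case l: False
      have "(1 / 4) powr p \<le> ?f x" using False l p by (intro powr_mono2) auto
      moreover have "(1 / 4) powr 2 \<le> (1 / 4 :: real) powr p" using p \<gamma>_range by (intro powr_mono') auto
      moreover have "(1 / 4 :: real) powr 2 = 1 / 16" by (simp add: powr_numeral power2_eq_square)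
      ultimately show ?thesis using low0[of x] by linarith
    qed
    then have "H * (1 - 16 * ?f x - 2 * ?l x) \<le> 0" using H by (intro mult_nonneg_nonpos) auto
    then show ?thesis using lnZ_lo[of x] by linarith
  qed
  have int: "integrable M (\<lambda>x. A0 + H * (1 - 16 * ?f x - 2 * ?l x))"
    using fm(1) lm(1) by (intro Bochner_Integration.integrable_add integrable_mult_right
      Bochner_Integration.integrable_diff integrable_const)
  have "A0 + H * (1 / 2) \<le> A0 + H * (1 - 16 * expectation ?f - 2 * expectation ?l)"
    using fm(2) lm(2) H by (intro add_left_mono mult_left_mono) auto
  also have "\<dots> = expectation (\<lambda>x. A0 + H * (1 - 16 * ?f x - 2 * ?l x))"
    using fm(1) lm(1) by (simp add: prob_space)
  also have "\<dots> \<le> expectation (lnZ \<beta> h (2 * N))"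
    by (rule integral_mono[OF int lnZ_int le])
  finally show ?thesis by (simp add: A0_def H_def)
qed

text \<open>The condition on \<beta> keeps the disorder weak up to scale N, while h L is of order
  N^(s - s'). This beats the ln N lost by pinning, so ln Z at 2N has positive mean and
  \<open>free_energy_exists\<close> applies.\<close>

lemma localized:
  assumes p: "1 < p" "p < \<gamma>" "p * (1 - a) < 1" and s: "0 < s'" "s' < s" "s < a"
  shows "\<exists>c>0. \<exists>N0\<ge>1. \<forall>\<beta> N. 0 < \<beta> \<longrightarrow> \<beta> \<le> 1 / 2 \<longrightarrow> N0 \<le> N \<longrightarrow>
    \<beta> powr p * real N powr (1 - p * (1 - a)) \<le> c \<longrightarrow>
    (\<exists>f>0. AE x in M. (\<lambda>n. 1 / real n * lnZ \<beta> (real N powr (- s')) n x) \<longlonglongrightarrow> f)"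
proof -
  obtain cK n0 where n0: "n0 \<ge> 1" and cK: "cK > 0"
    and K_lo: "\<And>n. n0 \<le> n \<Longrightarrow> cK * real n powr (- (1 + \<alpha>)) \<le> K n"
    using K_lower by blast
  obtain Cu where Cu: "Cu > 0" "\<And>n. 1 \<le> n \<Longrightarrow> u n \<le> Cu * real n powr (a - 1)"
    using u_upper by blast
  have s2: "0 < s" "s < \<alpha>" "s \<le> 1" using s a_bounds by auto
  obtain Cs where Cs: "Cs > 0" "\<And>L N. 1 \<le> N \<Longrightarrow> 1 - S L N \<le> Cs * real L * real N powr (- s)"
    using S_lower[OF s2] by blast
  define B where "B = (\<integral>y. \<bar>y\<bar> powr p \<partial>D) + 1"
  have B: "0 < B" unfolding B_def by (intro add_nonneg_pos) auto
  \<comment> \<open>The p-th power of \<open>u n\<close> is O(n^(-w)), and w < 1 makes its sum up to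
    N of order N^(1 - w).\<close>
  define w where "w = p * (1 - a)"
  have w: "0 \<le> w" "w < 1" using p a_bounds by (auto simp: w_def)
  define C where "C = 4 * p * B * (Cu powr p / (1 - w))"
  have C: "0 < C" unfolding C_def using p B Cu w by (intro mult_pos_pos divide_pos_pos) auto
  define c where "c = 1 / (64 * C)"
  have c: "0 < c" using C by (simp add: c_def)
  define c2 where "c2 = 1 / (8 * Cs)"
  have c2: "0 < c2" using Cs by (simp add: c2_def)
  define e where "e = s - s'"
  have e: "0 < e" using s by (simp add: e_def)
  have ev1: "eventually (\<lambda>N::nat. ln 4 \<le> c2 * real N powr e - 1) sequentially"
    using c2 e by real_asymp
  have ev2: "eventually (\<lambda>N::nat. 0 < ln (1 / 2) + ln cK - (1 + \<alpha>) * ln (2 * real N) + (c2 * real N powr e - 1 - ln 4) / 2) sequentially"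
    using c2 e by real_asymp
  obtain N1 where N1: "\<And>N. N1 \<le> N \<Longrightarrow> ln 4 \<le> c2 * real N powr e - 1"
    "\<And>N. N1 \<le> N \<Longrightarrow> 0 < ln (1 / 2) + ln cK - (1 + \<alpha>) * ln (2 * real N) + (c2 * real N powr e - 1 - ln 4) / 2"
    using eventually_conj[OF ev1 ev2] unfolding eventually_at_top_linorder by blast
  have main: "\<exists>f>0. AE x in M. (\<lambda>n. 1 / real n * lnZ \<beta> (real N powr (- s')) n x) \<longlonglongrightarrow> f"
    if \<beta>: "0 < \<beta>" "\<beta> \<le> 1 / 2" and N: "max n0 N1 \<le> N" and cond: "\<beta> powr p * real N powr (1 - p * (1 - a)) \<le> c" for \<beta> N
  proof -
    have N': "n0 \<le> N" "N1 \<le> N" "1 \<le> N" using N n0 by auto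
    have \<beta>1: "0 \<le> \<beta>" "\<beta> < 1" using \<beta> by auto
    define h where "h = real N powr (- s')"
    have h: "0 \<le> h" "h \<le> 1" using N' s powr_mono[of "- s'" 0 "real N"] by (auto simp: h_def)
    \<comment> \<open>Small enough that fewer than L contacts have probability at most 1/8, as Cs c2
      = 1/8.\<close>
    define L where "L = nat \<lfloor>c2 * real N powr s\<rfloor>"
    have Lpos: "0 \<le> c2 * real N powr s" using c2 by simp
    have L: "real L \<le> c2 * real N powr s" "c2 * real N powr s - 1 \<le> real L"
      unfolding L_def using Lpos by linarith+
    have hL: "c2 * real N powr e - 1 \<le> h * real L"
    proof -
      have "h * (c2 * real N powr s - 1) \<le> h * real L" using L h by (intro mult_left_mono) auto
      moreover have "h * (c2 * real N powr s - 1) = c2 * (real N powr (- s') * real N powr s) - h"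
        by (simp add: h_def algebra_simps)
      moreover have "real N powr (- s') * real N powr s = real N powr e"
        by (simp add: powr_add[symmetric] e_def)
      ultimately show ?thesis using h by simp
    qed
    have SL: "1 - S L N \<le> 1 / 8"
    proof -
      have "1 - S L N \<le> Cs * real L * real N powr (- s)" by (rule Cs(2)[OF N'(3)])
      also have "\<dots> \<le> Cs * (c2 * real N powr s) * real N powr (- s)"
        using L Cs by (intro mult_right_mono mult_left_mono) auto
      also have "\<dots> = Cs * c2 * (real N powr s * real N powr (- s))" by (simp only: mult.assoc)
      also have "real N powr s * real N powr (- s) = 1" using N' by (simp add: powr_add[symmetric])
      also have "Cs * c2 * 1 = 1 / 8" using Cs by (simp add: c2_def)
      finally show ?thesis .
    qed
    have U: "(\<Sum>n=1..N. u n powr p) \<le> Cu powr p * (real N powr (1 - w) / (1 - w))"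
    proof -
      have "(\<Sum>n=1..N. u n powr p) \<le> (\<Sum>n=1..N. Cu powr p * real n powr (- w))"
      proof (rule sum_mono)
        fix n assume n: "n \<in> {1..N}"
        have "u n powr p \<le> (Cu * real n powr (a - 1)) powr p"
          using n p u_nonneg Cu(2)[of n] by (intro powr_mono2) auto
        also have "\<dots> = Cu powr p * real n powr ((a - 1) * p)" unfolding powr_mult powr_powr ..
        also have "(a - 1) * p = - w" by (simp add: w_def algebra_simps)
        finally show "u n powr p \<le> Cu powr p * real n powr (- w)" .
      qed
      also have "\<dots> \<le> Cu powr p * (real N powr (1 - w) / (1 - w))"
        unfolding sum_distrib_left[symmetric] by (intro mult_left_mono sum_powr_le w) auto
      finally show ?thesis .
    qed
    have small: "4 * p * (\<integral>y. \<bar>y\<bar> powr p \<partial>D) * \<beta> powr p * (\<Sum>n=1..N. u n powr p) \<le> 1 / 64"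
    proof -
      have "4 * p * (\<integral>y. \<bar>y\<bar> powr p \<partial>D) * \<beta> powr p * (\<Sum>n=1..N. u n powr p)
          \<le> 4 * p * B * \<beta> powr p * (Cu powr p * (real N powr (1 - w) / (1 - w)))"
        using p by (intro mult_mono U mult_nonneg_nonneg sum_nonneg) (auto simp: B_def)
      also have "\<dots> = C * (\<beta> powr p * real N powr (1 - w))" by (simp add: C_def)
      also have "\<dots> \<le> C * c" using cond C by (intro mult_left_mono) (auto simp: w_def)
      also have "\<dots> = 1 / 64" using C by (simp add: c_def)
      finally show ?thesis .
    qed
    have big: "ln 4 \<le> h * real L" using N1(1)[OF N'(2)] hL by linarith
    have "ln (1 - \<beta>) + ln cK - (1 + \<alpha>) * ln (real (2 * N)) + (h * real L - ln 4) / 2 \<le> expectation (lnZ \<beta> h (2 * N))"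
      by (rule mean_lnZ_pos[OF p(1,2) \<beta>1 h(1) n0 cK K_lo N'(1) small SL big])
    moreover have "ln (1 / 2) \<le> ln (1 - \<beta>)" using \<beta> by (subst ln_le_cancel_iff) auto
    moreover have "(c2 * real N powr e - 1 - ln 4) / 2 \<le> (h * real L - ln 4) / 2" using hL by simp
    moreover have "real (2 * N) = 2 * real N" by simp
    ultimately have pos: "0 < expectation (lnZ \<beta> h (2 * N))"
      using N1(2)[OF N'(2)] by (simp only:)
    obtain f where f: "AE x in M. (\<lambda>n. 1 / real n * lnZ \<beta> h n x) \<longlonglongrightarrow> f"
      "\<forall>m\<ge>n0. integrable M (lnZ \<beta> h m) \<and> expectation (lnZ \<beta> h m) / real m \<le> f"
      using free_energy_exists[OF \<beta>1 n0 cK K_lo, of h] by blast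
    have "0 < expectation (lnZ \<beta> h (2 * N)) / real (2 * N)" using pos N' by (intro divide_pos_pos) auto
    also have "\<dots> \<le> f" using f(2)[rule_format, of "2 * N"] N' by auto
    finally show ?thesis using f(1) unfolding h_def by blast
  qed
  show ?thesis using c n0
    by (intro exI[of _ c] conjI exI[of _ "max n0 N1"] allI impI main) (auto simp: max_def)
qed

text \<open>Needed for the infimum in the critical point to range over a nonempty set. The value of
  h is the one at which the one-gap bound at \<open>n0\<close> equals 1.\<close>

lemma localized_large_h:
  assumes \<beta>: "0 \<le> \<beta>" "\<beta> < 1"
  shows "\<exists>h. \<exists>f>0. AE x in M. (\<lambda>n. 1 / real n * lnZ \<beta> h n x) \<longlonglongrightarrow> f"
proof -
  obtain cK n0 where n0: "n0 \<ge> 1" and cK: "cK > 0"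
    and K_lo: "\<And>n. n0 \<le> n \<Longrightarrow> cK * real n powr (- (1 + \<alpha>)) \<le> K n"
    using K_lower by blast
  define h where "h = 1 - (ln (1 - \<beta>) + ln cK - (1 + \<alpha>) * ln (real n0))"
  have lo: "1 \<le> lnZ \<beta> h n0 x" for x
  proof -
    have N2: "0 < n0" using n0 by auto
    have "exp h * (1 - \<beta>) * (cK * real n0 powr (- (1 + \<alpha>))) \<le> Z (wt \<beta> h (env x)) n0"
      using \<beta> by (intro order_trans[OF mult_left_mono[OF K_lo[OF order_refl]] Z_wt_lower[OF \<beta> N2]]) simp
    then have "ln (exp h * (1 - \<beta>) * (cK * real n0 powr (- (1 + \<alpha>)))) \<le> lnZ \<beta> h n0 x"
      unfolding lnZ_def using \<beta> cK N2 by (intro iffD2[OF ln_le_cancel_iff]) (auto intro: less_le_trans[rotated])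
    also have "ln (exp h * (1 - \<beta>) * (cK * real n0 powr (- (1 + \<alpha>)))) = h + ln (1 - \<beta>) + (ln cK + - (1 + \<alpha>) * ln (real n0))"
      using \<beta> cK N2 by (simp add: ln_mult ln_powr)
    finally show ?thesis by (simp add: h_def algebra_simps)
  qed
  obtain f where f: "AE x in M. (\<lambda>n. 1 / real n * lnZ \<beta> h n x) \<longlonglongrightarrow> f"
    "\<forall>m\<ge>n0. integrable M (lnZ \<beta> h m) \<and> expectation (lnZ \<beta> h m) / real m \<le> f"
    using free_energy_exists[OF \<beta> n0 cK K_lo, of h] by blast
  have "expectation (\<lambda>x. 1) \<le> expectation (lnZ \<beta> h n0)"
    using f(2) lo by (intro integral_mono) auto
  then have "0 < expectation (lnZ \<beta> h n0)" by (simp add: prob_space)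
  then have "0 < expectation (lnZ \<beta> h n0) / real n0" using n0 by (intro divide_pos_pos) auto
  also have "\<dots> \<le> f" using f(2) by auto
  finally show ?thesis using f(1) by blast
qed

end

subsection \<open>From the renewal process to its kernel\<close>

lemma measurable_nat_add:
  fixes f g :: "'c \<Rightarrow> nat"
  assumes "f \<in> measurable N (count_space UNIV)" "g \<in> measurable N (count_space UNIV)"
  shows "(\<lambda>x. f x + g x) \<in> measurable N (count_space UNIV)"
proof -
  have "(\<lambda>x. (f x, g x)) \<in> measurable N (count_space UNIV \<Otimes>\<^sub>M count_space UNIV)"
    by (rule measurable_Pair[OF assms])
  then have "(\<lambda>x. (f x, g x)) \<in> measurable N (count_space UNIV)"
    by (simp add: pair_measure_countable)
  then have "(\<lambda>x. case (f x, g x) of (a, b) \<Rightarrow> a + b) \<in> measurable N (count_space UNIV)"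
    by (rule measurable_compose) simp
  then show ?thesis by simp
qed

lemma measurable_nat_sum:
  fixes f :: "'i \<Rightarrow> 'c \<Rightarrow> nat"
  assumes "finite I" "\<And>i. i \<in> I \<Longrightarrow> f i \<in> measurable N (count_space UNIV)"
  shows "(\<lambda>x. \<Sum>i\<in>I. f i x) \<in> measurable N (count_space UNIV)"
  using assms by (induction I rule: finite_induct) (auto intro!: measurable_nat_add)

context renewal_process
begin

text \<open>\<open>K 0\<close> is arbitrary in \<open>renewal_process\<close>; since the increments
  are almost surely positive, 0 is the right value.\<close>

definition K' :: "nat \<Rightarrow> real" where "K' n = (if n = 0 then 0 else K n)"

definition X :: "nat \<Rightarrow> 'b \<Rightarrow> nat" where "X n t = \<tau> (Suc n) t - \<tau> n t"

text \<open>A function of the increments rather than of the contacts, because independence is given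
  for the increments.\<close>

definition H :: "(nat \<Rightarrow> real) \<Rightarrow> nat \<Rightarrow> nat \<Rightarrow> (nat \<Rightarrow> nat) \<Rightarrow> real" where
  "H \<xi> k n x = (\<Prod>i=1..k. \<xi> (\<Sum>j<i. x j)) * (if (\<Sum>j<k. x j) = n then 1 else 0)"

lemma measurable_X: "X n \<in> measurable P (count_space UNIV)"
  using increments_indep unfolding X_def[abs_def] by (auto simp: indep_vars_def)

lemma AE_path: "AE t in P. \<tau> 0 t = 0 \<and> (\<forall>n. \<tau> n t < \<tau> (Suc n) t)"
  using renewal_0 increments_pos by (simp add: AE_all_countable)

lemma prob_X: "prob {t \<in> space P. X n t = k} = K' k"
proof (cases "k = 0")
  case True
  have "prob {t \<in> space P. X n t = k} = 0"
  proof (rule prob_eq_0[THEN iffD2])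
    show "{t \<in> space P. X n t = k} \<in> events"
      using measurable_sets[OF measurable_X[of n], of "{k}"] by (simp add: vimage_def Int_def conj_commute)
    show "AE t in P. t \<notin> {t \<in> space P. X n t = k}"
      using increments_pos[of n] by eventually_elim (auto simp: X_def True)
  qed
  then show ?thesis by (simp add: K'_def True)
next
  case False
  then show ?thesis using increments_law[of k n] by (simp add: K'_def X_def)
qed

lemma kernel: "renewal_kernel K'"
proof
  show "K' 0 = 0" by (simp add: K'_def)
  show "0 \<le> K' n" for n using prob_X[of 0 n] by (metis measure_nonneg)
  have "(\<lambda>k. K' (Suc k)) sums 1" using recurrent by (simp add: K'_def)
  then have "K' sums (1 + K' 0)" by (simp only: sums_Suc_iff)
  moreover have "K' 0 = 0" by (simp add: K'_def)
  ultimately show "K' sums 1" by simp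
qed

sublocale R: renewal_kernel K' by (rule kernel)

lemma measurable_partial:
  fixes i k :: nat
  assumes "i \<le> k"
  shows "(\<lambda>x. \<Sum>j<i. x j) \<in> measurable (PiM {..<k} (\<lambda>_. count_space UNIV)) (count_space (UNIV :: nat set))"
  using assms by (intro measurable_nat_sum measurable_component_singleton) auto

lemma measurable_H: "H \<xi> k n \<in> borel_measurable (PiM {..<k} (\<lambda>_. count_space UNIV))"
  unfolding H_def[abs_def]
  by (intro borel_measurable_times borel_measurable_prod measurable_compose[OF measurable_partial]) auto

lemma H_restrict: "H \<xi> k n (restrict x {..<k}) = H \<xi> k n x"
proof -
  have "(\<Sum>j<i. restrict x {..<k} j) = (\<Sum>j<i. x j)" if "i \<le> k" for i
    using that by (intro sum.cong) auto
  then show ?thesis by (simp add: H_def)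
qed

text \<open>Only the \<open>m\<close> equal to the sum of the first k increments contributes, which
  separates the last increment from the earlier ones.\<close>

lemma H_Suc: "H \<xi> (Suc k) n x = \<xi> n * (\<Sum>m\<le>n. H \<xi> k m x * (if x k = n - m then 1 else 0))"
proof -
  let ?s = "\<Sum>j<k. x j"
  have "(\<Sum>m\<le>n. H \<xi> k m x * (if x k = n - m then 1 else 0))
      = (\<Sum>m\<le>n. if m = ?s then (\<Prod>i=1..k. \<xi> (\<Sum>j<i. x j)) * (if x k = n - ?s then 1 else 0) else 0)"
    by (intro sum.cong refl) (auto simp: H_def)
  also have "\<dots> = (if ?s \<le> n then (\<Prod>i=1..k. \<xi> (\<Sum>j<i. x j)) * (if x k = n - ?s then 1 else 0) else 0)"
    by simp
  finally show ?thesis by (auto simp: H_def)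
qed

text \<open>If the k-th contact is at \<open>n\<close>, all earlier ones are at most
  \<open>n\<close>, so only finitely many weights can occur.\<close>

lemma H_bounded: "\<bar>H \<xi> k n x\<bar> \<le> (1 + (\<Sum>j\<le>n. \<bar>\<xi> j\<bar>)) ^ k"
proof (cases "(\<Sum>j<k. x j) = n")
  case True
  have "\<bar>\<Prod>i=1..k. \<xi> (\<Sum>j<i. x j)\<bar> = (\<Prod>i=1..k. \<bar>\<xi> (\<Sum>j<i. x j)\<bar>)" by (rule abs_prod)
  also have "\<dots> \<le> (\<Prod>i=1..k. 1 + (\<Sum>j\<le>n. \<bar>\<xi> j\<bar>))"
  proof (intro prod_mono conjI)
    fix i assume i: "i \<in> {1..k}"
    have "(\<Sum>j<i. x j) \<le> (\<Sum>j<k. x j)" using i by (intro sum_mono2) auto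
    then have "\<bar>\<xi> (\<Sum>j<i. x j)\<bar> \<le> (\<Sum>j\<le>n. \<bar>\<xi> j\<bar>)"
      unfolding True by (intro member_le_sum[of _ _ "\<lambda>j. \<bar>\<xi> j\<bar>"]) auto
    then show "\<bar>\<xi> (\<Sum>j<i. x j)\<bar> \<le> 1 + (\<Sum>j\<le>n. \<bar>\<xi> j\<bar>)" by simp
  qed simp
  finally show ?thesis using True by (simp add: H_def)
qed (simp add: H_def sum_nonneg add_nonneg_nonneg)

lemma measurable_HX: "(\<lambda>t. H \<xi> k n (\<lambda>i. X i t)) \<in> borel_measurable P"
proof -
  have "(\<lambda>t. restrict (\<lambda>i. X i t) {..<k}) \<in> measurable P (PiM {..<k} (\<lambda>_. count_space UNIV))"
    by (intro measurable_restrict measurable_X)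
  from measurable_compose[OF this measurable_H[of \<xi> k n]] show ?thesis by (simp add: H_restrict)
qed

lemma integrable_HX: "integrable P (\<lambda>t. H \<xi> k n (\<lambda>i. X i t))"
  by (rule integrable_const_bound[OF AE_I2 measurable_HX]) (subst real_norm_def, rule H_bounded)

text \<open>The first k increments are independent of the next one, so \<open>H_Suc\<close> becomes
  the recursion that defines \<open>W\<close>.\<close>

lemma expectation_H: "expectation (\<lambda>t. H \<xi> k n (\<lambda>i. X i t)) = R.W \<xi> k n"
proof (induction k arbitrary: n)
  case 0
  show ?case by (simp add: H_def prob_space)
next
  case (Suc k)
  let ?I = "\<lambda>m x. if x = n - m then 1 else 0 :: real"
  have ind: "indep_var borel (\<lambda>t. H \<xi> k m (\<lambda>i. X i t)) borel (\<lambda>t. ?I m (X k t))" for m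
  proof -
    have "indep_var borel (H \<xi> k m \<circ> (\<lambda>t. restrict (\<lambda>i. X i t) {..<k}))
        borel ((\<lambda>x. ?I m (x k)) \<circ> (\<lambda>t. restrict (\<lambda>i. X i t) {k}))"
    proof (rule indep_var_compose[OF indep_var_restrict measurable_H])
      show "indep_vars (\<lambda>_. count_space UNIV) X UNIV"
        using increments_indep unfolding X_def[abs_def] .
      show "(\<lambda>x. ?I m (x k)) \<in> borel_measurable (PiM {k} (\<lambda>_. count_space UNIV))"
        by (rule measurable_compose[OF measurable_component_singleton]) auto
    qed auto
    then show ?thesis by (simp add: comp_def H_restrict)
  qed
  have mI: "(\<lambda>t. ?I m (X k t)) \<in> borel_measurable P" for m
    by (rule measurable_compose[OF measurable_X]) simp
  have intI: "integrable P (\<lambda>t. ?I m (X k t))" for m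
    by (rule integrable_const_bound[where B = 1, OF AE_I2 mI]) simp
  have EI: "expectation (\<lambda>t. ?I m (X k t)) = K' (n - m)" for m
  proof -
    have "expectation (\<lambda>t. ?I m (X k t)) = expectation (indicator {t \<in> space P. X k t = n - m})"
      by (rule Bochner_Integration.integral_cong) (auto simp: indicator_def)
    also have "\<dots> = prob ({t \<in> space P. X k t = n - m} \<inter> space P)" by simp
    also have "{t \<in> space P. X k t = n - m} \<inter> space P = {t \<in> space P. X k t = n - m}" by auto
    also have "prob \<dots> = K' (n - m)" by (rule prob_X)
    finally show ?thesis .
  qed
  have "expectation (\<lambda>t. H \<xi> (Suc k) n (\<lambda>i. X i t))
      = expectation (\<lambda>t. \<xi> n * (\<Sum>m\<le>n. H \<xi> k m (\<lambda>i. X i t) * ?I m (X k t)))"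
    by (simp only: H_Suc)
  also have "\<dots> = \<xi> n * (\<Sum>m\<le>n. expectation (\<lambda>t. H \<xi> k m (\<lambda>i. X i t) * ?I m (X k t)))"
    using indep_var_integrable[OF ind integrable_HX intI] by (simp add: Bochner_Integration.integral_sum)
  also have "\<dots> = \<xi> n * (\<Sum>m\<le>n. R.W \<xi> k m * K' (n - m))"
    by (simp only: indep_var_lebesgue_integral[OF ind integrable_HX intI] EI Suc.IH)
  finally show ?case by simp
qed

lemma path_sum:
  assumes "\<tau> 0 t = 0" "\<And>n. \<tau> n t < \<tau> (Suc n) t"
  shows "(\<Sum>j<k. X j t) = \<tau> k t"
  by (induction k) (use assms in \<open>auto simp: X_def less_imp_le\<close>)

text \<open>Almost surely the contacts increase strictly, so if N is a contact it has exactly one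
  index k, at most N, and the contacts in 1..N are those with index 1 to k.\<close>

lemma partition_function_eq: "partition_function P \<tau> w \<beta> h N = R.Z (\<lambda>i. exp h * (\<beta> * w i + 1)) N"
proof -
  define \<xi> where "\<xi> i = exp h * (\<beta> * w i + 1)" for i
  have "AE t in P. (\<Prod>n\<in>renewal_set \<tau> t \<inter> {1..N}. \<xi> n) * indicator {s. N \<in> renewal_set \<tau> s} t
      = (\<Sum>k\<le>N. H \<xi> k N (\<lambda>i. X i t))"
    using AE_path
  proof eventually_elim
    case (elim t)
    have 0: "\<tau> 0 t = 0" and step: "\<And>n. \<tau> n t < \<tau> (Suc n) t" using elim by auto
    have mono: "strict_mono (\<lambda>k. \<tau> k t)" using step by (simp add: strict_mono_Suc_iff)
    have ge: "k \<le> \<tau> k t" for k using mono by (rule strict_mono_imp_increasing)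
    have HX: "H \<xi> k N (\<lambda>i. X i t) = (\<Prod>i=1..k. \<xi> (\<tau> i t)) * (if \<tau> k t = N then 1 else 0)" for k
      by (simp add: H_def path_sum[OF 0 step])
    show ?case
    proof (cases "N \<in> renewal_set \<tau> t")
      case False
      then have "\<tau> k t \<noteq> N" for k by (auto simp: renewal_set_def)
      then show ?thesis using False by (simp add: HX)
    next
      case True
      then obtain k where k: "\<tau> k t = N" by (auto simp: renewal_set_def)
      have kN: "k \<le> N" using ge[of k] k by simp
      have iff: "\<tau> j t = N \<longleftrightarrow> j = k" for j
        using strict_mono_eq[OF mono, of j k] k by simp
      have "(\<Sum>j\<le>N. H \<xi> j N (\<lambda>i. X i t)) = (\<Sum>j\<le>N. if j = k then (\<Prod>i=1..k. \<xi> (\<tau> i t)) else 0)"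
        by (intro sum.cong refl) (auto simp: HX iff)
      also have "\<dots> = (\<Prod>i=1..k. \<xi> (\<tau> i t))" using kN by simp
      also have "\<dots> = (\<Prod>n\<in>(\<lambda>i. \<tau> i t) ` {1..k}. \<xi> n)"
        by (subst prod.reindex) (auto intro!: inj_onI simp: strict_mono_eq[OF mono])
      also have "(\<lambda>i. \<tau> i t) ` {1..k} = renewal_set \<tau> t \<inter> {1..N}"
      proof
        show "(\<lambda>i. \<tau> i t) ` {1..k} \<subseteq> renewal_set \<tau> t \<inter> {1..N}"
        proof
          fix n assume "n \<in> (\<lambda>i. \<tau> i t) ` {1..k}"
          then obtain i where i: "n = \<tau> i t" "1 \<le> i" "i \<le> k" by auto
          have "i \<le> \<tau> i t" by (rule ge)
          moreover have "\<tau> i t \<le> \<tau> k t" using strict_mono_less_eq[OF mono, of i k] i by simp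
          ultimately show "n \<in> renewal_set \<tau> t \<inter> {1..N}" using i k by (auto simp: renewal_set_def)
        qed
        show "renewal_set \<tau> t \<inter> {1..N} \<subseteq> (\<lambda>i. \<tau> i t) ` {1..k}"
        proof
          fix n assume n: "n \<in> renewal_set \<tau> t \<inter> {1..N}"
          then obtain i where i: "n = \<tau> i t" by (auto simp: renewal_set_def)
          have "i \<le> k" using strict_mono_less_eq[OF mono, of i k] i n k by simp
          moreover have "i \<noteq> 0" using i n 0 by (intro notI) auto
          ultimately show "n \<in> (\<lambda>i. \<tau> i t) ` {1..k}" using i by auto
        qed
      qed
      finally show ?thesis using True by simp
    qed
  qed
  then have "partition_function P \<tau> w \<beta> h N = expectation (\<lambda>t. \<Sum>k\<le>N. H \<xi> k N (\<lambda>i. X i t))"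
    unfolding partition_function_def \<xi>_def[symmetric]
  proof (rule integral_cong_AE[rotated 2])
    show "(\<lambda>t. \<Sum>k\<le>N. H \<xi> k N (\<lambda>i. X i t)) \<in> borel_measurable P"
      by (intro borel_measurable_sum measurable_HX)
    have ev: "{t \<in> space P. n \<in> renewal_set \<tau> t} \<in> events" for n
    proof -
      have "{t \<in> space P. n \<in> renewal_set \<tau> t} = (\<Union>k. \<tau> k -` {n} \<inter> space P)"
        by (auto simp: renewal_set_def)
      also have "\<dots> \<in> events"
        by (intro sets.countable_UN image_subsetI measurable_sets[OF renewal_measurable]) simp
      finally show ?thesis .
    qed
    \<comment> \<open>For measurability the product over a random set is rewritten over 1..N, each
      factor depending on whether n is a contact.\<close>
    have "(\<Prod>n\<in>renewal_set \<tau> t \<inter> {1..N}. \<xi> n) = (\<Prod>n=1..N. if n \<in> renewal_set \<tau> t then \<xi> n else 1)" for t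
      by (subst prod.inter_restrict[symmetric]) (auto simp: Int_commute)
    then show "(\<lambda>t. (\<Prod>n\<in>renewal_set \<tau> t \<inter> {1..N}. \<xi> n) * indicator {s. N \<in> renewal_set \<tau> s} t) \<in> borel_measurable P"
      using ev by (simp only:) (intro borel_measurable_times borel_measurable_prod measurable_If
        borel_measurable_const borel_measurable_indicator'; simp add: pred_def)
  qed
  also have "\<dots> = (\<Sum>k\<le>N. R.W \<xi> k N)"
    using integrable_HX by (simp add: Bochner_Integration.integral_sum expectation_H)
  also have "\<xi> = (\<lambda>i. exp h * (\<beta> * w i + 1))" by (simp add: fun_eq_iff \<xi>_def)
  finally show ?thesis by (simp only: R.Z_def)
qed

end

subsection \<open>The critical point\<close>

context pinning
begin

text \<open>\<open>F\<close> stands for the free energy. It is known only through almost sure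
  limits, so both bounds have to produce such a limit first.\<close>

lemma critical_asymptotics:
  fixes F :: "real \<Rightarrow> real \<Rightarrow> real"
  assumes \<alpha>: "1 - 1 / \<gamma> < \<alpha>"
    and F: "\<And>\<beta> h f. 0 < \<beta> \<Longrightarrow> \<beta> < 1 \<Longrightarrow> (AE x in M. (\<lambda>N. 1 / real N * lnZ \<beta> h N x) \<longlonglongrightarrow> f) \<Longrightarrow> F \<beta> h = f"
  shows "(\<forall>\<beta>\<in>{0<..<1}. 0 < Inf {h. 0 < F \<beta> h}) \<and>
    ((\<lambda>\<beta>. ln (Inf {h. 0 < F \<beta> h}) / ln \<beta>) \<longlongrightarrow>
      (if \<alpha> < 1 then \<alpha> * \<gamma> / ((\<alpha> - 1) * \<gamma> + 1) else \<gamma>)) (at_right 0)"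
proof -
  define hc where "hc \<beta> = Inf {h. 0 < F \<beta> h}" for \<beta>
  define \<kappa> where "\<kappa> = a - 1 + 1 / \<gamma>"
  have g1: "1 / \<gamma> < 1" using \<gamma>_range by simp
  have \<kappa>: "0 < \<kappa>" "\<kappa> < a" "\<kappa> = 1 / \<gamma> - (1 - a)"
    using \<alpha> g1 \<gamma>_range by (auto simp: \<kappa>_def a_def min_def)
  have e0: "(if \<alpha> < 1 then \<alpha> * \<gamma> / ((\<alpha> - 1) * \<gamma> + 1) else \<gamma>) = a / \<kappa>"
  proof -
    have "\<kappa> = ((a - 1) * \<gamma> + 1) / \<gamma>" using \<gamma>_range by (simp add: \<kappa>_def field_simps)
    then show ?thesis by (auto simp: a_def min_def)
  qed
  have nonempty: "{h. 0 < F \<beta> h} \<noteq> {}" if \<beta>: "0 < \<beta>" "\<beta> < 1" for \<beta>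
  proof -
    obtain h f where "0 < f" "AE x in M. (\<lambda>n. 1 / real n * lnZ \<beta> h n x) \<longlonglongrightarrow> f"
      using localized_large_h[of \<beta>] \<beta> by auto
    then show ?thesis using F[OF \<beta>, of h f] by auto
  qed
  \<comment> \<open>The condition of \<open>delocalized\<close> divided by l^(1/\<gamma> - 1). Every
    h with positive \<open>F\<close> lies above the threshold, which bounds the set and its infimum
    from below at once.\<close>
  have lower: "\<exists>c>0. \<exists>l0\<ge>1. \<forall>\<beta> l. 0 < \<beta> \<longrightarrow> \<beta> < 1 \<longrightarrow> l0 \<le> l \<longrightarrow> real l powr (\<epsilon> - \<kappa>) \<le> \<beta> \<longrightarrow>
      bdd_below {h. 0 < F \<beta> h} \<and> c * real l powr (\<epsilon> - a) \<le> hc \<beta>"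
    if \<epsilon>: "0 < \<epsilon>" "\<epsilon> < \<kappa>" for \<epsilon>
  proof -
    have "\<epsilon> < a" using \<epsilon> \<kappa> by simp
    from delocalized[OF \<epsilon>(1) this] obtain c l0 where c: "0 < c" "1 \<le> l0"
      and del: "\<And>\<beta> l h. 0 < \<beta> \<Longrightarrow> \<beta> < 1 \<Longrightarrow> l0 \<le> l \<Longrightarrow>
        real l powr (\<epsilon> - a) \<le> \<beta> * real l powr (1 / \<gamma> - 1) \<Longrightarrow> h \<le> c * real l powr (\<epsilon> - a) \<Longrightarrow>
        (AE x in M. (\<lambda>N. 1 / real N * lnZ \<beta> h N x) \<longlonglongrightarrow> 0)"
      by blast
    have "bdd_below {h. 0 < F \<beta> h} \<and> c * real l powr (\<epsilon> - a) \<le> hc \<beta>"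
      if \<beta>: "0 < \<beta>" "\<beta> < 1" and l: "l0 \<le> l" "real l powr (\<epsilon> - \<kappa>) \<le> \<beta>" for \<beta> l
    proof -
      have "real l powr (\<epsilon> - \<kappa>) * real l powr (1 / \<gamma> - 1) \<le> \<beta> * real l powr (1 / \<gamma> - 1)"
        using l by (intro mult_right_mono) auto
      moreover have "real l powr (\<epsilon> - \<kappa>) * real l powr (1 / \<gamma> - 1) = real l powr (\<epsilon> - a)"
        unfolding powr_add[symmetric] by (simp add: \<kappa>_def)
      ultimately have rel: "real l powr (\<epsilon> - a) \<le> \<beta> * real l powr (1 / \<gamma> - 1)" by simp
      have le: "c * real l powr (\<epsilon> - a) \<le> h" if "h \<in> {h. 0 < F \<beta> h}" for h
      proof (rule ccontr)
        assume "\<not> c * real l powr (\<epsilon> - a) \<le> h"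
        then have "AE x in M. (\<lambda>N. 1 / real N * lnZ \<beta> h N x) \<longlonglongrightarrow> 0"
          by (intro del[OF \<beta> l(1) rel]) simp
        then have "F \<beta> h = 0" by (rule F[OF \<beta>])
        then show False using that by simp
      qed
      show ?thesis
        unfolding hc_def using le nonempty[OF \<beta>] by (auto intro!: bdd_belowI cInf_greatest)
    qed
    then show ?thesis using c by blast
  qed
  have large_l: "eventually (\<lambda>l::nat. real l powr (\<epsilon> - \<kappa>) \<le> \<beta>) sequentially" if "0 < \<beta>" "\<epsilon> < \<kappa>" for \<beta> \<epsilon>
  proof -
    have "(\<lambda>l::nat. real l powr (\<epsilon> - \<kappa>)) \<longlonglongrightarrow> 0"
      using that by (intro tendsto_neg_powr filterlim_real_sequentially) simp
    from order_tendstoD(2)[OF this that(1)] show ?thesis by eventually_elim simp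
  qed
  have basic: "0 < hc \<beta> \<and> bdd_below {h. 0 < F \<beta> h}" if \<beta>: "0 < \<beta>" "\<beta> < 1" for \<beta>
  proof -
    have "0 < \<kappa> / 2" "\<kappa> / 2 < \<kappa>" using \<kappa> by auto
    from lower[OF this] obtain c l0 where c: "0 < c" "1 \<le> l0"
      and lo: "\<And>\<beta> l. 0 < \<beta> \<Longrightarrow> \<beta> < 1 \<Longrightarrow> l0 \<le> l \<Longrightarrow> real l powr (\<kappa> / 2 - \<kappa>) \<le> \<beta> \<Longrightarrow>
        bdd_below {h. 0 < F \<beta> h} \<and> c * real l powr (\<kappa> / 2 - a) \<le> hc \<beta>"
      by blast
    have "\<exists>l\<ge>l0. real l powr (\<kappa> / 2 - \<kappa>) \<le> \<beta>"
      using eventually_conj[OF eventually_ge_at_top[of l0] large_l[of \<beta> "\<kappa> / 2"]] \<beta> \<kappa>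
      by (auto simp: eventually_at_top_linorder)
    then obtain l where l: "l \<ge> l0" "real l powr (\<kappa> / 2 - \<kappa>) \<le> \<beta>" by blast
    have "0 < c * real l powr (\<kappa> / 2 - a)" using c l by simp
    then show ?thesis using lo[OF \<beta> l] by simp
  qed
  have up: "eventually (\<lambda>\<beta>. ln (hc \<beta>) / ln \<beta> < e) (at_right 0)" if e: "a / \<kappa> < e" for e
  proof -
    have e_pos: "0 < e" using e \<kappa> a_bounds by (intro less_trans[OF divide_pos_pos e]) auto
    have ek: "0 < e * \<kappa> - a" using e \<kappa> by (simp add: divide_less_eq)
    \<comment> \<open>The exponent obtained is (a - \<epsilon>) / (\<kappa> - \<epsilon>), above a /
      \<kappa> as \<kappa> < a. The second bound on \<epsilon> spends at most half of the margin e
      \<kappa> - a, so the exponent stays below e.\<close>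
    define \<epsilon> where "\<epsilon> = min (\<kappa> / 2) ((e * \<kappa> - a) / (2 * e))"
    have \<epsilon>: "0 < \<epsilon>" "\<epsilon> < \<kappa>" using \<kappa> ek e_pos by (auto simp: \<epsilon>_def min_less_iff_disj)
    have "\<epsilon> * e \<le> (e * \<kappa> - a) / (2 * e) * e" using e_pos by (intro mult_right_mono) (auto simp: \<epsilon>_def)
    also have "\<dots> = (e * \<kappa> - a) / 2" using e_pos by simp
    finally have "a - \<epsilon> < e * (\<kappa> - \<epsilon>)" using ek \<epsilon>(1) by (simp add: algebra_simps)
    then have e': "(a - \<epsilon>) / (\<kappa> - \<epsilon>) < e" using \<epsilon> by (simp add: divide_less_eq)
    define e' where "e' = (a - \<epsilon>) / (\<kappa> - \<epsilon>)"
    have e'e: "0 < e - e'" using e' by (simp add: e'_def)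
    from lower[OF \<epsilon>] obtain c l0 where c: "0 < c" "1 \<le> l0"
      and lo: "\<And>\<beta> l. 0 < \<beta> \<Longrightarrow> \<beta> < 1 \<Longrightarrow> l0 \<le> l \<Longrightarrow> real l powr (\<epsilon> - \<kappa>) \<le> \<beta> \<Longrightarrow> c * real l powr (\<epsilon> - a) \<le> hc \<beta>"
      by blast
    \<comment> \<open>The scale l is about \<beta>^(-d), the smallest at which \<open>lower\<close>
      applies. As ln \<beta> is negative, the lower bound on \<open>hc\<close> becomes an upper
      bound on the ratio.\<close>
    define d where "d = 1 / (\<kappa> - \<epsilon>)"
    have d: "0 < d" using \<epsilon> by (simp add: d_def)
    define c' where "c' = c * 2 powr (\<epsilon> - a)"
    have c': "0 < c'" using c by (simp add: c'_def)
    have ev1: "eventually (\<lambda>\<beta>::real. real l0 \<le> \<beta> powr (- d)) (at_right 0)"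
      using d by real_asymp
    have ev2: "eventually (\<lambda>\<beta>::real. \<beta> powr (e - e') < c') (at_right 0)"
    proof -
      have "((\<lambda>\<beta>::real. \<beta> powr (e - e')) \<longlongrightarrow> 0) (at_right 0)" using e'e by real_asymp
      then show ?thesis by (rule order_tendstoD) (rule c')
    qed
    have ev3: "eventually (\<lambda>\<beta>::real. 0 < \<beta> \<and> \<beta> < 1) (at_right 0)"
      by (auto simp: eventually_at_right_field intro!: exI[of _ 1])
    show ?thesis
      using ev1 ev2 ev3
    proof eventually_elim
      case (elim \<beta>)
      define l where "l = nat \<lceil>\<beta> powr (- d)\<rceil>"
      have p1: "1 \<le> \<beta> powr (- d)" using elim(1) c(2) by linarith
      have l: "\<beta> powr (- d) \<le> real l" "real l \<le> 2 * \<beta> powr (- d)"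
        unfolding l_def using p1 by linarith+
      have l0: "l0 \<le> l" using elim(1) l(1) by linarith
      have "real l powr (\<epsilon> - \<kappa>) \<le> (\<beta> powr (- d)) powr (\<epsilon> - \<kappa>)"
        using l p1 \<epsilon> by (intro powr_mono2') auto
      also have "\<dots> = \<beta>"
      proof -
        have "- d * (\<epsilon> - \<kappa>) = 1" using \<epsilon> by (simp add: d_def field_simps)
        then show ?thesis unfolding powr_powr using elim(3) by simp
      qed
      finally have lb: "c * real l powr (\<epsilon> - a) \<le> hc \<beta>" using lo elim(3) l0 by blast
      have "\<beta> powr e = \<beta> powr e' * \<beta> powr (e - e')" by (simp add: powr_add[symmetric])
      also have "\<dots> < \<beta> powr e' * c'" using elim by (intro mult_strict_left_mono) auto
      also have "\<beta> powr e' = (\<beta> powr (- d)) powr (\<epsilon> - a)"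
      proof -
        have "e' = - d * (\<epsilon> - a)" by (simp add: d_def e'_def diff_divide_distrib)
        then show ?thesis unfolding powr_powr by (simp only:)
      qed
      also have "\<dots> * c' = c * (2 * \<beta> powr (- d)) powr (\<epsilon> - a)"
        unfolding c'_def powr_mult by simp
      also have "\<dots> \<le> c * real l powr (\<epsilon> - a)"
        using l p1 \<epsilon> \<kappa> c by (intro mult_left_mono powr_mono2') auto
      also note lb
      finally have "\<beta> powr e < hc \<beta>" .
      then have "ln (\<beta> powr e) < ln (hc \<beta>)" using elim basic[of \<beta>] by (subst ln_less_cancel_iff) auto
      then have "e * ln \<beta> < ln (hc \<beta>)" using elim by (simp add: ln_powr)
      then show ?case using elim by (simp add: divide_less_eq mult.commute)
    qed
  qed
  have dn: "eventually (\<lambda>\<beta>. e < ln (hc \<beta>) / ln \<beta>) (at_right 0)" if e: "e < a / \<kappa>" for e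
  proof -
    \<comment> \<open>The moment order is \<gamma> - \<delta>. The exponent q lies just below p / (1
      - p (1 - a)), so that N of order \<beta>^(-q) makes \<beta>^p N^(1 - p (1 - a)) tend to 0. As
      \<delta> tends to 0, q s' with s' = a - 2 \<delta> tends to a / \<kappa>.\<close>
    let ?p = "\<lambda>\<delta>::real. \<gamma> - \<delta>"
    let ?q = "\<lambda>\<delta>::real. (\<gamma> - \<delta>) / (1 - (\<gamma> - \<delta>) * (1 - a)) - \<delta>"
    have den: "0 < 1 - \<gamma> * (1 - a)"
    proof -
      have "1 - \<gamma> * (1 - a) = \<gamma> * \<kappa>" using \<gamma>_range by (simp add: \<kappa>_def field_simps)
      then show ?thesis using \<gamma>_range \<kappa> by simp
    qed
    have tq: "(?q \<longlongrightarrow> (\<gamma> - 0) / (1 - (\<gamma> - 0) * (1 - a)) - 0) (at_right 0)"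
      using den by (intro tendsto_intros tendsto_ident_at) auto
    have q_lim: "(\<gamma> - 0) / (1 - (\<gamma> - 0) * (1 - a)) - 0 = 1 / \<kappa>"
      using \<gamma>_range \<kappa> den by (simp add: \<kappa>_def field_simps)
    have "((\<lambda>\<delta>. ?q \<delta> * (a - 2 * \<delta>)) \<longlongrightarrow> 1 / \<kappa> * (a - 2 * 0)) (at_right 0)"
      by (intro tendsto_intros tendsto_ident_at tq[unfolded q_lim])
    then have t1: "((\<lambda>\<delta>. ?q \<delta> * (a - 2 * \<delta>)) \<longlongrightarrow> a / \<kappa>) (at_right 0)" by simp
    have t2: "((\<lambda>\<delta>. ?p \<delta> * (1 - a)) \<longlongrightarrow> (\<gamma> - 0) * (1 - a)) (at_right 0)"
      by (intro tendsto_intros tendsto_ident_at)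
    have small: "eventually (\<lambda>\<delta>::real. 0 < \<delta> \<and> \<delta> < min (a / 2) (\<gamma> - 1)) (at_right 0)"
      using a_bounds \<gamma>_range by (auto simp: eventually_at_right_field intro!: exI[of _ "min (a / 2) (\<gamma> - 1)"])
    have "eventually (\<lambda>\<delta>. (0 < \<delta> \<and> \<delta> < min (a / 2) (\<gamma> - 1)) \<and> e < ?q \<delta> * (a - 2 * \<delta>) \<and> 0 < ?q \<delta> \<and> ?p \<delta> * (1 - a) < 1) (at_right 0)"
      using den \<kappa> by (intro eventually_conj small order_tendstoD(1)[OF t1 e] order_tendstoD(1)[OF tq[unfolded q_lim]]
        order_tendstoD(2)[OF t2]) auto
    then obtain \<delta> where \<delta>: "0 < \<delta>" "\<delta> < a / 2" "\<delta> < \<gamma> - 1" "e < ?q \<delta> * (a - 2 * \<delta>)" "0 < ?q \<delta>" "?p \<delta> * (1 - a) < 1"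
      using eventually_happens'[OF trivial_limit_at_right_real] by (metis (no_types, lifting) min_less_iff_conj)
    define p q s' where "p = ?p \<delta>" and "q = ?q \<delta>" and "s' = a - 2 * \<delta>"
    define w where "w = p * (1 - a)"
    have p: "1 < p" "p < \<gamma>" "p * (1 - a) < 1" using \<delta> by (auto simp: p_def)
    have w: "w < 1" using p by (simp add: w_def)
    have s: "0 < s'" "s' < a - \<delta>" "a - \<delta> < a" using \<delta> by (auto simp: s'_def)
    have q: "0 < q" "e < q * s'" using \<delta> by (auto simp: q_def s'_def)
    have pq: "0 < p - q * (1 - w)"
    proof -
      have "q = p / (1 - w) - \<delta>" by (simp add: q_def p_def w_def)
      then have "q * (1 - w) = p - \<delta> * (1 - w)" using w by (simp add: field_simps)
      then show ?thesis using \<delta>(1) w by simp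
    qed
    from localized[OF p s] obtain c N0 where c: "0 < c" "1 \<le> N0"
      and loc: "\<And>\<beta> N. 0 < \<beta> \<Longrightarrow> \<beta> \<le> 1 / 2 \<Longrightarrow> N0 \<le> N \<Longrightarrow> \<beta> powr p * real N powr (1 - p * (1 - a)) \<le> c \<Longrightarrow>
        \<exists>f>0. AE x in M. (\<lambda>n. 1 / real n * lnZ \<beta> (real N powr (- s')) n x) \<longlonglongrightarrow> f"
      by blast
    have ev1: "eventually (\<lambda>\<beta>::real. real N0 + 1 \<le> \<beta> powr (- q)) (at_right 0)"
      using q(1) by real_asymp
    have ev2: "eventually (\<lambda>\<beta>::real. \<beta> powr (p - q * (1 - w)) < c) (at_right 0)"
    proof -
      define r where "r = p - q * (1 - w)"
      have r: "0 < r" using pq by (simp add: r_def)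
      have "((\<lambda>\<beta>::real. \<beta> powr r) \<longlongrightarrow> 0) (at_right 0)" using r by real_asymp
      then show ?thesis unfolding r_def by (rule order_tendstoD) (rule c)
    qed
    have ev3: "eventually (\<lambda>\<beta>::real. \<beta> powr (q * s' - e) < 2 powr (- s')) (at_right 0)"
    proof -
      define r where "r = q * s' - e"
      have r: "0 < r" using q by (simp add: r_def)
      have "((\<lambda>\<beta>::real. \<beta> powr r) \<longlongrightarrow> 0) (at_right 0)" using r by real_asymp
      then show ?thesis unfolding r_def by (rule order_tendstoD) simp
    qed
    have ev4: "eventually (\<lambda>\<beta>::real. 0 < \<beta> \<and> \<beta> < 1 / 2) (at_right 0)"
      by (auto simp: eventually_at_right_field intro!: exI[of _ "1/2"])
    show ?thesis
      using ev1 ev2 ev3 ev4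
    proof eventually_elim
      case (elim \<beta>)
      have \<beta>: "0 < \<beta>" "\<beta> < 1" "\<beta> \<le> 1 / 2" using elim(4) by auto
      define N where "N = nat \<lfloor>\<beta> powr (- q)\<rfloor>"
      have b1: "2 \<le> \<beta> powr (- q)" using elim(1) c(2) by linarith
      have N: "real N \<le> \<beta> powr (- q)" "\<beta> powr (- q) / 2 \<le> real N"
        unfolding N_def using b1 by linarith+
      have "\<beta> powr (- q) < real N + 1" unfolding N_def using b1 by linarith
      then have N0: "N0 \<le> N" using elim(1) by linarith
      have Npos: "0 < real N" using N0 c(2) by simp
      have "\<beta> powr p * real N powr (1 - w) \<le> \<beta> powr p * (\<beta> powr (- q)) powr (1 - w)"
        using N w by (intro mult_left_mono powr_mono2) auto
      also have "\<dots> = \<beta> powr (p - q * (1 - w))" by (simp add: powr_powr powr_add[symmetric])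
      finally have "\<beta> powr p * real N powr (1 - p * (1 - a)) \<le> c" using elim(2) by (simp add: w_def)
      from loc[OF \<beta>(1,3) N0 this] obtain f where f: "0 < f"
        "AE x in M. (\<lambda>n. 1 / real n * lnZ \<beta> (real N powr (- s')) n x) \<longlonglongrightarrow> f" by blast
      have "real N powr (- s') \<in> {h. 0 < F \<beta> h}" using F[OF \<beta>(1,2) f(2)] f(1) by simp
      then have "hc \<beta> \<le> real N powr (- s')"
        unfolding hc_def using basic[OF \<beta>(1,2)] by (intro cInf_lower) auto
      also have "\<dots> \<le> (\<beta> powr (- q) / 2) powr (- s')"
        using N s b1 by (intro powr_mono2') auto
      also have "\<dots> = \<beta> powr (q * s') / 2 powr (- s')"
        using b1 by (simp add: powr_divide powr_powr)
      also have "\<beta> powr (q * s') = \<beta> powr e * \<beta> powr (q * s' - e)" by (simp add: powr_add[symmetric])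
      also have "\<beta> powr e * \<beta> powr (q * s' - e) / 2 powr (- s') < \<beta> powr e * 2 powr (- s') / 2 powr (- s')"
        using elim(3) \<beta> by (intro divide_strict_right_mono mult_strict_left_mono) auto
      also have "\<dots> = \<beta> powr e" by simp
      finally have "ln (hc \<beta>) < ln (\<beta> powr e)" using \<beta> basic[OF \<beta>(1,2)] by (subst ln_less_cancel_iff) auto
      then have "ln (hc \<beta>) < e * ln \<beta>" using \<beta> by (simp add: ln_powr)
      then show ?case using \<beta> by (simp add: less_divide_eq mult.commute)
    qed
  qed
  have "((\<lambda>\<beta>. ln (hc \<beta>) / ln \<beta>) \<longlongrightarrow> a / \<kappa>) (at_right 0)"
    by (rule order_tendstoI) (rule dn up, assumption)+
  then show ?thesis unfolding e0 using basic unfolding hc_def by auto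
qed

end

section \<open>Transfer to the given environment\<close>

context iid_environment
begin

lemma rv_\<omega>: "\<omega> n \<in> borel_measurable M"
  using environment_indep by (auto simp: indep_vars_def)

lemma AE_lower:
  assumes "prob {x \<in> space M. \<omega> 1 x \<ge> - 1} = 1"
  shows "AE x in M. \<forall>n. - 1 \<le> \<omega> n x"
proof -
  note [measurable] = rv_\<omega>
  have "AE x in M. - 1 \<le> \<omega> 1 x"
    using assms by (subst (asm) prob_Collect_eq_1) auto
  then have "AE y in distr M borel (\<omega> 1). - 1 \<le> y" by (subst AE_distr_iff) auto
  then have "AE x in M. - 1 \<le> \<omega> n x" for n
    unfolding environment_identical[of n, symmetric] by (subst (asm) AE_distr_iff) auto
  then show ?thesis by (simp add: AE_all_countable)
qed

text \<open>Truncation acts on each site separately, hence preserves independence and identical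
  laws, and it is almost surely the identity, hence preserves the mean.\<close>

lemma truncated_environment:
  assumes lower: "prob {x \<in> space M. \<omega> 1 x \<ge> - 1} = 1" and mean: "has_bochner_integral M (\<omega> 1) 0"
  shows "environment M (\<lambda>n x. max (- 1) (\<omega> n x))"
proof
  note [measurable] = rv_\<omega>
  show "indep_vars (\<lambda>_. borel) (\<lambda>n x. max (- 1) (\<omega> n x)) UNIV"
    by (rule indep_vars_compose2[OF environment_indep]) auto
  have distr: "distr M borel (\<lambda>x. max (- 1) (\<omega> n x)) = distr (distr M borel (\<omega> n)) borel (max (- 1))" for n
    by (subst distr_distr) (auto simp: comp_def)
  show "distr M borel (\<lambda>x. max (- 1) (\<omega> n x)) = distr M borel (\<lambda>x. max (- 1) (\<omega> 1 x))" for n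
    unfolding distr by (simp only: environment_identical[of n])
  have eq: "AE x in M. \<omega> 1 x = max (- 1) (\<omega> 1 x)"
    using AE_lower[OF lower] by eventually_elim (auto simp: max_def)
  have "has_bochner_integral M (\<lambda>x. max (- 1) (\<omega> 1 x)) 0"
    using mean by (subst has_bochner_integral_cong_AE[OF _ _ eq, symmetric]) auto
  then show "integrable M (\<lambda>x. max (- 1) (\<omega> 1 x))" "expectation (\<lambda>x. max (- 1) (\<omega> 1 x)) = 0"
    by (auto simp: has_bochner_integral_iff)
qed auto

end

theorem theorem2p4:
  fixes M :: "'a measure" and \<omega> :: "nat \<Rightarrow> 'a \<Rightarrow> real"
    and P :: "'b measure" and \<tau> :: "nat \<Rightarrow> 'b \<Rightarrow> nat" and K :: "nat \<Rightarrow> real"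
    and \<alpha> \<gamma> C_K C_P :: real
  assumes renewal: "renewal_process P \<tau> K"
    and K_tail: "C_K > 0" "asymp_equiv K at_top (\<lambda>n. C_K * real n powr (- (1 + \<alpha>)))"
    and environment: "iid_environment M \<omega>"
    and \<omega>_lower: "measure M {x \<in> space M. \<omega> 1 x \<ge> - 1} = 1"
    and \<omega>_mean: "has_bochner_integral M (\<omega> 1) 0"
    and \<omega>_tail: "C_P > 0"
      "asymp_equiv (\<lambda>u. measure M {x \<in> space M. \<omega> 1 x \<ge> u}) at_top (\<lambda>u. C_P * u powr (- \<gamma>))"
    and \<gamma>_range: "1 < \<gamma>" "\<gamma> < 2"
    and \<alpha>_range: "\<alpha> > 1 - 1 / \<gamma>"
  shows "(\<forall>\<beta>\<in>{0<..<1}. critical_point M \<omega> P \<tau> \<beta> > 0) \<and>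
    ((\<lambda>\<beta>. ln (critical_point M \<omega> P \<tau> \<beta>) / ln \<beta>) \<longlongrightarrow>
       (if \<alpha> < 1 then \<alpha> * \<gamma> / ((\<alpha> - 1) * \<gamma> + 1) else \<gamma>)) (at_right 0)"
proof -
  interpret ren: renewal_process P \<tau> K by (rule renewal)
  interpret iid: iid_environment M \<omega> by (rule environment)
  have "0 < 1 - 1 / \<gamma>" using \<gamma>_range by simp
  then have \<alpha>_pos: "0 < \<alpha>" using \<alpha>_range by simp
  have K'_tail: "ren.K' \<sim>[at_top] (\<lambda>n. C_K * real n powr (- (1 + \<alpha>)))"
    using K_tail(2)
  proof (rule asymp_equiv_transfer)
    show "\<forall>\<^sub>F n in at_top. K n = ren.K' n"
      using eventually_gt_at_top[of 0] by eventually_elim (simp add: ren.K'_def)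
  qed simp
  let ?\<omega> = "\<lambda>n x. max (- 1) (\<omega> n x)"
  have tail: "(\<lambda>t. measure M {x \<in> space M. ?\<omega> 1 x \<ge> t}) \<sim>[at_top] (\<lambda>t. C_P * t powr (- \<gamma>))"
    using \<omega>_tail(2)
  proof (rule asymp_equiv_transfer)
    show "\<forall>\<^sub>F t in at_top. measure M {x \<in> space M. \<omega> 1 x \<ge> t} = measure M {x \<in> space M. ?\<omega> 1 x \<ge> t}"
      using eventually_gt_at_top[of 0]
      by eventually_elim (auto intro!: arg_cong[where f = "measure M"])
  qed simp
  interpret env: environment M ?\<omega> by (rule iid.truncated_environment[OF \<omega>_lower \<omega>_mean])
  interpret pin: pinning ren.K' \<alpha> C_K M ?\<omega> C_P \<gamma>
    by unfold_locales (use \<alpha>_pos K_tail(1) K'_tail \<omega>_tail(1) \<gamma>_range tail in auto)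
  have lnZ: "AE x in M. \<forall>N. ln (partition_function P \<tau> (\<lambda>n. \<omega> n x) \<beta> h N) = pin.lnZ \<beta> h N x" for \<beta> h
    using iid.AE_lower[OF \<omega>_lower]
  proof eventually_elim
    case (elim x)
    then have "(\<lambda>i. exp h * (\<beta> * \<omega> i x + 1)) = env.wt \<beta> h (env.env x)"
      by (simp add: fun_eq_iff env.wt_def env.env_def max_absorb2)
    then show ?case by (simp add: ren.partition_function_eq pin.lnZ_def)
  qed
  \<comment> \<open>The definite description is resolved by uniqueness of limits: almost surely both
    limits hold, and \<open>g = f\<close> does not involve the sample point.\<close>
  have free_energy: "free_energy M \<omega> P \<tau> \<beta> h = f"
    if f: "AE x in M. (\<lambda>N. 1 / real N * pin.lnZ \<beta> h N x) \<longlonglongrightarrow> f" for \<beta> h f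
    unfolding free_energy_def
  proof (rule the_equality)
    show "AE x in M. (\<lambda>N. 1 / real N * ln (partition_function P \<tau> (\<lambda>n. \<omega> n x) \<beta> h N)) \<longlonglongrightarrow> f"
      using f lnZ[of \<beta> h] by eventually_elim simp
    fix g assume "AE x in M. (\<lambda>N. 1 / real N * ln (partition_function P \<tau> (\<lambda>n. \<omega> n x) \<beta> h N)) \<longlonglongrightarrow> g"
    then have "AE x in M. g = f"
      using f lnZ[of \<beta> h] by eventually_elim (auto intro: LIMSEQ_unique)
    then show "g = f" by simp
  qed
  show ?thesis
    unfolding critical_point_def
    by (rule pin.critical_asymptotics[OF \<alpha>_range]) (rule free_energy)
qed

end
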